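(* Let $\mathcal I$ be a thick affine (or vectorial) building, $A$ an apartment of $\mathcal I$, and $[z,x,x_1,\dots,x_n,y,z]$ a polygon in $A$. Let $\pi:[0,1]\to A$ be a piecewise linear, constant speed parametrization of the broken line $[x,x_1,\dots,x_n,y]$, with $x_i=\pi(t_i)$. Let $\mathfrak a$ be an alcove of $A$ containing $z$, and let $\rho=\rho_{A,\mathfrak a}$ be the retraction of $\mathcal I$ onto $A$ centered at $\mathfrak a$. For $i\in\{1,\dots,n\}$ let $\vec a_{x_i}$ be the chamber of $\overrightarrow{Ax_i}$ which contains all the vectors $\overrightarrow{x_iz'}$ with $z'\in\mathfrak a$. Then the polygon $[z,x,x_1,\dots,x_n,y,z]$ is the image under $\rho$ of a geodesic triangle $[z,x,\tilde y,z]$ of $\mathcal I$ if and only if, for every $i\in\{1,\dots,n\}$, there exists a $(W^v_{\pi(t_i)},\vec a_{x_i})$-chain from $\pi'_-(t_i)$ to $\pi'_+(t_i)$.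
   Context: Buildings. The model apartment $\mathbb A$ is a Euclidean affine space with direction the Euclidean space $V$, equipped with the set $\mathcal M$ of walls $M(\alpha,k)=\{x\mid \alpha(x)+k=0\}$, $\alpha\in\Phi$, $k\in\mathbb Z$, where $\Phi\subset V^*$ is a root system with finite Weyl group $W^v$ acting isometrically on $V$ (in the vectorial case only the walls with $k=0$ are kept). The affine Weyl group $W^a$ is generated by the orthogonal reflections in the walls; alcoves are the closures of the connected components of the complement of the walls (in the vectorial case: the Weyl chambers). An affine (or vectorial) building $\mathcal I$ is a metric space covered by apartments isometric to $\mathbb A$ (by isometries unique up to $W^a$), in which any two alcoves lie in a common apartment, unique up to an isomorphism fixing both alcoves pointwise. It is thick if every panel (codimension one face of an alcove) lies in at least three alcoves. Retraction. For an alcove $\mathfrak a$ in an apartment $A$, $\rho_{A,\mathfrak a}:\mathcal I\to A$ sends $x$ to $\varphi(x)$, where $B$ is any apartment containing $\mathfrak a$ and $x$ and $\varphi:B\to A$ is the isomorphism fixing $\mathfrak a$ pointwise. Paths and triangles. Here $0<t_1<\dots<t_n<1$, $\pi(0)=x$, $\pi(1)=y$, $\pi$ is affine on each interval cut out by the $t_i$, its derivative has constant norm, and $\pi'_-(t)$, $\pi'_+(t)$ are the left and right derivatives. "The polygon is the image under $\rho$ of a triangle $[z,x,\tilde y,z]$" means that there is $\tilde y\in\mathcal I$ such that, if $\tilde\pi:[0,1]\to\mathcal I$ is the constant speed parametrization of the geodesic segment $[x,\tilde y]$, then $\rho\circ\tilde\pi=\pi$ (the sides $[z,x]$ and $[\tilde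 y,z]$ being sent to $[z,x]$ and $[y,z]$). Local notions. For $p\in A$, $\overrightarrow{Ap}$ is the vector space directing $A$ (origin at $p$), with walls the directions of the walls of $A$ passing through $p$; $W^v_p$ is the finite group generated by the linear reflections in these hyperplanes; the chambers of $\overrightarrow{Ap}$ are the closures of the connected components of the complement of these hyperplanes. Given a chamber $D$ of $\overrightarrow{Ap}$, a $(W^v_p,D)$-chain from $\eta$ to $\eta'$ is a finite sequence $\eta=\eta_0,\eta_1,\dots,\eta_m=\eta'$ of vectors of $\overrightarrow{Ap}$ together with reflections $\tau_1,\dots,\tau_m$ in walls $H_1,\dots,H_m$ of $\overrightarrow{Ap}$ such that $\eta_j=\tau_j(\eta_{j-1})$, $\eta_{j-1}\notin H_j$, and $\eta_{j-1}$ and $D$ lie on the same side of $H_j$ (so $\eta_j$ lies strictly on the other side); $m=0$ is allowed. *)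

theory Defs
  imports "HOL-Analysis.Analysis"
begin

text \<open>
  The model apartment is the Euclidean space \<open>'v\<close> itself, with its origin and its inner product.
  The dual of \<open>'v\<close> is identified with \<open>'v\<close> through the inner product: a root \<open>\<alpha>\<close> is represented by
  the vector \<open>a\<close> with \<open>\<alpha> v = a \<bullet> v\<close>. Since the Weyl group acts isometrically, the reflection
  attached to \<open>\<alpha>\<close> is the orthogonal one, and \<open>\<langle>\<beta>, \<alpha>\<^sup>\<or>\<rangle> = 2 (a \<bullet> b) / (a \<bullet> a)\<close>.
\<close>

definition wall :: "'v::real_inner \<Rightarrow> real \<Rightarrow> 'v set" where
  "wall a k = {v. a \<bullet> v + k = 0}"

definition reflection :: "'v::real_inner \<Rightarrow> real \<Rightarrow> 'v \<Rightarrow> 'v" where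
  "reflection a k v = v - (2 * (a \<bullet> v + k) / (a \<bullet> a)) *\<^sub>R a"

definition root_system :: "'v::real_inner set \<Rightarrow> bool" where
  "root_system \<Phi> \<longleftrightarrow>
     finite \<Phi> \<and> 0 \<notin> \<Phi> \<and> span \<Phi> = UNIV \<and>
     (\<forall>a\<in>\<Phi>. reflection a 0 ` \<Phi> = \<Phi>) \<and>
     (\<forall>a\<in>\<Phi>. \<forall>b\<in>\<Phi>. 2 * (a \<bullet> b) / (a \<bullet> a) \<in> \<int>)"

datatype building_kind = Affine | Vectorial

fun levels :: "building_kind \<Rightarrow> real set" where
  "levels Affine = \<int>"
| "levels Vectorial = {0}"

definition walls :: "building_kind \<Rightarrow> 'v::real_inner set \<Rightarrow> 'v set set" where
  "walls ty \<Phi> = {wall a k | a k. a \<in> \<Phi> \<and> k \<in> levels ty}"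

text \<open>
  The affine Weyl group (the finite Weyl group in the vectorial case). The generators are
  involutions, so closure under inverses need not be required.
\<close>

inductive_set weyl_group :: "building_kind \<Rightarrow> 'v::real_inner set \<Rightarrow> ('v \<Rightarrow> 'v) set"
  for ty :: building_kind and \<Phi> :: "'v set"
where
  "id \<in> weyl_group ty \<Phi>"
| "a \<in> \<Phi> \<Longrightarrow> k \<in> levels ty \<Longrightarrow> w \<in> weyl_group ty \<Phi> \<Longrightarrow> reflection a k \<circ> w \<in> weyl_group ty \<Phi>"

definition closed_chambers :: "'v::real_inner set set \<Rightarrow> 'v set set" where
  "closed_chambers \<H> = closure ` components (- \<Union>\<H>)"

text \<open>
  The apartments of a building are given by an atlas \<open>At\<close>: the set of all the distinguished
  isometries from the model apartment onto the apartments.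
\<close>

definition apartments :: "('v \<Rightarrow> 'i) set \<Rightarrow> 'i set set" where
  "apartments At = range ` At"

definition alcoves_of ::
  "building_kind \<Rightarrow> 'v::real_inner set \<Rightarrow> ('v \<Rightarrow> 'i) set \<Rightarrow> 'i set \<Rightarrow> 'i set set" where
  "alcoves_of ty \<Phi> At A =
     {f ` C | f C. f \<in> At \<and> range f = A \<and> C \<in> closed_chambers (walls ty \<Phi>)}"

definition alcoves ::
  "building_kind \<Rightarrow> 'v::real_inner set \<Rightarrow> ('v \<Rightarrow> 'i) set \<Rightarrow> 'i set set" where
  "alcoves ty \<Phi> At = (\<Union>A\<in>apartments At. alcoves_of ty \<Phi> At A)"

definition panels ::
  "building_kind \<Rightarrow> 'v::euclidean_space set \<Rightarrow> ('v \<Rightarrow> 'i) set \<Rightarrow> 'i set set" where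
  "panels ty \<Phi> At =
     {f ` F | f C F. f \<in> At \<and> C \<in> closed_chambers (walls ty \<Phi>) \<and> F facet_of C}"

text \<open>Only the values of \<open>\<phi>\<close> on \<open>A\<close> matter.\<close>

definition apartment_iso :: "('v \<Rightarrow> 'i) set \<Rightarrow> 'i set \<Rightarrow> 'i set \<Rightarrow> ('i \<Rightarrow> 'i) \<Rightarrow> bool" where
  "apartment_iso At A B \<phi> \<longleftrightarrow>
     (\<exists>f\<in>At. range f = A \<and> \<phi> \<circ> f \<in> At \<and> range (\<phi> \<circ> f) = B)"

locale building =
  fixes ty :: building_kind
    and \<Phi> :: "'v::euclidean_space set"
    and At :: "('v \<Rightarrow> 'i::metric_space) set"
  assumes root_system: "root_system \<Phi>"
    and chart_isometry: "f \<in> At \<Longrightarrow> dist (f u) (f v) = dist u v"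
    and chart_comp_weyl: "f \<in> At \<Longrightarrow> w \<in> weyl_group ty \<Phi> \<Longrightarrow> f \<circ> w \<in> At"
    and chart_unique:
      "f \<in> At \<Longrightarrow> g \<in> At \<Longrightarrow> range f = range g \<Longrightarrow> \<exists>w\<in>weyl_group ty \<Phi>. g = f \<circ> w"
    and apartments_cover: "\<Union>(apartments At) = UNIV"
    and common_apartment:
      "a \<in> alcoves ty \<Phi> At \<Longrightarrow> b \<in> alcoves ty \<Phi> At \<Longrightarrow> \<exists>A\<in>apartments At. a \<subseteq> A \<and> b \<subseteq> A"
    and common_apartment_unique:
      "a \<in> alcoves ty \<Phi> At \<Longrightarrow> b \<in> alcoves ty \<Phi> At \<Longrightarrow>
       A \<in> apartments At \<Longrightarrow> a \<subseteq> A \<Longrightarrow> b \<subseteq> A \<Longrightarrow>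
       B \<in> apartments At \<Longrightarrow> a \<subseteq> B \<Longrightarrow> b \<subseteq> B \<Longrightarrow>
       \<exists>\<phi>. apartment_iso At A B \<phi> \<and> (\<forall>p\<in>a \<union> b. \<phi> p = p)"

locale thick_building = building +
  assumes thick:
    "P \<in> panels ty \<Phi> At \<Longrightarrow>
     \<exists>a\<in>alcoves ty \<Phi> At. \<exists>b\<in>alcoves ty \<Phi> At. \<exists>c\<in>alcoves ty \<Phi> At.
       a \<noteq> b \<and> a \<noteq> c \<and> b \<noteq> c \<and> P \<subseteq> a \<and> P \<subseteq> b \<and> P \<subseteq> c"

definition retraction_at ::
  "('v \<Rightarrow> 'i) set \<Rightarrow> 'i set \<Rightarrow> 'i set \<Rightarrow> 'i \<Rightarrow> 'i" where
  "retraction_at At A \<aa> p =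
     (THE q. \<exists>B \<phi>. B \<in> apartments At \<and> \<aa> \<subseteq> B \<and> p \<in> B \<and>
        apartment_iso At B A \<phi> \<and> (\<forall>u\<in>\<aa>. \<phi> u = u) \<and> q = \<phi> p)"

definition geodesic_path :: "(real \<Rightarrow> 'i::metric_space) \<Rightarrow> 'i \<Rightarrow> 'i \<Rightarrow> bool" where
  "geodesic_path \<gamma> p q \<longleftrightarrow>
     \<gamma> 0 = p \<and> \<gamma> 1 = q \<and>
     (\<forall>s\<in>{0..1}. \<forall>t\<in>{0..1}. dist (\<gamma> s) (\<gamma> t) = dist p q * \<bar>s - t\<bar>)"

text \<open>
  The polygon with vertices \<open>z\<close>, \<open>x\<close>, \<open>y\<close>, whose broken side from \<open>x\<close> to \<open>y\<close> is parametrized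
  by \<open>\<pi>\<close>, is the image under \<open>\<rho>\<close> of a geodesic triangle with vertices \<open>z\<close>, \<open>x\<close>, \<open>y'\<close>.
\<close>

definition image_of_geodesic_triangle ::
  "('i::metric_space \<Rightarrow> 'i) \<Rightarrow> 'i \<Rightarrow> 'i \<Rightarrow> 'i \<Rightarrow> (real \<Rightarrow> 'i) \<Rightarrow> bool" where
  "image_of_geodesic_triangle \<rho> z x y \<pi> \<longleftrightarrow>
     (\<exists>y' \<gamma> \<sigma> \<tau>.
        geodesic_path \<gamma> x y' \<and> (\<forall>s\<in>{0..1}. \<rho> (\<gamma> s) = \<pi> s) \<and>
        geodesic_path \<sigma> z x \<and> geodesic_path (\<rho> \<circ> \<sigma>) z x \<and>
        geodesic_path \<tau> y' z \<and> geodesic_path (\<rho> \<circ> \<tau>) y z)"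

text \<open>
  A chart \<open>f\<close> of an apartment \<open>A\<close> identifies \<open>A\<close> with the model apartment. The vector from \<open>p\<close> to
  \<open>q\<close>, for \<open>p\<close> and \<open>q\<close> in \<open>A\<close>, is then \<open>coord f q - coord f p\<close>. Another chart of \<open>A\<close> changes the
  coordinates by an element of the Weyl group, which permutes the walls.
\<close>

definition coord :: "('v \<Rightarrow> 'i) \<Rightarrow> 'i \<Rightarrow> 'v" where
  "coord f = inv f"

definition affine_on :: "real set \<Rightarrow> (real \<Rightarrow> 'v::real_vector) \<Rightarrow> bool" where
  "affine_on S g \<longleftrightarrow> (\<exists>u v. \<forall>s\<in>S. g s = u + s *\<^sub>R v)"

text \<open>
  The break points are \<open>t 1 < \<dots> < t n\<close>, completed by \<open>t 0 = 0\<close> and \<open>t (n + 1) = 1\<close>.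
\<close>

definition broken_line_param ::
  "('v::real_normed_vector \<Rightarrow> 'i) \<Rightarrow> nat \<Rightarrow> (nat \<Rightarrow> real) \<Rightarrow> (real \<Rightarrow> 'i) \<Rightarrow> bool" where
  "broken_line_param f n t \<pi> \<longleftrightarrow>
     t 0 = 0 \<and> t (Suc n) = 1 \<and> (\<forall>i\<le>n. t i < t (Suc i)) \<and>
     \<pi> ` {0..1} \<subseteq> range f \<and>
     (\<forall>i\<le>n. affine_on {t i..t (Suc i)} (coord f \<circ> \<pi>)) \<and>
     (\<exists>c. \<forall>s\<in>{0..1} - t ` {0..Suc n}. norm (vector_derivative (coord f \<circ> \<pi>) (at s)) = c)"

text \<open>In the following definitions the point \<open>p\<close> is given by its coordinates.\<close>

definition local_roots :: "building_kind \<Rightarrow> 'v::real_inner set \<Rightarrow> 'v \<Rightarrow> 'v set" where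
  "local_roots ty \<Phi> p = {a \<in> \<Phi>. \<exists>k\<in>levels ty. p \<in> wall a k}"

definition local_chambers :: "building_kind \<Rightarrow> 'v::real_inner set \<Rightarrow> 'v \<Rightarrow> 'v set set" where
  "local_chambers ty \<Phi> p = closed_chambers {wall a 0 | a. a \<in> local_roots ty \<Phi> p}"

definition same_side :: "'v::real_inner \<Rightarrow> 'v \<Rightarrow> 'v set \<Rightarrow> bool" where
  "same_side b \<eta> D \<longleftrightarrow>
     (\<forall>d\<in>insert \<eta> D. 0 \<le> b \<bullet> d) \<or> (\<forall>d\<in>insert \<eta> D. b \<bullet> d \<le> 0)"

text \<open>The wall \<open>H\<^sub>j\<close> of a chain is \<open>wall (b j) 0\<close>.\<close>

definition weyl_chain ::
  "building_kind \<Rightarrow> 'v::real_inner set \<Rightarrow> 'v \<Rightarrow> 'v set \<Rightarrow> 'v \<Rightarrow> 'v \<Rightarrow> bool" where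
  "weyl_chain ty \<Phi> p D \<eta> \<eta>' \<longleftrightarrow>
     (\<exists>m e b. e (0::nat) = \<eta> \<and> e m = \<eta>' \<and>
        (\<forall>j\<in>{1..m}. b j \<in> local_roots ty \<Phi> p \<and>
           e j = reflection (b j) 0 (e (j - 1)) \<and>
           e (j - 1) \<notin> wall (b j) 0 \<and> same_side (b j) (e (j - 1)) D))"

end

(*
  The retraction is determined by distances: it sends q to the point of A at the same distance
  from every point of the alcove. This makes it isometric on alcoves, hence 1-Lipschitz, which
  yields unique geodesics and the CAT(0) inequality; so only the break points matter.

  At a break point p, let the incoming germ have direction \<eta> and the outgoing one \<eta>', both read
  through the retraction. That a pair of opposite germs in the building retracts to (\<eta>, \<eta>') exactly
  when there is a chain from \<eta> to \<eta>' is proved by induction on the number of walls separating \<eta>'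
  from the local chamber D: one moves the base chamber across a wall \<alpha> of D that separates D from
  \<eta>'. The incoming direction then becomes s\<^sub>\<alpha> \<eta>, or stays \<eta> if \<alpha>(\<eta>) > 0 and the new base chamber
  is not the one facing the incoming germ; thickness supplies such a chamber. On the side of chains
  this is the lifting property of the Bruhat order.
*)
theory Submission
  imports Defs
begin

section \<open>The model apartment\<close>

text \<open>In coordinates the base alcove never moves. Crossing the wall of \<alpha> replaces a
  chart \<open>f\<close> by its composite with the reflection in that wall, so the new base alcove
  is again the image of \<open>cell u\<close>: \<open>p\<close>, \<open>u\<close> and the positive
  local roots stay the same throughout the induction, and only the directions are reflected.

  The induction needs a base alcove that contains the break point \<open>p\<close>, whereas the
  centre of the retraction may be far from it. The alcove \<open>cell u\<close> is therefore
  replaced by its projection to \<open>p\<close>, the alcove met when leaving \<open>p\<close>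
  towards \<open>u\<close>. Convexity of apartments shows that charts which agree on
  \<open>cell u\<close> and at \<open>p\<close> also agree on this projection, and the local chamber
  at \<open>p\<close> is the same for both.

  Opposite germs only make the lifted path geodesic near each break; that it is geodesic as a whole
  comes from contracting both sides towards the break point, by the CAT(0) inequality.

  The affine and vectorial cases are treated at once: the levels enter only through
  \<open>levels_Ints\<close>, \<open>levels_diff_mult\<close> and
  \<open>levels_uminus\<close>.\<close>

lemma mult_pos_nonneg_iff:
  fixes p q r :: real
  assumes "0 < p * q"
  shows "0 \<le> p * r \<longleftrightarrow> 0 \<le> q * r"
  using assms by (auto simp: zero_le_mult_iff zero_less_mult_iff)

lemma mult_pos_trans:
  fixes p q r :: real
  shows "0 < p * q \<Longrightarrow> 0 < p * r \<Longrightarrow> 0 < q * r"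
  by (auto simp: zero_less_mult_iff)

lemma sign_change_zero:
  assumes "connected T" "u \<in> T" "v \<in> T" "(a \<bullet> u + k) * (a \<bullet> v + k) \<le> 0"
  shows "\<exists>w\<in>T. a \<bullet> w + k = (0::real)"
proof -
  from assms(4) consider "a \<bullet> u \<le> -k" "-k \<le> a \<bullet> v" | "a \<bullet> v \<le> -k" "-k \<le> a \<bullet> u"
    by (fastforce simp: mult_le_0_iff)
  then have "\<exists>w\<in>T. a \<bullet> w = -k"
    by cases (use assms connected_ivt_hyperplane in blast)+
  then show ?thesis by force
qed

text \<open>A connected set that misses a wall stays on one side of it, which gives one inclusion.
  For the other, the right-hand side is an intersection of open half-spaces, hence convex, and it
  misses every wall. \<open>S\<close> may be infinite, as it is for affine walls.\<close>

lemma connected_component_off_walls: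
  fixes S :: "('v::euclidean_space \<times> real) set"
  assumes u: "\<forall>(a,k)\<in>S. a \<bullet> u + k \<noteq> 0"
  shows "connected_component_set (- \<Union>{wall a k |a k. (a,k) \<in> S}) u
           = {v. \<forall>(a,k)\<in>S. 0 < (a \<bullet> u + k) * (a \<bullet> v + k)}" (is "connected_component_set ?U u = ?C")
proof
  show "connected_component_set ?U u \<subseteq> ?C"
  proof
    fix v assume "v \<in> connected_component_set ?U u"
    then obtain T where T: "connected T" "T \<subseteq> ?U" "u \<in> T" "v \<in> T"
      by (auto simp: connected_component_def)
    have "0 < (a \<bullet> u + k) * (a \<bullet> v + k)" if "(a,k) \<in> S" for a k
    proof (rule ccontr)
      assume "\<not> ?thesis"
      then obtain w where "w \<in> T" "a \<bullet> w + k = 0"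
        using sign_change_zero[OF T(1,3,4), of a k] by (auto simp: not_less)
      then show False using T(2) that by (auto simp: wall_def)
    qed
    then show "v \<in> ?C" by auto
  qed
  have "?C = (\<Inter>(a,k)\<in>S. {v. 0 < (a \<bullet> u + k) * (a \<bullet> v + k)})" by auto
  moreover have "convex {v. 0 < c * (a \<bullet> v + k)}" for a :: 'v and c k :: real
  proof -
    have "{v. 0 < c * (a \<bullet> v + k)} = {v. (c *\<^sub>R a) \<bullet> v > - c * k}"
      by (auto simp: algebra_simps)
    then show ?thesis using convex_halfspace_gt by metis
  qed
  ultimately have "convex ?C" by (auto intro!: convex_INT)
  moreover have "u \<in> ?C" using u by (auto simp: zero_less_mult_iff not_less order.order_iff_strict)
  moreover have "?C \<subseteq> ?U" by (force simp: wall_def)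
  ultimately show "?C \<subseteq> connected_component_set ?U u"
    by (intro connected_component_maximal convex_connected)
qed

text \<open>Weak inequalities describe the closure because a point that satisfies them becomes
  strictly interior as soon as it moves towards \<open>u\<close>.\<close>

lemma closed_chambers_hyperplanes:
  fixes S :: "('v::euclidean_space \<times> real) set"
  shows "closed_chambers {wall a k |a k. (a,k) \<in> S} =
    {{v. \<forall>(a,k)\<in>S. 0 \<le> (a \<bullet> u + k) * (a \<bullet> v + k)} | u. \<forall>(a,k)\<in>S. a \<bullet> u + k \<noteq> 0}"
proof -
  let ?U = "- \<Union>{wall a k |a k. (a,k) \<in> S}"
  have U: "u \<in> ?U \<longleftrightarrow> (\<forall>(a,k)\<in>S. a \<bullet> u + k \<noteq> 0)" for u
    by (auto simp: wall_def)
  have cl: "closure (connected_component_set ?U u)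
      = {v. \<forall>(a,k)\<in>S. 0 \<le> (a \<bullet> u + k) * (a \<bullet> v + k)}" (is "_ = ?K")
    if u: "\<forall>(a,k)\<in>S. a \<bullet> u + k \<noteq> 0" for u
  proof -
    let ?C = "{v. \<forall>(a,k)\<in>S. 0 < (a \<bullet> u + k) * (a \<bullet> v + k)}"
    have "?K = (\<Inter>(a,k)\<in>S. {v. 0 \<le> (a \<bullet> u + k) * (a \<bullet> v + k)})" by auto
    then have "closed ?K"
      by (auto intro!: closed_INT closed_Collect_le continuous_intros)
    then have 1: "closure ?C \<subseteq> ?K"
      by (intro closure_minimal) force+
    have "v \<in> closure ?C" if v: "v \<in> ?K" for v
    proof -
      have lim: "((\<lambda>s. v + s *\<^sub>R (u - v)) \<longlongrightarrow> v + 0 *\<^sub>R (u - v)) (at_right 0)"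
        by (intro tendsto_intros)
      have "\<forall>\<^sub>F s in at_right (0::real). v + s *\<^sub>R (u - v) \<in> ?C"
      proof -
        have "v + s *\<^sub>R (u - v) \<in> ?C" if s: "0 < s" "s < 1" for s
        proof -
          have "0 < (a \<bullet> u + k) * (a \<bullet> (v + s *\<^sub>R (u - v)) + k)" if "(a,k) \<in> S" for a k
          proof -
            have "(a \<bullet> u + k) * (a \<bullet> (v + s *\<^sub>R (u - v)) + k)
              = (1 - s) * ((a \<bullet> u + k) * (a \<bullet> v + k)) + s * (a \<bullet> u + k)\<^sup>2"
              by (simp add: inner_add_right inner_diff_right algebra_simps power2_eq_square)
            moreover have "0 \<le> (1 - s) * ((a \<bullet> u + k) * (a \<bullet> v + k))" using v s that by force
            moreover have "0 < s * (a \<bullet> u + k)\<^sup>2" using u s that by fastforce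
            ultimately show ?thesis by linarith
          qed
          then show ?thesis by auto
        qed
        then show ?thesis by (auto simp: eventually_at_right_field intro!: exI[of _ 1])
      qed
      then have "\<forall>\<^sub>F s in at_right (0::real). v + s *\<^sub>R (u - v) \<in> closure ?C"
        by eventually_elim (rule subsetD[OF closure_subset])
      then have "v + 0 *\<^sub>R (u - v) \<in> closure ?C"
        by (rule Lim_in_closed_set[OF closed_closure _ trivial_limit_at_right_real lim])
      then show ?thesis by simp
    qed
    with 1 show ?thesis unfolding connected_component_off_walls[OF u] by blast
  qed
  have "closed_chambers {wall a k |a k. (a,k) \<in> S}
      = (\<lambda>u. closure (connected_component_set ?U u)) ` ?U"
    unfolding closed_chambers_def components_def by (simp only: image_image)
  also have "\<dots> = (\<lambda>u. {v. \<forall>(a,k)\<in>S. 0 \<le> (a \<bullet> u + k) * (a \<bullet> v + k)}) ` ?U"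
    using cl U by (intro image_cong) auto
  also have "\<dots> = {{v. \<forall>(a,k)\<in>S. 0 \<le> (a \<bullet> u + k) * (a \<bullet> v + k)} | u. \<forall>(a,k)\<in>S. a \<bullet> u + k \<noteq> 0}"
    unfolding image_def Bex_def U by blast
  finally show ?thesis .
qed

section \<open>Levels, local finiteness of the walls, generic vectors\<close>

lemma levels_Ints: "k \<in> levels ty \<Longrightarrow> k \<in> \<int>"
  by (cases ty) auto

text \<open>A reflection of level \<open>k\<close> exchanges walls of levels \<open>l\<close> and
  \<open>l - k * m\<close>, with \<open>m\<close> a Cartan integer; see
  \<open>inner_reflection_root\<close>.\<close>

lemma levels_diff_mult: "k \<in> levels ty \<Longrightarrow> l \<in> levels ty \<Longrightarrow> m \<in> \<int> \<Longrightarrow> l - k * m \<in> levels ty"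
  by (cases ty) auto

lemma levels_uminus: "k \<in> levels ty \<Longrightarrow> - k \<in> levels ty"
  by (cases ty) auto

text \<open>The integers \<open>k\<close> with \<open>y + k \<noteq> 0\<close> form a closed set
  that avoids \<open>- y\<close>, so one radius serves all of them at once.\<close>

lemma eventually_same_side_Ints:
  fixes y :: real
  shows "\<forall>\<^sub>F x in nhds y. \<forall>k\<in>\<int>. y + k \<noteq> 0 \<longrightarrow> 0 < (y + k) * (x + k)"
proof -
  have "closed ((of_int :: int \<Rightarrow> real) ` {m. y + of_int m \<noteq> 0})" (is "closed ?Z")
    by (rule closed_of_int_image)
  moreover have "-y \<notin> ?Z" by auto
  ultimately obtain e where e: "0 < e" "ball (-y) e \<inter> ?Z = {}"
    by (metis (no_types, lifting) ComplI Int_commute disjoint_eq_subset_Compl open_Compl openE)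
  have "\<forall>\<^sub>F x in nhds y. dist x y < e" using e(1) eventually_nhds_metric by blast
  then show ?thesis
  proof eventually_elim
    case (elim x)
    show ?case
    proof (intro ballI impI)
      fix k :: real assume k: "k \<in> \<int>" "y + k \<noteq> 0"
      then have "k \<in> ?Z" by (auto elim!: Ints_cases)
      then have "e \<le> \<bar>y + k\<bar>" using e(2) by (force simp: dist_real_def)
      with elim show "0 < (y + k) * (x + k)"
        by (auto simp: dist_real_def zero_less_mult_iff abs_if split: if_splits)
    qed
  qed
qed

lemma tendsto_line: "((\<lambda>s. p + s *\<^sub>R v) \<longlongrightarrow> p) (at_right (0::real))" for p v :: "'a::real_normed_vector"
proof -
  have "((\<lambda>s. p + s *\<^sub>R v) \<longlongrightarrow> p + 0 *\<^sub>R v) (at_right (0::real))"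
    by (intro tendsto_intros)
  then show ?thesis by simp
qed

lemma eventually_line:
  fixes p v :: "'a::real_normed_vector"
  assumes "\<forall>\<^sub>F q in nhds p. P q"
  shows "\<forall>\<^sub>F s in at_right (0::real). P (p + s *\<^sub>R v)"
  using assms tendsto_line[of p v] by (simp add: filterlim_iff)

lemma eventually_pos: "\<forall>\<^sub>F s in at_right (0::real). 0 < s"
  by (simp add: eventually_at_filter)

lemma eventually_less_right: "0 < e \<Longrightarrow> \<forall>\<^sub>F s in at_right (0::real). s < e"
  by (metis eventually_at_right_field)

text \<open>A finite union of hyperplanes is negligible, so it contains no nonempty open
  set.\<close>

lemma exists_off_hyperplanes:
  fixes N :: "'a::euclidean_space set"
  assumes "open U" "U \<noteq> {}" "finite N" "0 \<notin> N"
  shows "\<exists>w\<in>U. \<forall>n\<in>N. n \<bullet> w \<noteq> 0"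
proof (rule ccontr)
  assume "\<not> ?thesis"
  then have "U \<subseteq> (\<Union>n\<in>N. {x. n \<bullet> x = 0})" by auto
  moreover have "negligible (\<Union>n\<in>N. {x. n \<bullet> x = 0})"
    using assms(3,4) by (intro negligible_Union) (auto intro!: negligible_hyperplane)
  ultimately show False using open_not_negligible assms(1,2) negligible_subset by blast
qed

section \<open>Orthogonal reflections\<close>

lemma reflection_dist: "dist (reflection a k u) (reflection a k v) = dist u v"
  for a :: "'a::real_inner"
proof (cases "a = 0")
  case True then show ?thesis by (simp add: reflection_def)
next
  case False
  define d c where "d = u - v" and "c = 2 * (a \<bullet> d) / (a \<bullet> a)"
  have c: "c * (a \<bullet> a) = 2 * (a \<bullet> d)" using False by (simp add: c_def)
  have "reflection a k u - reflection a k v = d - c *\<^sub>R a"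
    by (simp add: reflection_def d_def c_def inner_diff_right diff_divide_distrib add_divide_distrib
        scaleR_diff_left scaleR_add_left right_diff_distrib distrib_left)
  moreover have "(d - c *\<^sub>R a) \<bullet> (d - c *\<^sub>R a) = d \<bullet> d - 2 * c * (a \<bullet> d) + c * (c * (a \<bullet> a))"
    by (simp add: inner_diff_left inner_diff_right inner_commute algebra_simps)
  ultimately show ?thesis unfolding dist_norm norm_eq_sqrt_inner c d_def by simp
qed

lemma inner_reflection:
  "a \<noteq> 0 \<Longrightarrow> a \<bullet> reflection a k v + k = - (a \<bullet> v + k)" for a :: "'a::real_inner"
  by (simp add: reflection_def inner_diff_right)

lemma reflection_invol: "reflection a k (reflection a k v) = v" for a :: "'a::real_inner"
proof (cases "a = 0")
  case False
  have "reflection a k (reflection a k v)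
      = reflection a k v - (2 * (a \<bullet> reflection a k v + k) / (a \<bullet> a)) *\<^sub>R a"
    by (simp only: reflection_def[of a k "reflection a k v"])
  also have "\<dots> = reflection a k v + (2 * (a \<bullet> v + k) / (a \<bullet> a)) *\<^sub>R a"
    by (simp only: inner_reflection[OF False] mult_minus_right minus_divide_left[symmetric] scaleR_minus_left
        diff_minus_eq_add)
  also have "\<dots> = v" by (simp add: reflection_def)
  finally show ?thesis .
qed (simp add: reflection_def)

lemma reflection_fix: "a \<bullet> v + k = 0 \<Longrightarrow> reflection a k v = v"
  by (simp add: reflection_def)

lemma inner_reflection_swap: "b \<bullet> reflection a 0 v = reflection a 0 b \<bullet> v"
  by (simp add: reflection_def inner_diff_left inner_diff_right inner_commute)

lemma reflection_line:
  "a \<bullet> p + k = 0 \<Longrightarrow> reflection a k (p + s *\<^sub>R v) = p + s *\<^sub>R reflection a 0 v"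
  by (simp add: reflection_def inner_add_right algebra_simps)

lemma reflection_line_diff:
  "a \<bullet> p + k = 0 \<Longrightarrow> reflection a k (p - s *\<^sub>R v) = p - s *\<^sub>R reflection a 0 v"
  using reflection_line[of a p k "-s" v] by simp

lemma reflection_scaled: "c \<noteq> 0 \<Longrightarrow> reflection (c *\<^sub>R a) 0 v = reflection a 0 v"
  by (simp add: reflection_def)

lemma norm_reflection: "norm (reflection a 0 v) = norm v" for a :: "'a::real_inner"
  using reflection_dist[of a 0 v 0] by (simp add: reflection_def dist_norm)

lemma reflection_surj: "range (reflection a k) = UNIV" for a :: "'a::real_inner"
  by (metis reflection_invol surjI)

section \<open>Alcoves of the model apartment\<close>

locale root_datum =
  fixes ty :: building_kind and \<Phi> :: "'v::euclidean_space set"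
  assumes roots: "root_system \<Phi>"
begin

lemma finite_roots: "finite \<Phi>" and zero_not_root: "0 \<notin> \<Phi>"
  using roots by (auto simp: root_system_def)

lemma root_nonzero: "a \<in> \<Phi> \<Longrightarrow> a \<noteq> 0"
  using zero_not_root by auto

lemma reflection_root: "a \<in> \<Phi> \<Longrightarrow> b \<in> \<Phi> \<Longrightarrow> reflection a 0 b \<in> \<Phi>"
  using roots by (auto simp: root_system_def)

lemma uminus_root: "a \<in> \<Phi> \<Longrightarrow> - a \<in> \<Phi>"
  using reflection_root[of a a] root_nonzero[of a]
  by (simp add: reflection_def scaleR_2)

lemma cartan_Ints: "a \<in> \<Phi> \<Longrightarrow> b \<in> \<Phi> \<Longrightarrow> 2 * (a \<bullet> b) / (a \<bullet> a) \<in> \<int>"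
  using roots by (auto simp: root_system_def)

definition regular :: "'v \<Rightarrow> bool" where
  "regular u \<longleftrightarrow> (\<forall>a\<in>\<Phi>. \<forall>k\<in>levels ty. a \<bullet> u + k \<noteq> 0)"

text \<open>An alcove is named by one of its interior points: for \<open>u\<close> regular this is
  the alcove around \<open>u\<close>. Comparing signs by products avoids a choice of positive roots.
  Several \<open>u\<close> name the same alcove; \<open>cell_eq\<close> identifies them.\<close>

definition cell :: "'v \<Rightarrow> 'v set" where
  "cell u = {v. \<forall>a\<in>\<Phi>. \<forall>k\<in>levels ty. 0 \<le> (a \<bullet> u + k) * (a \<bullet> v + k)}"

lemma closed_chambers_walls: "closed_chambers (walls ty \<Phi>) = {cell u | u. regular u}"
  using closed_chambers_hyperplanes[of "\<Phi> \<times> levels ty"]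
  by (simp add: walls_def cell_def regular_def)

lemma local_chambers_eq:
  "local_chambers ty \<Phi> p =
    {{v. \<forall>a\<in>local_roots ty \<Phi> p. 0 \<le> (a \<bullet> e) * (a \<bullet> v)} | e. \<forall>a\<in>local_roots ty \<Phi> p. a \<bullet> e \<noteq> 0}"
  using closed_chambers_hyperplanes[of "local_roots ty \<Phi> p \<times> {0}"]
  by (simp add: local_chambers_def)

lemma mem_local_roots: "a \<in> local_roots ty \<Phi> p \<longleftrightarrow> a \<in> \<Phi> \<and> (\<exists>k\<in>levels ty. a \<bullet> p + k = 0)"
  by (auto simp: local_roots_def wall_def)

lemma mem_cell_self: "u \<in> cell u"
  by (auto simp: cell_def)

lemma cell_eq:
  assumes "regular u" "regular v" "v \<in> cell u"
  shows "cell v = cell u"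
proof -
  have "0 < (a \<bullet> v + k) * (a \<bullet> u + k)" if "a \<in> \<Phi>" "k \<in> levels ty" for a k
    using assms that by (fastforce simp: cell_def regular_def less_le mult.commute)
  then show ?thesis unfolding cell_def using mult_pos_nonneg_iff by blast
qed

text \<open>There are finitely many roots, and the levels of each are integers, so the walls that
  miss \<open>p\<close> keep a common distance from it.\<close>

lemma locally_finite:
  "\<forall>\<^sub>F v in nhds p. \<forall>a\<in>\<Phi>. \<forall>k\<in>levels ty. a \<bullet> p + k \<noteq> 0 \<longrightarrow> 0 < (a \<bullet> p + k) * (a \<bullet> v + k)"
proof -
  have "\<forall>\<^sub>F v in nhds p. \<forall>k\<in>levels ty. a \<bullet> p + k \<noteq> 0 \<longrightarrow> 0 < (a \<bullet> p + k) * (a \<bullet> v + k)" for a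
  proof -
    have "((\<lambda>v. a \<bullet> v) \<longlongrightarrow> a \<bullet> p) (nhds p)"
      by (intro tendsto_intros) (auto simp: filterlim_ident)
    from this[unfolded filterlim_iff, rule_format, OF eventually_same_side_Ints]
    show ?thesis by eventually_elim (use levels_Ints in blast)
  qed
  then show ?thesis using finite_roots by (simp add: eventually_ball_finite)
qed

lemma eventually_in_cell:
  assumes "regular u"
  shows "\<forall>\<^sub>F v in nhds u. regular v \<and> v \<in> cell u"
  using locally_finite[of u]
proof eventually_elim
  case (elim v)
  then show ?case using assms by (fastforce simp: regular_def cell_def)
qed

text \<open>The points equidistant from \<open>v\<close> and \<open>v'\<close> form a hyperplane
  orthogonal to \<open>v - v'\<close>, which cannot contain both \<open>u\<close> and a nearby point
  \<open>u + s *\<^sub>R (v - v')\<close>. This is what allows a retraction to be defined by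
  distances.\<close>

lemma cell_separates_points:
  assumes "regular u" and eq: "\<forall>y\<in>cell u. dist v y = dist v' y"
  shows "v = v'"
proof (rule ccontr)
  assume ne: "v \<noteq> v'"
  have bis: "2 * ((v - v') \<bullet> y) = v \<bullet> v - v' \<bullet> v'" if "y \<in> cell u" for y
  proof -
    have "(dist v y)\<^sup>2 = (dist v' y)\<^sup>2" using eq that by simp
    then show ?thesis
      by (simp add: dist_norm power2_norm_eq_inner inner_diff_left inner_diff_right inner_commute)
  qed
  have "\<forall>\<^sub>F s in at_right (0::real). u + s *\<^sub>R (v - v') \<in> cell u \<and> 0 < s"
    using eventually_line[OF eventually_in_cell[OF assms(1)], of "v - v'"] eventually_pos
    by eventually_elim auto
  then obtain s where s: "u + s *\<^sub>R (v - v') \<in> cell u" "0 < s"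
    using eventually_happens' trivial_limit_at_right_real by blast
  have "s * ((v - v') \<bullet> (v - v')) = 0"
    using bis[OF s(1)] bis[OF mem_cell_self] by (simp add: inner_add_right)
  then show False using ne s(2) by simp
qed

text \<open>The direction \<open>v\<close> may lie in several walls, so it is tilted to
  \<open>v + \<theta> *\<^sub>R w\<close> by a generic \<open>w\<close> with
  \<open>\<alpha> \<bullet> w > 0\<close>, and \<open>u\<close> is taken on the tilted ray. A small
  \<theta> keeps the signs of the roots that do not vanish on \<open>v\<close>; a small step
  \<epsilon> along the ray crosses no wall that misses \<open>p\<close>.\<close>

lemma germ_in_cell_side:
  assumes "\<alpha> \<noteq> 0" "0 \<le> \<alpha> \<bullet> v"
  shows "\<exists>u. regular u \<and> p \<in> cell u \<and> 0 < \<alpha> \<bullet> (u - p) \<and> (\<forall>\<^sub>F s in at_right 0. p + s *\<^sub>R v \<in> cell u)"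
proof -
  obtain w where w: "\<alpha> \<bullet> w > 0" "\<forall>a\<in>\<Phi>. a \<bullet> w \<noteq> 0"
  proof -
    obtain w where w: "\<forall>a\<in>insert \<alpha> \<Phi>. a \<bullet> w \<noteq> 0"
      using exists_off_hyperplanes[of UNIV "insert \<alpha> \<Phi>"] finite_roots zero_not_root assms(1) by auto
    show ?thesis
      using that[of w] that[of "-w"] w by (cases "\<alpha> \<bullet> w > 0") auto
  qed
  have side: "\<forall>\<^sub>F s in at_right (0::real). a \<bullet> v \<noteq> 0 \<longrightarrow> 0 < (a \<bullet> v) * (a \<bullet> (v + s *\<^sub>R w))" for a
  proof (cases "a \<bullet> v = 0")
    case False
    have lim: "((\<lambda>s. (a \<bullet> v) * (a \<bullet> (v + s *\<^sub>R w))) \<longlongrightarrow> (a \<bullet> v) * (a \<bullet> v)) (at_right (0::real))"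
      by (intro tendsto_intros tendsto_line)
    have "0 < (a \<bullet> v) * (a \<bullet> v)" using False not_real_square_gt_zero by blast
    with lim have "\<forall>\<^sub>F s in at_right (0::real). 0 < (a \<bullet> v) * (a \<bullet> (v + s *\<^sub>R w))"
      by (rule order_tendstoD(1))
    then show ?thesis by eventually_elim simp
  qed simp
  have "\<forall>\<^sub>F s in at_right (0::real). \<forall>a\<in>\<Phi>. a \<bullet> v \<noteq> 0 \<longrightarrow> 0 < (a \<bullet> v) * (a \<bullet> (v + s *\<^sub>R w))"
    using side finite_roots by (simp add: eventually_ball_finite)
  with eventually_pos have "\<forall>\<^sub>F s in at_right (0::real).
      0 < s \<and> (\<forall>a\<in>\<Phi>. a \<bullet> v \<noteq> 0 \<longrightarrow> 0 < (a \<bullet> v) * (a \<bullet> (v + s *\<^sub>R w)))"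
    by eventually_elim auto
  then obtain \<theta> where \<theta>: "0 < \<theta>" "\<forall>a\<in>\<Phi>. a \<bullet> v \<noteq> 0 \<longrightarrow> 0 < (a \<bullet> v) * (a \<bullet> (v + \<theta> *\<^sub>R w))"
    using eventually_happens' trivial_limit_at_right_real by blast
  define v' where "v' = v + \<theta> *\<^sub>R w"
  have v'0: "a \<bullet> v' \<noteq> 0" if "a \<in> \<Phi>" for a
  proof (cases "a \<bullet> v = 0")
    case True then show ?thesis using \<theta>(1) w(2) that by (simp add: v'_def inner_add_right)
  next
    case False
    then have "0 < (a \<bullet> v) * (a \<bullet> v')" using \<theta>(2) that unfolding v'_def by blast
    then show ?thesis by auto
  qed
  have v'v: "0 \<le> (a \<bullet> v') * (a \<bullet> v)" if "a \<in> \<Phi>" for a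
  proof (cases "a \<bullet> v = 0")
    case False
    then have "0 < (a \<bullet> v) * (a \<bullet> v')" using \<theta>(2) that unfolding v'_def by blast
    then show ?thesis by (simp only: mult.commute less_imp_le)
  qed simp
  have "\<forall>\<^sub>F s in at_right (0::real). 0 < s \<and>
     (\<forall>a\<in>\<Phi>. \<forall>k\<in>levels ty. a \<bullet> p + k \<noteq> 0 \<longrightarrow> 0 < (a \<bullet> p + k) * (a \<bullet> (p + s *\<^sub>R v') + k))"
    using eventually_line[OF locally_finite, of p v'] eventually_pos by eventually_elim auto
  then obtain \<epsilon> where \<epsilon>: "0 < \<epsilon>"
     "\<forall>a\<in>\<Phi>. \<forall>k\<in>levels ty. a \<bullet> p + k \<noteq> 0 \<longrightarrow> 0 < (a \<bullet> p + k) * (a \<bullet> (p + \<epsilon> *\<^sub>R v') + k)"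
    using eventually_happens' trivial_limit_at_right_real by blast
  define u where "u = p + \<epsilon> *\<^sub>R v'"
  have thru: "a \<bullet> (p + s *\<^sub>R z) + k = s * (a \<bullet> z)" if "a \<bullet> p + k = 0" for a k s z
    using that by (simp add: inner_add_right algebra_simps)
  have "regular u"
    unfolding regular_def
  proof (intro ballI)
    fix a k assume ak: "a \<in> \<Phi>" "k \<in> levels ty"
    show "a \<bullet> u + k \<noteq> 0"
    proof (cases "a \<bullet> p + k = 0")
      case True then show ?thesis using thru[OF True] \<epsilon>(1) v'0[OF ak(1)] by (simp add: u_def)
    next
      case False
      then have "0 < (a \<bullet> p + k) * (a \<bullet> u + k)" using \<epsilon>(2) ak unfolding u_def by blast
      then show ?thesis by auto
    qed
  qed
  moreover have "0 < \<alpha> \<bullet> (u - p)"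
    using assms(2) w(1) \<theta>(1) \<epsilon>(1) by (simp add: u_def v'_def inner_add_right add_nonneg_pos)
  moreover have "p \<in> cell u"
    unfolding cell_def
  proof (clarify)
    fix a k assume ak: "a \<in> \<Phi>" "k \<in> levels ty"
    show "0 \<le> (a \<bullet> u + k) * (a \<bullet> p + k)"
    proof (cases "a \<bullet> p + k = 0")
      case False
      then have "0 < (a \<bullet> p + k) * (a \<bullet> u + k)" using \<epsilon>(2) ak unfolding u_def by blast
      then show ?thesis by (simp only: mult.commute less_imp_le)
    qed simp
  qed
  moreover have "\<forall>\<^sub>F s in at_right 0. p + s *\<^sub>R v \<in> cell u"
    using eventually_line[OF locally_finite, of p v] eventually_pos
  proof eventually_elim
    case (elim s)
    show ?case unfolding cell_def
    proof (clarify)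
      fix a k assume ak: "a \<in> \<Phi>" "k \<in> levels ty"
      show "0 \<le> (a \<bullet> u + k) * (a \<bullet> (p + s *\<^sub>R v) + k)"
      proof (cases "a \<bullet> p + k = 0")
        case True
        have "(a \<bullet> u + k) * (a \<bullet> (p + s *\<^sub>R v) + k) = \<epsilon> * s * ((a \<bullet> v') * (a \<bullet> v))"
          unfolding u_def thru[OF True] by simp
        then show ?thesis using \<epsilon>(1) elim(2) v'v[OF ak(1)] by simp
      next
        case False
        then have "0 < (a \<bullet> p + k) * (a \<bullet> (p + s *\<^sub>R v) + k)" "0 < (a \<bullet> p + k) * (a \<bullet> u + k)"
          using elim(1) \<epsilon>(2) ak unfolding u_def by blast+
        then show ?thesis using mult_pos_trans less_imp_le by blast
      qed
    qed
  qed
  ultimately show ?thesis by blast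
qed

lemma germ_in_cell:
  "\<exists>u. regular u \<and> p \<in> cell u \<and> (\<forall>\<^sub>F s in at_right 0. p + s *\<^sub>R v \<in> cell u)"
proof -
  obtain \<alpha> :: 'v where "\<alpha> \<noteq> 0" "0 \<le> \<alpha> \<bullet> v"
    by (metis inner_zero_right inner_ge_zero nonempty_Basis nonzero_Basis equals0I order_refl)
  then show ?thesis using germ_in_cell_side by blast
qed

lemma exists_cell: "\<exists>u. regular u \<and> p \<in> cell u"
  using germ_in_cell by blast

text \<open>A point near \<open>p\<close> on the way to \<open>u\<close> is on the side of
  \<open>u\<close> for the walls through \<open>p\<close>, and on the side of \<open>p\<close> for
  all others. Its alcove is the projection of \<open>cell u\<close> to \<open>p\<close>.\<close>

lemma exists_cell_towards:
  assumes "regular u"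
  shows "\<exists>\<epsilon>>0. \<epsilon> < 1 \<and> regular (p + \<epsilon> *\<^sub>R (u - p)) \<and> p \<in> cell (p + \<epsilon> *\<^sub>R (u - p))"
proof -
  have "\<forall>\<^sub>F s in at_right (0::real). 0 < s \<and> s < 1 \<and> regular (p + s *\<^sub>R (u - p)) \<and> p \<in> cell (p + s *\<^sub>R (u - p))"
    using eventually_line[OF locally_finite, of p "u - p"] eventually_pos eventually_less_right[OF zero_less_one]
  proof eventually_elim
    case (elim s)
    have *: "a \<bullet> (p + s *\<^sub>R (u - p)) + k = s * (a \<bullet> u + k)" if "a \<bullet> p + k = 0" for a k
      proof -
      have "k = - (a \<bullet> p)" using that by simp
      then show ?thesis by (simp add: inner_add_right inner_diff_right algebra_simps)
    qed
    have "regular (p + s *\<^sub>R (u - p))"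
      unfolding regular_def
    proof (intro ballI)
      fix a k assume ak: "a \<in> \<Phi>" "k \<in> levels ty"
      show "a \<bullet> (p + s *\<^sub>R (u - p)) + k \<noteq> 0"
      proof (cases "a \<bullet> p + k = 0")
        case True
        have "a \<bullet> u + k \<noteq> 0" using assms ak unfolding regular_def by blast
        then show ?thesis using *[OF True] elim(2) by simp
      next
        case False
        then have "0 < (a \<bullet> p + k) * (a \<bullet> (p + s *\<^sub>R (u - p)) + k)" using elim(1) ak by blast
        then show ?thesis by auto
      qed
    qed
    moreover have "p \<in> cell (p + s *\<^sub>R (u - p))"
      unfolding cell_def
    proof (clarify)
      fix a k assume ak: "a \<in> \<Phi>" "k \<in> levels ty"
      show "0 \<le> (a \<bullet> (p + s *\<^sub>R (u - p)) + k) * (a \<bullet> p + k)"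
      proof (cases "a \<bullet> p + k = 0")
        case False
        then have "0 < (a \<bullet> p + k) * (a \<bullet> (p + s *\<^sub>R (u - p)) + k)" using elim(1) ak by blast
        then show ?thesis by (simp only: mult.commute less_imp_le)
      qed simp
    qed
    ultimately show ?case using elim by simp
  qed
  then show ?thesis
    using eventually_happens'[OF trivial_limit_at_right_real] by blast
qed

text \<open>Reflections permute the affine roots: the linear part is reflected, and integrality of
  the Cartan number keeps the constant a level.\<close>

lemma inner_reflection_root:
  assumes "\<alpha> \<in> \<Phi>" "k \<in> levels ty" "b \<in> \<Phi>" "l \<in> levels ty"
  obtains b' l' where "b' \<in> \<Phi>" "l' \<in> levels ty" "\<And>v. b \<bullet> reflection \<alpha> k v + l = b' \<bullet> v + l'"
proof
  show "reflection \<alpha> 0 b \<in> \<Phi>" using assms reflection_root by simp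
  show "l - k * (2 * (\<alpha> \<bullet> b) / (\<alpha> \<bullet> \<alpha>)) \<in> levels ty"
    using assms by (intro levels_diff_mult cartan_Ints)
  show "b \<bullet> reflection \<alpha> k v + l = reflection \<alpha> 0 b \<bullet> v + (l - k * (2 * (\<alpha> \<bullet> b) / (\<alpha> \<bullet> \<alpha>)))" for v
    by (simp add: reflection_def inner_diff_left inner_diff_right inner_commute
        add_divide_distrib algebra_simps)
qed

lemma regular_reflection:
  assumes "\<alpha> \<in> \<Phi>" "k \<in> levels ty" "regular u"
  shows "regular (reflection \<alpha> k u)"
  unfolding regular_def
proof (intro ballI)
  fix b l assume b: "b \<in> \<Phi>" "l \<in> levels ty"
  obtain b' l' where "b' \<in> \<Phi>" "l' \<in> levels ty" "\<And>v. b \<bullet> reflection \<alpha> k v + l = b' \<bullet> v + l'"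
    using inner_reflection_root[OF assms(1,2) b] by blast
  then show "b \<bullet> reflection \<alpha> k u + l \<noteq> 0"
    using assms(3) by (simp add: regular_def)
qed

lemma reflection_in_cell:
  assumes "\<alpha> \<in> \<Phi>" "k \<in> levels ty" "v \<in> cell u"
  shows "reflection \<alpha> k v \<in> cell (reflection \<alpha> k u)"
  unfolding cell_def
proof (clarify)
  fix b l assume b: "b \<in> \<Phi>" "l \<in> levels ty"
  obtain b' l' where "b' \<in> \<Phi>" "l' \<in> levels ty" "\<And>v. b \<bullet> reflection \<alpha> k v + l = b' \<bullet> v + l'"
    using inner_reflection_root[OF assms(1,2) b] by blast
  then show "0 \<le> (b \<bullet> reflection \<alpha> k u + l) * (b \<bullet> reflection \<alpha> k v + l)"
    using assms(3) by (simp add: cell_def)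
qed

lemma reflection_cell:
  assumes "\<alpha> \<in> \<Phi>" "k \<in> levels ty"
  shows "reflection \<alpha> k ` cell u = cell (reflection \<alpha> k u)"
proof
  show "reflection \<alpha> k ` cell u \<subseteq> cell (reflection \<alpha> k u)"
    using reflection_in_cell[OF assms] by blast
  show "cell (reflection \<alpha> k u) \<subseteq> reflection \<alpha> k ` cell u"
    using reflection_in_cell[OF assms, of _ "reflection \<alpha> k u"] reflection_invol
    by (metis image_eqI subsetI)
qed

lemma weyl_group_cell:
  assumes "w \<in> weyl_group ty \<Phi>" "regular u"
  shows "regular (w u) \<and> w ` cell u = cell (w u)"
  using assms
proof induction
  case (2 a k w)
  have "(reflection a k \<circ> w) ` cell u = reflection a k ` (w ` cell u)" by (simp only: image_comp)
  with 2 show ?case by (simp add: regular_reflection reflection_cell)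
qed simp

lemma reflection_in_weyl_group: "\<alpha> \<in> \<Phi> \<Longrightarrow> k \<in> levels ty \<Longrightarrow> reflection \<alpha> k \<in> weyl_group ty \<Phi>"
  using weyl_group.intros(2)[OF _ _ weyl_group.intros(1)] by fastforce

section \<open>Panels of an alcove\<close>

text \<open>\<open>x\<close> lies in the relative interior of the panel of \<open>cell u\<close> on the wall of \<open>\<alpha>\<close>.\<close>

definition panel_point :: "'v \<Rightarrow> real \<Rightarrow> 'v \<Rightarrow> 'v \<Rightarrow> bool" where
  "panel_point \<alpha> k u x \<longleftrightarrow> \<alpha> \<in> \<Phi> \<and> k \<in> levels ty \<and> regular u \<and> 0 < \<alpha> \<bullet> u + k \<and>
     \<alpha> \<bullet> x + k = 0 \<and> x \<in> cell u \<and>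
     (\<forall>b\<in>\<Phi>. \<forall>l\<in>levels ty. b \<bullet> x + l = 0 \<longrightarrow> (\<exists>c. b = c *\<^sub>R \<alpha>))"

text \<open>Two affine functions that vanish at \<open>x\<close> and have proportional gradients are
  proportional.\<close>

lemma panel_point_multiple:
  assumes "panel_point \<alpha> k u x" "b \<in> \<Phi>" "l \<in> levels ty" "b \<bullet> x + l = 0"
  obtains c where "c \<noteq> 0" "\<And>v. b \<bullet> v + l = c * (\<alpha> \<bullet> v + k)"
proof -
  obtain c where c: "b = c *\<^sub>R \<alpha>" using assms by (auto simp: panel_point_def)
  have k: "k = - (\<alpha> \<bullet> x)" and l: "l = - (b \<bullet> x)" using assms by (auto simp: panel_point_def)
  show thesis
  proof (rule that)
    show "c \<noteq> 0" using c root_nonzero[OF assms(2)] by auto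
    show "b \<bullet> v + l = c * (\<alpha> \<bullet> v + k)" for v
      unfolding k l by (simp add: c algebra_simps)
  qed
qed

text \<open>The only wall close to \<open>x\<close> is that of \<alpha>, so around \<open>x\<close>
  the alcove looks like a half-space.\<close>

lemma panel_point_near:
  assumes P: "panel_point \<alpha> k u x"
  shows "\<forall>\<^sub>F v in nhds x. (0 < \<alpha> \<bullet> v + k \<longrightarrow> regular v) \<and> (0 \<le> \<alpha> \<bullet> v + k \<longrightarrow> v \<in> cell u)"
  using locally_finite[of x]
proof eventually_elim
  case (elim v)
  have x: "x \<in> cell u" and u: "0 < \<alpha> \<bullet> u + k" using P by (auto simp: panel_point_def)
  have "b \<bullet> v + l \<noteq> 0" if "b \<in> \<Phi>" "l \<in> levels ty" "0 < \<alpha> \<bullet> v + k" for b l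
  proof (cases "b \<bullet> x + l = 0")
    case True
    from panel_point_multiple[OF P that(1,2) True]
    obtain c where "c \<noteq> 0" "\<And>v. b \<bullet> v + l = c * (\<alpha> \<bullet> v + k)" by blast
    with that show ?thesis by simp
  next
    case False
    with elim that have "0 < (b \<bullet> x + l) * (b \<bullet> v + l)" by blast
    then show ?thesis by auto
  qed
  moreover have "0 \<le> (b \<bullet> u + l) * (b \<bullet> v + l)" if "b \<in> \<Phi>" "l \<in> levels ty" "0 \<le> \<alpha> \<bullet> v + k" for b l
  proof (cases "b \<bullet> x + l = 0")
    case True
    from panel_point_multiple[OF P that(1,2) True]
    obtain c where "\<And>v. b \<bullet> v + l = c * (\<alpha> \<bullet> v + k)" by blast
    then have "(b \<bullet> u + l) * (b \<bullet> v + l) = c\<^sup>2 * ((\<alpha> \<bullet> u + k) * (\<alpha> \<bullet> v + k))"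
      by (simp add: power2_eq_square)
    with that u show ?thesis by simp
  next
    case False
    with elim that have 1: "0 < (b \<bullet> x + l) * (b \<bullet> v + l)" by blast
    have 2: "0 \<le> (b \<bullet> u + l) * (b \<bullet> x + l)" using x that unfolding cell_def by blast
    then have "0 \<le> (b \<bullet> x + l) * (b \<bullet> u + l)" by (simp only: mult.commute)
    then show ?thesis using mult_pos_nonneg_iff[OF 1] by (simp only: mult.commute)
  qed
  ultimately show ?case by (auto simp: regular_def cell_def)
qed

text \<open>The walls that miss \<open>x\<close> have \<open>w\<close> on the side of
  \<open>x\<close>, just like \<open>u\<close> and its mirror image; those through \<open>x\<close>
  are the wall of \<alpha>. So the sign of \<alpha> alone tells apart the alcoves of an apartment at
  \<open>x\<close>.\<close>

lemma panel_point_cells: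
  assumes P: "panel_point \<alpha> k u x" and w: "regular w" "x \<in> cell w"
  shows "cell w = (if 0 < \<alpha> \<bullet> w + k then cell u else cell (reflection \<alpha> k u))"
proof -
  have \<alpha>: "\<alpha> \<in> \<Phi>" "k \<in> levels ty" and u: "regular u" "0 < \<alpha> \<bullet> u + k" "x \<in> cell u" and x: "\<alpha> \<bullet> x + k = 0"
    using P by (auto simp: panel_point_def)
  have *: "cell w = cell u'" if u': "regular u'" "x \<in> cell u'" "0 < (\<alpha> \<bullet> w + k) * (\<alpha> \<bullet> u' + k)" for u'
  proof (rule cell_eq)
    show "w \<in> cell u'"
      unfolding cell_def
    proof (clarify)
      fix b l assume b: "b \<in> \<Phi>" "l \<in> levels ty"
      show "0 \<le> (b \<bullet> u' + l) * (b \<bullet> w + l)"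
      proof (cases "b \<bullet> x + l = 0")
        case True
        from panel_point_multiple[OF P b True]
        obtain c where "\<And>v. b \<bullet> v + l = c * (\<alpha> \<bullet> v + k)" by blast
        then have "(b \<bullet> u' + l) * (b \<bullet> w + l) = c\<^sup>2 * ((\<alpha> \<bullet> w + k) * (\<alpha> \<bullet> u' + k))"
          by (simp add: power2_eq_square)
        with u'(3) show ?thesis by simp
      next
        case False
        have "0 \<le> (b \<bullet> w + l) * (b \<bullet> x + l)" "0 \<le> (b \<bullet> u' + l) * (b \<bullet> x + l)"
          using b w(2) u'(2) unfolding cell_def by blast+
        with False show ?thesis
          by (metis mult_nonneg_nonneg mult_nonpos_nonpos zero_le_mult_iff order_antisym_conv)
      qed
    qed
  qed (use w u' in auto)
  have "\<alpha> \<bullet> w + k \<noteq> 0" using w \<alpha> by (auto simp: regular_def)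
  moreover have "x \<in> cell (reflection \<alpha> k u)"
    using reflection_in_cell[OF \<alpha> u(3)] reflection_fix[OF x] by simp
  ultimately show ?thesis
    using *[OF u(1,3)] u(2) *[OF regular_reflection[OF \<alpha> u(1)]] inner_reflection[OF root_nonzero[OF \<alpha>(1)], of k u]
    by (auto simp: mult_neg_neg)
qed

text \<open>Together with convexity of apartments, this forces an apartment that contains the panel
  point \<open>x\<close> and the point \<open>w\<close> to contain the alcove \<open>cell u\<close>
  that the segment enters.\<close>

lemma panel_point_line:
  assumes P: "panel_point \<alpha> k u x" and w: "0 < \<alpha> \<bullet> w + k"
  shows "\<exists>t>0. t < 1 \<and> regular ((1 - t) *\<^sub>R x + t *\<^sub>R w) \<and> (1 - t) *\<^sub>R x + t *\<^sub>R w \<in> cell u"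
proof -
  have x: "\<alpha> \<bullet> x + k = 0" using P by (auto simp: panel_point_def)
  have "\<forall>\<^sub>F t in at_right (0::real). 0 < t \<and> t < 1 \<and> regular (x + t *\<^sub>R (w - x)) \<and> x + t *\<^sub>R (w - x) \<in> cell u"
    using eventually_line[OF panel_point_near[OF P], of "w - x"] eventually_pos
      eventually_less_right[OF zero_less_one]
  proof eventually_elim
    case (elim t)
    have "\<alpha> \<bullet> (x + t *\<^sub>R (w - x)) + k = t * (\<alpha> \<bullet> w + k)"
    proof -
      have "k = - (\<alpha> \<bullet> x)" using x by simp
      then show ?thesis by (simp add: inner_add_right inner_diff_right)
    qed
    then have "0 < \<alpha> \<bullet> (x + t *\<^sub>R (w - x)) + k" using w elim by simp
    with elim show ?case by auto
  qed
  then obtain t where "0 < t" "t < 1" "regular (x + t *\<^sub>R (w - x))" "x + t *\<^sub>R (w - x) \<in> cell u"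
    using eventually_happens' trivial_limit_at_right_real by blast
  moreover have "x + t *\<^sub>R (w - x) = (1 - t) *\<^sub>R x + t *\<^sub>R w" by (simp add: algebra_simps)
  ultimately show ?thesis by auto
qed

text \<open>The panel has nonempty interior in its wall, so \<open>v - v'\<close> is orthogonal to
  the wall and equals \<open>c *\<^sub>R \<alpha>\<close>; equidistance from \<open>x\<close> then
  determines \<open>c\<close> when it is not 0.\<close>

lemma panel_equidistant:
  assumes P: "panel_point \<alpha> k u x"
    and eq: "\<And>y. y \<in> cell u \<Longrightarrow> \<alpha> \<bullet> y + k = 0 \<Longrightarrow> dist v y = dist v' y"
  shows "v' = v \<or> v' = reflection \<alpha> k v"
proof (cases "v = v'")
  case False
  have x: "\<alpha> \<bullet> x + k = 0" "x \<in> cell u" and \<alpha>0: "\<alpha> \<noteq> 0"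
    using P root_nonzero by (auto simp: panel_point_def)
  have bis: "2 * ((v - v') \<bullet> y) = v \<bullet> v - v' \<bullet> v'" if "y \<in> cell u" "\<alpha> \<bullet> y + k = 0" for y
  proof -
    have "(dist v y)\<^sup>2 = (dist v' y)\<^sup>2" using eq that by simp
    then show ?thesis
      by (simp add: dist_norm power2_norm_eq_inner inner_diff_left inner_diff_right inner_commute)
  qed
  define d where "d = v - v'"
  have perp: "d \<bullet> z = 0" if z: "\<alpha> \<bullet> z = 0" for z
  proof -
    have "\<forall>\<^sub>F s in at_right (0::real). x + s *\<^sub>R z \<in> cell u \<and> 0 < s"
      using eventually_line[OF panel_point_near[OF P], of z] eventually_pos
      by eventually_elim (use x z in \<open>simp add: inner_add_right\<close>)
    then obtain s where s: "x + s *\<^sub>R z \<in> cell u" "0 < s"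
      using eventually_happens' trivial_limit_at_right_real by blast
    have "s * (d \<bullet> z) = 0"
      using bis[OF s(1)] bis[OF x(2,1)] x z by (simp add: inner_add_right d_def)
    with s show ?thesis by simp
  qed
  define c where "c = (\<alpha> \<bullet> d) / (\<alpha> \<bullet> \<alpha>)"
  have "\<alpha> \<bullet> (d - c *\<^sub>R \<alpha>) = 0" using \<alpha>0 by (simp add: c_def inner_diff_right)
  from perp[OF this] this have "(d - c *\<^sub>R \<alpha>) \<bullet> (d - c *\<^sub>R \<alpha>) = 0"
    by (simp add: inner_diff_left)
  then have d: "d = c *\<^sub>R \<alpha>" by simp
  then have v': "v' = v - c *\<^sub>R \<alpha>" by (simp add: d_def algebra_simps)
  have "c \<noteq> 0" using d False by (auto simp: d_def)
  have "2 * (d \<bullet> x) = v \<bullet> v - v' \<bullet> v'" using bis[OF x(2,1)] by (simp add: d_def)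
  then have "c * (2 * (\<alpha> \<bullet> x)) = c * (2 * (\<alpha> \<bullet> v) - c * (\<alpha> \<bullet> \<alpha>))"
    unfolding d v' by (simp add: inner_diff_left inner_diff_right inner_commute algebra_simps)
  then have "2 * (\<alpha> \<bullet> x) = 2 * (\<alpha> \<bullet> v) - c * (\<alpha> \<bullet> \<alpha>)" using \<open>c \<noteq> 0\<close> by simp
  then have "c = 2 * (\<alpha> \<bullet> v + k) / (\<alpha> \<bullet> \<alpha>)"
    using x(1) \<alpha>0 by (simp add: field_simps)
  then show ?thesis by (simp add: v' reflection_def)
qed simp

lemma cell_inter_reflected:
  assumes P: "panel_point \<alpha> k u x" and "y \<in> cell u" "y \<in> cell (reflection \<alpha> k u)"
  shows "\<alpha> \<bullet> y + k = 0"
proof -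
  have \<alpha>: "\<alpha> \<in> \<Phi>" "k \<in> levels ty" and u: "0 < \<alpha> \<bullet> u + k"
    using P by (auto simp: panel_point_def)
  have "0 \<le> (\<alpha> \<bullet> u + k) * (\<alpha> \<bullet> y + k)" "0 \<le> (\<alpha> \<bullet> reflection \<alpha> k u + k) * (\<alpha> \<bullet> y + k)"
    using assms \<alpha> unfolding cell_def by blast+
  then show ?thesis
    using u unfolding inner_reflection[OF root_nonzero[OF \<alpha>(1)]]
    by (auto simp: zero_le_mult_iff)
qed

lemma on_wall_in_reflected:
  assumes "panel_point \<alpha> k u x" "y \<in> cell u" "\<alpha> \<bullet> y + k = 0"
  shows "y \<in> cell (reflection \<alpha> k u)"
  using reflection_in_cell[of \<alpha> k y u] assms reflection_fix[of \<alpha> y k]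
  by (auto simp: panel_point_def)

text \<open>Near \<open>x\<close> the whole wall lies in the alcove, so the panel has the dimension
  of a hyperplane. Thickness is stated for facets, and this supplies one.\<close>

lemma panel_facet:
  assumes P: "panel_point \<alpha> k u x"
  shows "(cell u \<inter> {y. \<alpha> \<bullet> y = - k}) facet_of cell u" (is "?F facet_of _")
proof -
  have \<alpha>: "\<alpha> \<in> \<Phi>" "k \<in> levels ty" and x: "\<alpha> \<bullet> x + k = 0" "x \<in> cell u" and u: "0 < \<alpha> \<bullet> u + k" "regular u"
    using P by (auto simp: panel_point_def)
  have "convex (cell u)"
  proof -
    have "convex {v. 0 \<le> c * (a \<bullet> v + l)}" for a :: 'v and c l :: real
    proof -
      have "{v. 0 \<le> c * (a \<bullet> v + l)} = {v. (c *\<^sub>R a) \<bullet> v \<ge> - (c * l)}"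
        by (auto simp: distrib_left)
      then show ?thesis using convex_halfspace_ge by metis
    qed
    moreover have "cell u = (\<Inter>a\<in>\<Phi>. \<Inter>k\<in>levels ty. {v. 0 \<le> (a \<bullet> u + k) * (a \<bullet> v + k)})"
      by (auto simp: cell_def)
    ultimately show ?thesis by (simp add: convex_INT)
  qed
  moreover have "\<alpha> \<bullet> y \<ge> - k" if "y \<in> cell u" for y
  proof -
    have "0 \<le> (\<alpha> \<bullet> u + k) * (\<alpha> \<bullet> y + k)" using that \<alpha> by (auto simp: cell_def)
    with u show ?thesis by (auto simp: zero_le_mult_iff)
  qed
  ultimately have face: "?F face_of cell u"
    by (rule face_of_Int_supporting_hyperplane_ge)
  obtain U where U: "open U" "x \<in> U" "\<And>v. v \<in> U \<Longrightarrow> 0 \<le> \<alpha> \<bullet> v + k \<Longrightarrow> v \<in> cell u"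
    using panel_point_near[OF P] unfolding eventually_nhds by blast
  have hyp: "aff_dim {y. \<alpha> \<bullet> y = - k} = int DIM('v) - 1"
    by (simp add: aff_dim_hyperplane root_nonzero[OF \<alpha>(1)])
  have xU: "x \<in> U \<inter> {y. \<alpha> \<bullet> y = - k}" using U x by auto
  have "aff_dim (U \<inter> {y. \<alpha> \<bullet> y = - k}) = aff_dim {y. \<alpha> \<bullet> y = - k}"
    using aff_dim_convex_Int_open[OF convex_hyperplane U(1)] xU by (metis Int_commute empty_iff)
  moreover have "U \<inter> {y. \<alpha> \<bullet> y = - k} \<subseteq> ?F" using U(3) by auto
  ultimately have dimF: "aff_dim ?F = int DIM('v) - 1"
    using aff_dim_subset hyp by (metis Int_lower2 order_antisym)
  obtain U' where U': "open U'" "u \<in> U'" "U' \<subseteq> cell u"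
    using eventually_in_cell[OF u(2)] unfolding eventually_nhds by blast
  have "aff_dim (cell u) = int DIM('v)"
    using aff_dim_open[OF U'(1)] U'(2) aff_dim_subset[OF U'(3)] aff_dim_le_DIM[of "cell u"] by fastforce
  with face dimF x show ?thesis unfolding facet_of_def by auto
qed

end

section \<open>Chains of reflections\<close>

lemma reflection_conjugate:
  "reflection (reflection \<alpha> 0 b) 0 (reflection \<alpha> 0 v) = reflection \<alpha> 0 (reflection b 0 v)"
  for \<alpha> :: "'v::real_inner"
proof -
  have in_eq: "reflection \<alpha> 0 x \<bullet> reflection \<alpha> 0 y = x \<bullet> y" for x y
    using inner_reflection_swap[of "reflection \<alpha> 0 x" \<alpha> y] by (simp add: reflection_invol)
  have lin: "reflection \<alpha> 0 (x - c *\<^sub>R y) = reflection \<alpha> 0 x - c *\<^sub>R reflection \<alpha> 0 y" for x y c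
    by (simp add: reflection_def inner_diff_right diff_divide_distrib scaleR_diff_left
        scaleR_diff_right right_diff_distrib)
  show ?thesis
    unfolding reflection_def[of "reflection \<alpha> 0 b" 0] reflection_def[of b 0] lin in_eq by simp
qed

context root_datum
begin

lemma local_root_reflection:
  assumes "\<alpha> \<in> local_roots ty \<Phi> p" "b \<in> local_roots ty \<Phi> p"
  shows "reflection \<alpha> 0 b \<in> local_roots ty \<Phi> p"
proof -
  obtain k l where k: "\<alpha> \<in> \<Phi>" "k \<in> levels ty" "\<alpha> \<bullet> p + k = 0" and l: "b \<in> \<Phi>" "l \<in> levels ty" "b \<bullet> p + l = 0"
    using assms by (auto simp: mem_local_roots)
  define m where "m = 2 * (\<alpha> \<bullet> b) / (\<alpha> \<bullet> \<alpha>)"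
  have m: "m \<in> \<int>" using cartan_Ints k l by (simp add: m_def)
  have 1: "\<alpha> \<bullet> p = -k" "b \<bullet> p = -l" using k(3) l(3) by linarith+
  have "reflection \<alpha> 0 b \<bullet> p = b \<bullet> p - m * (\<alpha> \<bullet> p)"
    by (simp add: reflection_def m_def inner_diff_left)
  then have "reflection \<alpha> 0 b \<bullet> p + (l - k * m) = 0" by (simp add: 1)
  then show ?thesis
    using levels_diff_mult[OF k(2) l(2) m] reflection_root[OF k(1) l(1)] mem_local_roots by blast
qed

lemma local_root_uminus:
  assumes "b \<in> local_roots ty \<Phi> p"
  shows "- b \<in> local_roots ty \<Phi> p"
proof -
  obtain k where k: "b \<in> \<Phi>" "k \<in> levels ty" "b \<bullet> p + k = 0"
    using assms by (auto simp: mem_local_roots)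
  have "-b \<bullet> p + (-k) = 0" using k(3) by simp
  then show ?thesis using uminus_root[OF k(1)] levels_uminus[OF k(2)] mem_local_roots by blast
qed

lemma finite_local_roots: "finite (local_roots ty \<Phi> p)"
  using finite_roots by (simp add: local_roots_def)

lemma local_root_nonzero: "b \<in> local_roots ty \<Phi> p \<Longrightarrow> b \<noteq> 0"
  using root_nonzero by (auto simp: mem_local_roots)

definition local_regular :: "'v \<Rightarrow> 'v \<Rightarrow> bool" where
  "local_regular p e \<longleftrightarrow> (\<forall>b\<in>local_roots ty \<Phi> p. b \<bullet> e \<noteq> 0)"

text \<open>The local chamber of a chain is given by a vector \<open>e\<close> in its interior.\<close>

definition chain_step :: "'v \<Rightarrow> 'v \<Rightarrow> 'v \<Rightarrow> 'v \<Rightarrow> bool" where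
  "chain_step p e \<eta> \<eta>' \<longleftrightarrow> (\<exists>b\<in>local_roots ty \<Phi> p. 0 < b \<bullet> e \<and> 0 < b \<bullet> \<eta> \<and> \<eta>' = reflection b 0 \<eta>)"

abbreviation chain :: "'v \<Rightarrow> 'v \<Rightarrow> 'v \<Rightarrow> 'v \<Rightarrow> bool" where
  "chain p e \<equiv> (chain_step p e)\<^sup>*\<^sup>*"

text \<open>Both \<open>b\<close> and \<open>- b\<close> are local roots, so the root of a step can
  be chosen positive on \<open>e\<close>. The weak inequalities of \<open>same_side\<close> become
  strict because neither \<open>e\<close> nor \<eta> lies on the wall.\<close>

lemma chain_step_iff_same_side:
  assumes e: "local_regular p e" and D: "D = {v. \<forall>a\<in>local_roots ty \<Phi> p. 0 \<le> (a \<bullet> e) * (a \<bullet> v)}"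
  shows "chain_step p e \<eta> \<eta>' \<longleftrightarrow> (\<exists>b\<in>local_roots ty \<Phi> p. \<eta>' = reflection b 0 \<eta> \<and> \<eta> \<notin> wall b 0 \<and> same_side b \<eta> D)"
proof
  assume "chain_step p e \<eta> \<eta>'"
  then obtain b where b: "b \<in> local_roots ty \<Phi> p" "0 < b \<bullet> e" "0 < b \<bullet> \<eta>" "\<eta>' = reflection b 0 \<eta>"
    by (auto simp: chain_step_def)
  have "0 \<le> b \<bullet> d" if "d \<in> D" for d
  proof -
    have "0 \<le> (b \<bullet> e) * (b \<bullet> d)" using that b(1) D by blast
    then show ?thesis using b(2) by (simp add: zero_le_mult_iff)
  qed
  then have "same_side b \<eta> D" using b(3) by (simp add: same_side_def)
  moreover have "\<eta> \<notin> wall b 0" using b(3) by (simp add: wall_def)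
  ultimately show "\<exists>b\<in>local_roots ty \<Phi> p. \<eta>' = reflection b 0 \<eta> \<and> \<eta> \<notin> wall b 0 \<and> same_side b \<eta> D"
    using b by blast
next
  assume "\<exists>b\<in>local_roots ty \<Phi> p. \<eta>' = reflection b 0 \<eta> \<and> \<eta> \<notin> wall b 0 \<and> same_side b \<eta> D"
  then obtain b where b: "b \<in> local_roots ty \<Phi> p" "\<eta>' = reflection b 0 \<eta>" "b \<bullet> \<eta> \<noteq> 0" "same_side b \<eta> D"
    by (auto simp: wall_def)
  have "e \<in> D" by (simp add: D)
  moreover have "b \<bullet> e \<noteq> 0" using e b(1) by (auto simp: local_regular_def)
  ultimately have "(0 < b \<bullet> e \<and> 0 < b \<bullet> \<eta>) \<or> (b \<bullet> e < 0 \<and> b \<bullet> \<eta> < 0)"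
    using b(3,4) by (auto simp: same_side_def less_le)
  then show "chain_step p e \<eta> \<eta>'"
  proof
    assume "0 < b \<bullet> e \<and> 0 < b \<bullet> \<eta>"
    then show ?thesis using b(1,2) by (auto simp: chain_step_def)
  next
    assume "b \<bullet> e < 0 \<and> b \<bullet> \<eta> < 0"
    moreover have "\<eta>' = reflection (- b) 0 \<eta>"
      using reflection_scaled[of "-1" b \<eta>] b(2) by simp
    ultimately show ?thesis
      using local_root_uminus[OF b(1)] by (auto simp: chain_step_def intro!: bexI[of _ "-b"])
  qed
qed

lemma weyl_chain_iff_chain:
  assumes e: "local_regular p e" and D: "D = {v. \<forall>a\<in>local_roots ty \<Phi> p. 0 \<le> (a \<bullet> e) * (a \<bullet> v)}"
  shows "weyl_chain ty \<Phi> p D \<eta> \<eta>' \<longleftrightarrow> chain p e \<eta> \<eta>'"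
proof
  assume "weyl_chain ty \<Phi> p D \<eta> \<eta>'"
  then obtain m f b where f: "f (0::nat) = \<eta>" "f m = \<eta>'"
    and b: "\<And>j. j \<in> {1..m} \<Longrightarrow> b j \<in> local_roots ty \<Phi> p \<and> f j = reflection (b j) 0 (f (j - 1)) \<and>
           f (j - 1) \<notin> wall (b j) 0 \<and> same_side (b j) (f (j - 1)) D"
    unfolding weyl_chain_def by blast
  have "chain_step p e (f j) (f (Suc j))" if "j < m" for j
    unfolding chain_step_iff_same_side[OF e D] using b[of "Suc j"] that
    by (intro bexI[of _ "b (Suc j)"]) auto
  then have "(chain_step p e ^^ m) \<eta> \<eta>'"
    unfolding relpowp_fun_conv using f by blast
  then show "chain p e \<eta> \<eta>'" by (rule relpowp_imp_rtranclp)
next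
  assume "chain p e \<eta> \<eta>'"
  then obtain m where "(chain_step p e ^^ m) \<eta> \<eta>'" using rtranclp_imp_relpowp by fast
  then obtain f where f: "f 0 = \<eta>" "f m = \<eta>'" "\<And>j. j < m \<Longrightarrow> chain_step p e (f j) (f (Suc j))"
    unfolding relpowp_fun_conv by blast
  then have "\<forall>j. \<exists>b. j < m \<longrightarrow> b \<in> local_roots ty \<Phi> p \<and> f (Suc j) = reflection b 0 (f j) \<and> f j \<notin> wall b 0 \<and> same_side b (f j) D"
    unfolding chain_step_iff_same_side[OF e D] by blast
  then obtain b where b: "\<And>j. j < m \<Longrightarrow> b j \<in> local_roots ty \<Phi> p \<and> f (Suc j) = reflection (b j) 0 (f j) \<and> f j \<notin> wall (b j) 0 \<and> same_side (b j) (f j) D"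
    by metis
  show "weyl_chain ty \<Phi> p D \<eta> \<eta>'"
    unfolding weyl_chain_def
  proof (intro exI conjI ballI)
    fix j assume "j \<in> {1..m}"
    \<comment> \<open>The reflections of \<open>weyl_chain\<close> are numbered from 1, the steps
      from 0. The subtraction is not truncated, because \<open>j\<close> is at least 1.\<close>
    then have "j - 1 < m" "Suc (j - 1) = j" by auto
    with b[of "j - 1"] show "b (j - 1) \<in> local_roots ty \<Phi> p" "f j = reflection (b (j - 1)) 0 (f (j - 1))"
       "f (j - 1) \<notin> wall (b (j - 1)) 0" "same_side (b (j - 1)) (f (j - 1)) D"
      by simp_all
  qed (use f in auto)
qed

section \<open>Simple roots and the lifting property\<close>

text \<open>The vector \<open>y\<close> lies in the relative interior of the panel of the local chamber on the wall of \<open>\<alpha>\<close>.\<close>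

definition simple_root :: "'v \<Rightarrow> 'v \<Rightarrow> 'v \<Rightarrow> 'v \<Rightarrow> bool" where
  "simple_root p e \<alpha> y \<longleftrightarrow> \<alpha> \<in> local_roots ty \<Phi> p \<and> 0 < \<alpha> \<bullet> e \<and> \<alpha> \<bullet> y = 0 \<and>
     (\<forall>b\<in>local_roots ty \<Phi> p. 0 < b \<bullet> e \<longrightarrow> (\<exists>c. b = c *\<^sub>R \<alpha>) \<or> 0 < b \<bullet> y)"

text \<open>The reflection fixes \<open>y\<close>, so the reflected root keeps the positive value of
  \<open>b\<close> there. Were it negative on \<open>e\<close>, its opposite would be positive on
  \<open>e\<close> and negative at \<open>y\<close>, hence a multiple of \<alpha>, and then so would
  \<open>b\<close>.\<close>

lemma simple_reflection_positive:
  assumes e: "local_regular p e" and s: "simple_root p e \<alpha> y"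
    and b: "b \<in> local_roots ty \<Phi> p" "0 < b \<bullet> e" "\<nexists>c. b = c *\<^sub>R \<alpha>"
  shows "0 < reflection \<alpha> 0 b \<bullet> e"
proof (rule ccontr)
  let ?b = "reflection \<alpha> 0 b"
  assume *: "\<not> ?thesis"
  have \<alpha>: "\<alpha> \<in> local_roots ty \<Phi> p" "\<alpha> \<bullet> y = 0" using s by (auto simp: simple_root_def)
  have by_pos: "0 < b \<bullet> y" using s b by (auto simp: simple_root_def)
  have "?b \<bullet> y = b \<bullet> y"
    using inner_reflection_swap[of b \<alpha> y] reflection_fix[of \<alpha> y 0] \<alpha>(2) by simp
  have loc: "- ?b \<in> local_roots ty \<Phi> p"
    using local_root_uminus[OF local_root_reflection[OF \<alpha>(1) b(1)]] .
  then have "- ?b \<bullet> e \<noteq> 0" using e unfolding local_regular_def by blast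
  then have "0 < - ?b \<bullet> e" using * by simp
  moreover have "\<not> 0 < - ?b \<bullet> y" using \<open>?b \<bullet> y = b \<bullet> y\<close> by_pos by simp
  ultimately obtain c where "- ?b = c *\<^sub>R \<alpha>" using s loc unfolding simple_root_def by blast
  then have "?b = (- c) *\<^sub>R \<alpha>" by (metis minus_minus scaleR_minus_left)
  then have "b = reflection \<alpha> 0 ((- c) *\<^sub>R \<alpha>)" by (metis reflection_invol)
  also have "\<dots> = c *\<^sub>R \<alpha>"
    using local_root_nonzero[OF \<alpha>(1)] by (simp add: reflection_def flip: scaleR_diff_left)
  finally show False using b(3) by blast
qed

context
  fixes p e \<alpha> y
  assumes e: "local_regular p e" and simple: "simple_root p e \<alpha> y"
begin

lemma simple_root_pos: "\<alpha> \<in> local_roots ty \<Phi> p" "0 < \<alpha> \<bullet> e" "\<alpha> \<noteq> 0"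
  using simple local_root_nonzero by (auto simp: simple_root_def)

lemma inner_simple_reflection: "\<alpha> \<bullet> reflection \<alpha> 0 v = - (\<alpha> \<bullet> v)"
  using inner_reflection[of \<alpha> 0 v] simple_root_pos by simp

lemma chain_simple_reflection:
  assumes "0 \<le> \<alpha> \<bullet> \<eta>"
  shows "chain p e \<eta> (reflection \<alpha> 0 \<eta>)"
proof (cases "\<alpha> \<bullet> \<eta> = 0")
  case True then show ?thesis using reflection_fix[of \<alpha> \<eta> 0] by simp
next
  case False
  then have "chain_step p e \<eta> (reflection \<alpha> 0 \<eta>)"
    using assms simple_root_pos by (auto simp: chain_step_def)
  then show ?thesis by blast
qed

text \<open>Conjugation by the simple reflection keeps positive every positive root that is not a
  multiple of \<alpha>, and so turns steps into steps; a multiple of \<alpha> gives the simple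
  reflection itself.\<close>

lemma chain_step_cases:
  assumes "chain_step p e \<eta> \<eta>'"
  obtains "0 < \<alpha> \<bullet> \<eta>" "\<eta>' = reflection \<alpha> 0 \<eta>"
  | "chain_step p e (reflection \<alpha> 0 \<eta>) (reflection \<alpha> 0 \<eta>')"
proof -
  from assms obtain b where b: "b \<in> local_roots ty \<Phi> p" "0 < b \<bullet> e" "0 < b \<bullet> \<eta>" "\<eta>' = reflection b 0 \<eta>"
    by (auto simp: chain_step_def)
  show thesis
  proof (cases "\<exists>c. b = c *\<^sub>R \<alpha>")
    case True
    then obtain c where c: "b = c *\<^sub>R \<alpha>" by blast
    then have "0 < c" using b(2) simple_root_pos(2) by (simp add: zero_less_mult_iff)
    then show thesis
      using that(1) b(3,4) c by (simp add: reflection_scaled zero_less_mult_iff)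
  next
    case False
    have "0 < reflection \<alpha> 0 b \<bullet> e"
      using simple_reflection_positive[OF e simple b(1,2) False] .
    moreover have "0 < reflection \<alpha> 0 b \<bullet> reflection \<alpha> 0 \<eta>"
      using b(3) by (simp add: inner_reflection_swap[symmetric] reflection_invol)
    moreover have "reflection \<alpha> 0 \<eta>' = reflection (reflection \<alpha> 0 b) 0 (reflection \<alpha> 0 \<eta>)"
      using b(4) reflection_conjugate by metis
    ultimately show thesis
      using that(2) local_root_reflection[OF simple_root_pos(1) b(1)] by (auto simp: chain_step_def)
  qed
qed

text \<open>Of \<eta> and its mirror image, the one on the side of \<open>e\<close>, from which a
  chain leads to the other; \<open>lower\<close> selects the other. They play the parts of the
  shorter and the longer of w and sw in the Bruhat order.\<close>

definition upper :: "'v \<Rightarrow> 'v" where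
  "upper \<eta> = (if 0 \<le> \<alpha> \<bullet> \<eta> then \<eta> else reflection \<alpha> 0 \<eta>)"

definition lower :: "'v \<Rightarrow> 'v" where
  "lower \<eta> = (if \<alpha> \<bullet> \<eta> \<le> 0 then \<eta> else reflection \<alpha> 0 \<eta>)"

text \<open>A step by the simple reflection stays within one mirror pair and becomes trivial. For
  any other step the mirrored one is a step too, and at most one simple reflection has to be put in
  front.\<close>

lemma chain_upper:
  assumes "chain p e \<eta> \<eta>'"
  shows "chain p e (upper \<eta>) (upper \<eta>')"
  using assms
proof induction
  case (step \<eta>1 \<eta>2)
  have "chain p e (upper \<eta>1) (upper \<eta>2)"
    using \<open>chain_step p e \<eta>1 \<eta>2\<close>
  proof (cases rule: chain_step_cases)
    case 1
    then show ?thesis by (simp add: upper_def inner_simple_reflection reflection_invol)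
  next
    case 2
    consider "0 \<le> \<alpha> \<bullet> \<eta>1" "0 \<le> \<alpha> \<bullet> \<eta>2" | "\<alpha> \<bullet> \<eta>1 < 0" "\<alpha> \<bullet> \<eta>2 < 0"
      | "0 \<le> \<alpha> \<bullet> \<eta>1" "\<alpha> \<bullet> \<eta>2 < 0" | "\<alpha> \<bullet> \<eta>1 < 0" "0 \<le> \<alpha> \<bullet> \<eta>2" by linarith
    then show ?thesis
    proof cases
      \<comment> \<open>The chain goes from \<open>\<eta>1\<close> to its mirror image, then along
        the mirrored step.\<close>
      case 3
      then show ?thesis
        using rtranclp.rtrancl_into_rtrancl[OF chain_simple_reflection[OF 3(1)] 2]
        by (simp add: upper_def)
    next
      \<comment> \<open>The chain goes from the mirror image of \<open>\<eta>1\<close> to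
        \<open>\<eta>1\<close>, then along the given step.\<close>
      case 4
      then have "chain p e (reflection \<alpha> 0 \<eta>1) \<eta>1"
        using chain_simple_reflection[of "reflection \<alpha> 0 \<eta>1"]
        by (simp add: inner_simple_reflection reflection_invol)
      from rtranclp.rtrancl_into_rtrancl[OF this step(2)] show ?thesis
        using 4 by (simp add: upper_def)
    qed (use 2 step(2) in \<open>auto simp: upper_def\<close>)
  qed
  with step.IH show ?case by (rule rtranclp_trans)
qed simp

text \<open>Dual to \<open>chain_upper\<close>: the extra simple reflection is appended at the end
  instead of put in front.\<close>

lemma chain_lower:
  assumes "chain p e \<eta> \<eta>'"
  shows "chain p e (lower \<eta>) (lower \<eta>')"
  using assms
proof induction
  case (step \<eta>1 \<eta>2)
  have "chain p e (lower \<eta>1) (lower \<eta>2)"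
    using \<open>chain_step p e \<eta>1 \<eta>2\<close>
  proof (cases rule: chain_step_cases)
    case 1
    then show ?thesis by (simp add: lower_def inner_simple_reflection reflection_invol)
  next
    case 2
    consider "\<alpha> \<bullet> \<eta>1 \<le> 0" "\<alpha> \<bullet> \<eta>2 \<le> 0" | "0 < \<alpha> \<bullet> \<eta>1" "0 < \<alpha> \<bullet> \<eta>2"
      | "\<alpha> \<bullet> \<eta>1 \<le> 0" "0 < \<alpha> \<bullet> \<eta>2" | "0 < \<alpha> \<bullet> \<eta>1" "\<alpha> \<bullet> \<eta>2 \<le> 0" by linarith
    then show ?thesis
    proof cases
      case 3
      then have "chain p e \<eta>2 (reflection \<alpha> 0 \<eta>2)" using chain_simple_reflection by simp
      from converse_rtranclp_into_rtranclp[OF step(2) this] show ?thesis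
        using 3 by (simp add: lower_def)
    next
      case 4
      then have "chain p e (reflection \<alpha> 0 \<eta>2) \<eta>2"
        using chain_simple_reflection[of "reflection \<alpha> 0 \<eta>2"]
        by (simp add: inner_simple_reflection reflection_invol)
      from converse_rtranclp_into_rtranclp[OF 2 this] show ?thesis
        using 4 by (simp add: lower_def)
    qed (use 2 step(2) in \<open>auto simp: lower_def\<close>)
  qed
  with step.IH show ?case by (rule rtranclp_trans)
qed simp

text \<open>The simple reflection maps the first set injectively into the second and misses
  \<alpha>, whose preimage would be \<open>- \<alpha>\<close>, not a positive root. This is the
  measure of both inductions.\<close>

lemma card_negative_roots_decreases:
  assumes neg: "\<alpha> \<bullet> \<eta> < 0"
  shows "card {b \<in> local_roots ty \<Phi> p. 0 < b \<bullet> e \<and> b \<bullet> reflection \<alpha> 0 \<eta> < 0}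
       < card {b \<in> local_roots ty \<Phi> p. 0 < b \<bullet> e \<and> b \<bullet> \<eta> < 0}" (is "card ?N' < card ?N")
proof -
  have fin: "finite ?N" using finite_local_roots by simp
  have inj: "inj_on (reflection \<alpha> 0) ?N'" by (intro inj_onI) (metis reflection_invol)
  have "card ?N' = card (reflection \<alpha> 0 ` ?N')"
    by (rule card_image[OF inj, symmetric])
  also have "\<dots> \<le> card (?N - {\<alpha>})"
  proof (rule card_mono)
    show "reflection \<alpha> 0 ` ?N' \<subseteq> ?N - {\<alpha>}"
    proof (clarify, intro DiffI)
      fix b assume b: "b \<in> local_roots ty \<Phi> p" "0 < b \<bullet> e" "b \<bullet> reflection \<alpha> 0 \<eta> < 0"
      have nc: "\<nexists>c. b = c *\<^sub>R \<alpha>"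
      proof
        assume "\<exists>c. b = c *\<^sub>R \<alpha>"
        then obtain c where c: "b = c *\<^sub>R \<alpha>" by blast
        then have "0 < c" using b(2) simple_root_pos(2) by (simp add: zero_less_mult_iff)
        then show False using b(3) neg c by (simp add: inner_simple_reflection zero_less_mult_iff)
      qed
      have "reflection \<alpha> 0 b \<bullet> \<eta> < 0" using b(3) by (simp add: inner_reflection_swap)
      then show "reflection \<alpha> 0 b \<in> ?N"
        using local_root_reflection[OF simple_root_pos(1) b(1)]
          simple_reflection_positive[OF e simple b(1,2) nc] by simp
      show "reflection \<alpha> 0 b \<notin> {\<alpha>}"
      proof
        assume "reflection \<alpha> 0 b \<in> {\<alpha>}"
        then have "b = reflection \<alpha> 0 \<alpha>" by (metis reflection_invol singletonD)
        also have "\<dots> = (-1) *\<^sub>R \<alpha>"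
          using simple_root_pos(3) by (simp add: reflection_def scaleR_2)
        finally show False using nc by blast
      qed
    qed
  qed (use fin in simp)
  also have "\<dots> < card ?N"
    using fin neg simple_root_pos by (intro psubset_card_mono) auto
  finally show ?thesis .
qed

end

text \<open>The segment from a generic point \<open>v\<close> of the open local chamber to \<eta>
  leaves the chamber through a panel. Its wall gives \<alpha>, the exit point gives
  \<open>y\<close>.\<close>

lemma exists_simple_root:
  assumes e: "local_regular p e" and b0: "b\<^sub>0 \<in> local_roots ty \<Phi> p" "0 < b\<^sub>0 \<bullet> e" "b\<^sub>0 \<bullet> \<eta> < 0"
  shows "\<exists>\<alpha> y. simple_root p e \<alpha> y \<and> \<alpha> \<bullet> \<eta> < 0"
proof -
  let ?L = "local_roots ty \<Phi> p"
  define Pos where "Pos = {b \<in> ?L. 0 < b \<bullet> e}"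
  have finP: "finite Pos" using finite_local_roots by (simp add: Pos_def)
  define U where "U = (\<Inter>b\<in>Pos. {v. 0 < b \<bullet> v})"
  \<comment> \<open>For two roots negative on \<eta>, such a combination is orthogonal to
    \<open>v\<close> exactly when both vanish at the same parameter of the segment from
    \<open>v\<close> to \<eta>. Removing 0 exempts proportional pairs.\<close>
  define N where "N = (\<lambda>(a, b). (b \<bullet> \<eta>) *\<^sub>R a - (a \<bullet> \<eta>) *\<^sub>R b) ` (Pos \<times> Pos) - {0}"
  have "open U" unfolding U_def
    using finP by (intro open_INT ballI open_Collect_less continuous_intros)
  moreover have "e \<in> U" by (auto simp: U_def Pos_def)
  moreover have "finite N" using finP by (simp add: N_def)
  moreover have "0 \<notin> N" by (simp add: N_def)
  ultimately obtain v where v: "v \<in> U" "\<forall>n\<in>N. n \<bullet> v \<noteq> 0"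
    using exists_off_hyperplanes[of U N] by blast
  have vpos: "0 < b \<bullet> v" if "b \<in> Pos" for b using v(1) that by (auto simp: U_def)
  define Neg where "Neg = {b \<in> Pos. b \<bullet> \<eta> < 0}"
  \<comment> \<open>The parameter at which the segment from \<open>v\<close> to \<eta> meets the
    wall of \<open>b\<close>; its minimum is the exit time.\<close>
  define r where "r b = (b \<bullet> v) / (b \<bullet> v - b \<bullet> \<eta>)" for b
  have "finite Neg" "Neg \<noteq> {}" using finP b0 by (simp_all add: Neg_def) (auto simp: Pos_def)
  then obtain \<alpha> where \<alpha>: "\<alpha> \<in> Neg" and min: "\<And>b. b \<in> Neg \<Longrightarrow> r \<alpha> \<le> r b"
    using arg_min_if_finite[of Neg r] by (metis not_le)
  have \<alpha>': "\<alpha> \<in> Pos" "\<alpha> \<bullet> \<eta> < 0" using \<alpha> by (auto simp: Neg_def)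
  define t y where "t = r \<alpha>" and "y = v + t *\<^sub>R (\<eta> - v)"
  have iy: "b \<bullet> y = (1 - t) * (b \<bullet> v) + t * (b \<bullet> \<eta>)" for b
    by (simp add: y_def inner_add_right inner_diff_right algebra_simps)
  have den: "0 < b \<bullet> v - b \<bullet> \<eta>" if "b \<in> Neg" for b
    using that vpos[of b] by (simp add: Neg_def)
  have t: "0 < t" "t < 1"
    using vpos[OF \<alpha>'(1)] \<alpha>'(2) by (auto simp: t_def r_def field_simps)
  have "\<alpha> \<bullet> y = 0"
  proof -
    have "t * (\<alpha> \<bullet> v - \<alpha> \<bullet> \<eta>) = \<alpha> \<bullet> v" using den[OF \<alpha>] by (simp add: t_def r_def)
    then show ?thesis by (simp add: iy algebra_simps)
  qed
  moreover have "(\<exists>c. b = c *\<^sub>R \<alpha>) \<or> 0 < b \<bullet> y" if b: "b \<in> Pos" for b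
  proof (cases "b \<bullet> \<eta> < 0")
    case False
    then have "0 < (1 - t) * (b \<bullet> v)" "0 \<le> t * (b \<bullet> \<eta>)" using t vpos[OF b] by auto
    then show ?thesis by (simp add: iy)
  next
    case True
    then have bN: "b \<in> Neg" using b by (simp add: Neg_def)
    have rb: "r b * (b \<bullet> v - b \<bullet> \<eta>) = b \<bullet> v" using den[OF bN] by (simp add: r_def)
    have by_eq: "b \<bullet> y = (r b - t) * (b \<bullet> v - b \<bullet> \<eta>)"
      unfolding iy left_diff_distrib rb by (simp add: algebra_simps)
    show ?thesis
    proof (cases "r b = t")
      case False
      then have "0 < r b - t" using min[OF bN] by (simp add: t_def)
      then show ?thesis using by_eq den[OF bN] by simp
    next
      case True
      have "(b \<bullet> v) * (\<alpha> \<bullet> v - \<alpha> \<bullet> \<eta>) = (\<alpha> \<bullet> v) * (b \<bullet> v - b \<bullet> \<eta>)"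
        using True den[OF bN] den[OF \<alpha>] by (simp add: t_def r_def frac_eq_eq)
      then have "((\<alpha> \<bullet> \<eta>) *\<^sub>R b - (b \<bullet> \<eta>) *\<^sub>R \<alpha>) \<bullet> v = 0"
        by (simp add: inner_diff_left algebra_simps)
      moreover have "(\<alpha> \<bullet> \<eta>) *\<^sub>R b - (b \<bullet> \<eta>) *\<^sub>R \<alpha> \<in> insert 0 N"
        using b \<alpha>'(1) by (force simp: N_def)
      ultimately have "(\<alpha> \<bullet> \<eta>) *\<^sub>R b - (b \<bullet> \<eta>) *\<^sub>R \<alpha> = 0" using v(2) by blast
      then have "(\<alpha> \<bullet> \<eta>) *\<^sub>R b = (b \<bullet> \<eta>) *\<^sub>R \<alpha>" by simp
      then have "inverse (\<alpha> \<bullet> \<eta>) *\<^sub>R ((\<alpha> \<bullet> \<eta>) *\<^sub>R b) = inverse (\<alpha> \<bullet> \<eta>) *\<^sub>R ((b \<bullet> \<eta>) *\<^sub>R \<alpha>)" by simp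
      then have "b = (inverse (\<alpha> \<bullet> \<eta>) * (b \<bullet> \<eta>)) *\<^sub>R \<alpha>" using \<alpha>'(2) by simp
      then show ?thesis by blast
    qed
  qed
  ultimately have "simple_root p e \<alpha> y"
    using \<alpha>'(1) by (auto simp: simple_root_def Pos_def)
  then show ?thesis using \<alpha>'(2) by blast
qed

lemma local_regular_towards:
  assumes "regular u"
  shows "local_regular p (u - p)"
  unfolding local_regular_def
proof
  fix b assume "b \<in> local_roots ty \<Phi> p"
  then obtain k where k: "b \<in> \<Phi>" "k \<in> levels ty" "b \<bullet> p + k = 0" by (auto simp: mem_local_roots)
  have "b \<bullet> u + k \<noteq> 0" using assms k by (simp add: regular_def)
  then show "b \<bullet> (u - p) \<noteq> 0" using k(3) by (simp add: inner_diff_right)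
qed

text \<open>The direction \<open>y\<close> only describes a panel of the local chamber. The point
  \<open>p + \<epsilon> *\<^sub>R y\<close> lies in a panel of the alcove itself when \<epsilon> is
  small enough for the walls that miss \<open>p\<close> to be avoided.\<close>

lemma simple_root_panel_point:
  assumes u: "regular u" "p \<in> cell u" and s: "simple_root p (u - p) \<alpha> y"
  shows "\<exists>k x. \<alpha> \<bullet> p + k = 0 \<and> panel_point \<alpha> k u x"
proof -
  obtain k where k: "\<alpha> \<in> \<Phi>" "k \<in> levels ty" "\<alpha> \<bullet> p + k = 0" "0 < \<alpha> \<bullet> (u - p)" "\<alpha> \<bullet> y = 0"
    using s by (auto simp: simple_root_def mem_local_roots)
  have "\<forall>\<^sub>F s in at_right (0::real). 0 < s \<and>
     (\<forall>a\<in>\<Phi>. \<forall>k\<in>levels ty. a \<bullet> p + k \<noteq> 0 \<longrightarrow> 0 < (a \<bullet> p + k) * (a \<bullet> (p + s *\<^sub>R y) + k))"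
    using eventually_line[OF locally_finite, of p y] eventually_pos by eventually_elim auto
  then obtain \<epsilon> where \<epsilon>: "0 < \<epsilon>"
     "\<And>a k. a \<in> \<Phi> \<Longrightarrow> k \<in> levels ty \<Longrightarrow> a \<bullet> p + k \<noteq> 0 \<Longrightarrow> 0 < (a \<bullet> p + k) * (a \<bullet> (p + \<epsilon> *\<^sub>R y) + k)"
    using eventually_happens'[OF trivial_limit_at_right_real] by blast
  define x where "x = p + \<epsilon> *\<^sub>R y"
  have thru: "b \<bullet> x + l = \<epsilon> * (b \<bullet> y)" if "b \<bullet> p + l = 0" for b l
  proof -
    have "l = - (b \<bullet> p)" using that by simp
    then show ?thesis by (simp add: x_def inner_add_right)
  qed
  have dich: "(\<exists>c. b = c *\<^sub>R \<alpha>) \<or> 0 < (b \<bullet> (u - p)) * (b \<bullet> y)" if b: "b \<in> local_roots ty \<Phi> p" for b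
  proof -
    have "b \<bullet> (u - p) \<noteq> 0" using local_regular_towards[OF u(1)] b unfolding local_regular_def by blast
    then consider "0 < b \<bullet> (u - p)" | "0 < - b \<bullet> (u - p)" by fastforce
    then show ?thesis
    proof cases
      case 1
      then have "(\<exists>c. b = c *\<^sub>R \<alpha>) \<or> 0 < b \<bullet> y" using s b unfolding simple_root_def by blast
      then show ?thesis using 1 by auto
    next
      case 2
      then have "(\<exists>c. - b = c *\<^sub>R \<alpha>) \<or> 0 < - b \<bullet> y"
        using s local_root_uminus[OF b] unfolding simple_root_def by blast
      moreover have "- b = c *\<^sub>R \<alpha> \<Longrightarrow> b = (- c) *\<^sub>R \<alpha>" for c by (metis minus_minus scaleR_minus_left)
      moreover have "0 < - b \<bullet> y \<Longrightarrow> 0 < (b \<bullet> (u - p)) * (b \<bullet> y)" using 2 by (simp add: mult_neg_neg)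
      ultimately show ?thesis by blast
    qed
  qed
  have bu: "b \<bullet> u + l = b \<bullet> (u - p)" if "b \<bullet> p + l = 0" for b l
    using that by (simp add: inner_diff_right)
  have "x \<in> cell u"
    unfolding cell_def
  proof (clarify)
    fix b l assume b: "b \<in> \<Phi>" "l \<in> levels ty"
    show "0 \<le> (b \<bullet> u + l) * (b \<bullet> x + l)"
    proof (cases "b \<bullet> p + l = 0")
      case True
      then have loc: "b \<in> local_roots ty \<Phi> p" using b mem_local_roots by blast
      have "0 \<le> (b \<bullet> (u - p)) * (b \<bullet> y)"
        using dich[OF loc] k(5) by auto
      then have "0 \<le> \<epsilon> * ((b \<bullet> (u - p)) * (b \<bullet> y))" using \<epsilon>(1) by simp
      then show ?thesis unfolding bu[OF True] thru[OF True] by (simp only: mult.left_commute)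
    next
      case False
      have "0 \<le> (b \<bullet> p + l) * (b \<bullet> u + l)" using u(2) b by (simp add: cell_def mult.commute)
      then have "0 \<le> (b \<bullet> x + l) * (b \<bullet> u + l)"
        using mult_pos_nonneg_iff[OF \<epsilon>(2)[OF b False]] by (simp add: x_def)
      then show ?thesis by (simp only: mult.commute)
    qed
  qed
  moreover have "\<exists>c. b = c *\<^sub>R \<alpha>" if b: "b \<in> \<Phi>" "l \<in> levels ty" "b \<bullet> x + l = 0" for b l
  proof -
    have True: "b \<bullet> p + l = 0" using \<epsilon>(2)[OF b(1,2)] b(3) by (auto simp: x_def)
    then have "b \<in> local_roots ty \<Phi> p" "b \<bullet> y = 0"
      using b thru[OF True] \<epsilon>(1) mem_local_roots by auto
    then show ?thesis using dich by fastforce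
  qed
  ultimately have "panel_point \<alpha> k u x"
    using k u(1) bu[OF k(3)] thru[OF k(3)] by (simp add: panel_point_def)
  then show ?thesis using k(3) by blast
qed

end

section \<open>Retractions and geodesics\<close>

text \<open>The triangle inequality turns both bounds into equalities, and Stewart's formula then
  makes the squared distance between the two points 0. With inequalities as hypotheses the lemma
  applies to images under 1-Lipschitz maps.\<close>

lemma segment_point_unique:
  fixes a b m :: "'e::real_inner"
  assumes "dist a m \<le> t * dist a b" "dist m b \<le> (1 - t) * dist a b"
  shows "m = (1 - t) *\<^sub>R a + t *\<^sub>R b"
proof -
  let ?m = "(1 - t) *\<^sub>R a + t *\<^sub>R b"
  have "dist a b \<le> dist a m + dist m b" by (rule dist_triangle)
  moreover have "t * dist a b + (1 - t) * dist a b = dist a b" by (simp add: algebra_simps)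
  ultimately have eq: "dist a m = t * dist a b" "dist m b = (1 - t) * dist a b"
    using assms by linarith+
  have "(m - ?m) \<bullet> (m - ?m)
      = (1 - t) * ((m - a) \<bullet> (m - a)) + t * ((m - b) \<bullet> (m - b)) - t * (1 - t) * ((a - b) \<bullet> (a - b))"
    by (simp add: inner_diff_left inner_diff_right inner_add_left inner_add_right inner_commute algebra_simps)
  also have "\<dots> = (1 - t) * (dist m a)\<^sup>2 + t * (dist m b)\<^sup>2 - t * (1 - t) * (dist a b)\<^sup>2"
    by (simp add: dist_norm power2_norm_eq_inner)
  also have "\<dots> = 0" unfolding dist_commute[of m a] eq by (simp add: power2_eq_square algebra_simps)
  finally show ?thesis by simp
qed

sublocale building \<subseteq> root_datum ty \<Phi>
  by unfold_locales (rule root_system)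

section \<open>Charts, alcoves and apartments\<close>

context building
begin

abbreviation agree :: "'v \<Rightarrow> ('v \<Rightarrow> 'i) \<Rightarrow> ('v \<Rightarrow> 'i) \<Rightarrow> bool" where
  "agree u f g \<equiv> \<forall>v\<in>cell u. f v = g v"

lemma chart_inj: "f \<in> At \<Longrightarrow> f v = f v' \<longleftrightarrow> v = v'"
  by (metis chart_isometry dist_eq_0_iff)

lemma chart_reflection:
  assumes "f \<in> At" "\<alpha> \<in> \<Phi>" "k \<in> levels ty"
  shows "f \<circ> reflection \<alpha> k \<in> At"
  using assms chart_comp_weyl reflection_in_weyl_group by blast

lemma alcoves_iff: "c \<in> alcoves ty \<Phi> At \<longleftrightarrow> (\<exists>h\<in>At. \<exists>u. regular u \<and> c = h ` cell u)"
  by (auto simp: alcoves_def alcoves_of_def apartments_def closed_chambers_walls)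

lemma image_cell_alcove: "h \<in> At \<Longrightarrow> regular u \<Longrightarrow> h ` cell u \<in> alcoves ty \<Phi> At"
  using alcoves_iff by blast

text \<open>The definition of \<open>apartment_iso\<close> provides one chart; every other chart of
  the apartment differs from it by an element of the Weyl group.\<close>

lemma apartment_iso_chart:
  assumes "apartment_iso At A B \<phi>" "f \<in> At" "range f = A"
  shows "\<phi> \<circ> f \<in> At \<and> range (\<phi> \<circ> f) = B"
proof -
  obtain f0 where f0: "f0 \<in> At" "range f0 = A" "\<phi> \<circ> f0 \<in> At" "range (\<phi> \<circ> f0) = B"
    using assms(1) by (auto simp: apartment_iso_def)
  obtain w where w: "w \<in> weyl_group ty \<Phi>" "f = f0 \<circ> w"
    using chart_unique[OF f0(1) assms(2)] f0(2) assms(3) by blast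
  have "\<phi> \<circ> f = (\<phi> \<circ> f0) \<circ> w" using w(2) by (simp add: comp_assoc)
  moreover have "range (\<phi> \<circ> f) = range (\<phi> \<circ> f0)"
    using f0(2) assms(3) by (metis image_comp)
  ultimately show ?thesis using chart_comp_weyl[OF f0(3) w(1)] f0(4) by simp
qed

text \<open>The uniqueness axiom with both alcoves equal: apartments that share an alcove are
  isomorphic over it.\<close>

lemma chart_transport:
  assumes "h \<in> At" "f \<in> At" "regular u" "h ` cell u \<subseteq> range f"
  shows "\<exists>g\<in>At. range g = range f \<and> agree u g h"
proof -
  have c: "h ` cell u \<in> alcoves ty \<Phi> At" using image_cell_alcove assms by blast
  have "range h \<in> apartments At" "range f \<in> apartments At"
    using assms by (auto simp: apartments_def)
  then obtain \<phi> where \<phi>: "apartment_iso At (range h) (range f) \<phi>" "\<forall>p\<in>h ` cell u \<union> h ` cell u. \<phi> p = p"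
    using common_apartment_unique[OF c c, of "range h" "range f"] assms(4) by blast
  from apartment_iso_chart[OF \<phi>(1) assms(1)] \<phi>(2) show ?thesis
    by (intro bexI[of _ "\<phi> \<circ> h"]) auto
qed

text \<open>Working form of the apartment axioms: a common apartment of two alcoves comes with a
  chart that keeps the coordinates of the first.\<close>

lemma exists_chart_extending:
  assumes "g \<in> At" "regular u" "h \<in> At" "regular w"
  shows "\<exists>f\<in>At. agree u f g \<and> h ` cell w \<subseteq> range f"
proof -
  obtain E where E: "E \<in> At" "g ` cell u \<subseteq> range E" "h ` cell w \<subseteq> range E"
    using common_apartment[OF image_cell_alcove[OF assms(1,2)] image_cell_alcove[OF assms(3,4)]]
    by (auto simp: apartments_def)
  show ?thesis using chart_transport[OF assms(1) E(1) assms(2) E(2)] E(3) by metis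
qed

lemma alcove_in_chart:
  assumes "h \<in> At" "f \<in> At" "regular u" "h ` cell u \<subseteq> range f"
  shows "\<exists>u'. regular u' \<and> h ` cell u = f ` cell u'"
proof -
  obtain g where g: "g \<in> At" "range g = range f" "agree u g h"
    using chart_transport[OF assms] by blast
  obtain w where w: "w \<in> weyl_group ty \<Phi>" "g = f \<circ> w"
    using chart_unique[OF assms(2) g(1)] g(2) by metis
  have "h ` cell u = g ` cell u" using g(3) by (intro image_cong) auto
  also have "\<dots> = f ` (w ` cell u)" using w(2) by (simp only: image_comp)
  finally show ?thesis using weyl_group_cell[OF w(1) assms(3)] by auto
qed

lemma agree_point_unique:
  assumes "f \<in> At" "g \<in> At" "regular u" "agree u f g" "f v = g v'"
  shows "v = v'"
proof (rule cell_separates_points[OF assms(3)], rule ballI)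
  fix y assume y: "y \<in> cell u"
  have "dist v y = dist (f v) (f y)" using assms chart_isometry by metis
  also have "\<dots> = dist (g v') (g y)" using assms y by simp
  also have "\<dots> = dist v' y" using assms chart_isometry by metis
  finally show "dist v y = dist v' y" .
qed

lemma agree_on_common:
  assumes "f \<in> At" "g \<in> At" "regular u" "agree u f g" "f v \<in> range g"
  shows "f v = g v"
  using assms agree_point_unique by blast

text \<open>Take an alcove of \<open>f\<close> at the point \<open>h u\<close>, and a chart through
  both alcoves. There \<open>u\<close> is interior to one and belongs to the other, so they
  coincide.\<close>

lemma alcove_subset_range:
  assumes "h \<in> At" "f \<in> At" "regular u" "h u \<in> range f"
  shows "h ` cell u \<subseteq> range f"
proof -
  obtain v where v: "h u = f v" using assms by blast
  obtain w where w: "regular w" "v \<in> cell w" using exists_cell by blast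
  obtain k where k: "k \<in> At" "agree u k h" "f ` cell w \<subseteq> range k"
    using exists_chart_extending[OF assms(1,3,2) w(1)] by blast
  obtain w' where w': "regular w'" "f ` cell w = k ` cell w'"
    using alcove_in_chart[OF assms(2) k(1) w(1) k(3)] by blast
  have "k u \<in> k ` cell w'" using v k(2) w(2) w'(2) mem_cell_self by (metis image_eqI)
  then have "u \<in> cell w'" by (auto simp: chart_inj[OF k(1)])
  then have "cell u = cell w'" using cell_eq w'(1) assms(3) by blast
  moreover have "h ` cell u = k ` cell u" using k(2) by (intro image_cong) auto
  ultimately have "h ` cell u = f ` cell w" using w'(2) by simp
  then show ?thesis by blast
qed

lemma exists_chart_at:
  obtains h u v where "h \<in> At" "regular u" "v \<in> cell u" "q = h v"
proof -
  obtain h v where "h \<in> At" "q = h v"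
  proof -
    have "q \<in> \<Union>(apartments At)" using apartments_cover by simp
    then show ?thesis using that by (auto simp: apartments_def)
  qed
  moreover obtain u where "regular u" "v \<in> cell u" using exists_cell by blast
  ultimately show thesis using that by blast
qed

lemma exists_chart_extending_point:
  assumes "g \<in> At" "regular u"
  shows "\<exists>f\<in>At. agree u f g \<and> q \<in> range f"
proof -
  obtain h w v where h: "h \<in> At" "regular w" "v \<in> cell w" "q = h v" by (rule exists_chart_at)
  show ?thesis using exists_chart_extending[OF assms h(1,2)] h(3,4) by blast
qed

lemma two_points_in_chart:
  obtains E a b where "E \<in> At" "q = E a" "r = E b"
proof -
  obtain h u v where h: "h \<in> At" "regular u" "v \<in> cell u" "q = h v" by (rule exists_chart_at)
  obtain f where f: "f \<in> At" "agree u f h" "r \<in> range f"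
    using exists_chart_extending_point[OF h(1,2)] by blast
  then show thesis using that[of f v] h by auto
qed

text \<open>The retraction centered at the alcove \<open>g ` cell u\<close>, in the coordinates given by \<open>g\<close>.\<close>

definition retr :: "'v \<Rightarrow> ('v \<Rightarrow> 'i) \<Rightarrow> 'i \<Rightarrow> 'v" where
  "retr u g q = (THE v. \<forall>y\<in>cell u. dist q (g y) = dist v y)"

lemma retr_eq:
  assumes "regular u" "\<And>y. y \<in> cell u \<Longrightarrow> dist q (g y) = dist v y"
  shows "retr u g q = v"
  unfolding retr_def using assms cell_separates_points by (intro the_equality) auto

lemma retr_chart:
  assumes "f \<in> At" "regular u" "agree u f g"
  shows "retr u g (f v) = v"
  using assms by (intro retr_eq) (auto simp: chart_isometry simp flip: bspec[OF assms(3)])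

lemma retr_isometric_on_alcove:
  assumes "g \<in> At" "regular u" "h \<in> At" "regular w" "a \<in> cell w" "b \<in> cell w"
  shows "dist (retr u g (h a)) (retr u g (h b)) = dist a b"
proof -
  obtain f where f: "f \<in> At" "agree u f g" "h ` cell w \<subseteq> range f"
    using exists_chart_extending[OF assms(1-4)] by blast
  obtain a' b' where ab: "h a = f a'" "h b = f b'" using f(3) assms by blast
  have "dist a' b' = dist a b" using ab f(1) assms(3) chart_isometry by metis
  then show ?thesis using ab retr_chart[OF f(1) assms(2) f(2)] by simp
qed

text \<open>Along a segment, the retracted point moves at the speed \<open>L\<close> of the segment
  on either side of each parameter, because a germ lies in a single alcove. The bisection principle
  \<open>Bolzano\<close> adds up these local estimates without a count of the alcoves
  crossed.\<close>

lemma retr_lipschitz: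
  assumes g: "g \<in> At" and u: "regular u"
  shows "dist (retr u g q) (retr u g r) \<le> dist q r"
proof -
  obtain E a b where E: "E \<in> At" "q = E a" "r = E b" by (rule two_points_in_chart)
  define l where "l s = a + s *\<^sub>R (b - a)" for s
  define F where "F s = retr u g (E (l s))" for s
  define L where "L = dist a b"
  have dl: "dist (l s) (l s') = L * \<bar>s - s'\<bar>" for s s'
    by (simp add: l_def L_def dist_norm norm_minus_commute flip: scaleR_diff_left)
  \<comment> \<open>The two germs at \<open>x\<close> may lie in different alcoves; \<sigma> is 1 or
    -1 and selects one of them.\<close>
  have side: "\<exists>d>0. \<forall>s\<in>{0..d}. dist (F x) (F (x + \<sigma> * s)) = L * s" if \<sigma>: "\<bar>\<sigma>\<bar> = 1" for x \<sigma>
  proof -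
    obtain w where w: "regular w" "l x \<in> cell w" "\<forall>\<^sub>F s in at_right 0. l x + s *\<^sub>R (\<sigma> *\<^sub>R (b - a)) \<in> cell w"
      using germ_in_cell by blast
    obtain d where d: "0 < d" "\<And>s. 0 < s \<Longrightarrow> s < d \<Longrightarrow> l x + s *\<^sub>R (\<sigma> *\<^sub>R (b - a)) \<in> cell w"
      using w(3) unfolding eventually_at_right_field by blast
    have "dist (F x) (F (x + \<sigma> * s)) = L * s" if "s \<in> {0..d/2}" for s
    proof (cases "s = 0")
      case False
      have eq: "l x + s *\<^sub>R (\<sigma> *\<^sub>R (b - a)) = l (x + \<sigma> * s)" by (simp add: l_def algebra_simps)
      have "l (x + \<sigma> * s) \<in> cell w" using d(2)[of s] that False d(1) unfolding eq by auto
      then have "dist (F x) (F (x + \<sigma> * s)) = dist (l x) (l (x + \<sigma> * s))"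
        unfolding F_def by (intro retr_isometric_on_alcove[OF g u E(1) w(1,2)])
      also have "\<dots> = L * s" using \<sigma> that by (simp add: dl abs_mult)
      finally show ?thesis .
    qed simp
    then show ?thesis using d(1) by (intro exI[of _ "d/2"]) auto
  qed
  have "dist (F 0) (F 1) \<le> L * (1 - 0)"
  proof (rule Bolzano[of 0 1 "\<lambda>s s'. dist (F s) (F s') \<le> L * (s' - s)"])
    fix s1 s2 s3
    assume "dist (F s1) (F s2) \<le> L * (s2 - s1)" "dist (F s2) (F s3) \<le> L * (s3 - s2)"
    then show "dist (F s1) (F s3) \<le> L * (s3 - s1)"
      using dist_triangle[of "F s1" "F s3" "F s2"] by (simp add: algebra_simps)
  next
    fix x :: real
    obtain d1 d2 where d: "0 < d1" "\<And>s. s \<in> {0..d1} \<Longrightarrow> dist (F x) (F (x + 1 * s)) = L * s"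
       "0 < d2" "\<And>s. s \<in> {0..d2} \<Longrightarrow> dist (F x) (F (x + (-1) * s)) = L * s"
      using side[of 1 x] side[of "-1" x] by auto
    show "\<exists>d>0. \<forall>s s'. s \<le> x \<and> x \<le> s' \<and> s' - s < d \<longrightarrow> dist (F s) (F s') \<le> L * (s' - s)"
    proof (intro exI[of _ "min d1 d2"] conjI allI impI)
      fix s s' assume s: "s \<le> x \<and> x \<le> s' \<and> s' - s < min d1 d2"
      have "dist (F x) (F s') = L * (s' - x)" "dist (F x) (F s) = L * (x - s)"
        using d(2)[of "s' - x"] d(4)[of "x - s"] s by auto
      then show "dist (F s) (F s') \<le> L * (s' - s)"
        using dist_triangle[of "F s" "F s'" "F x"] by (simp add: dist_commute algebra_simps)
    qed (use d in auto)
  qed simp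
  then show ?thesis
    using E by (simp add: F_def l_def L_def chart_isometry)
qed

text \<open>The retraction is centred at an alcove that contains the expected point. It sends
  \<open>m\<close> to the coordinates of that point by \<open>segment_point_unique\<close>, and a
  chart through \<open>m\<close> that agrees with \<open>E\<close> on the alcove shows that
  \<open>m\<close> is this point.\<close>

lemma geodesic_in_chart:
  assumes E: "E \<in> At" and t: "dist (E a) m \<le> t * dist a b" "dist m (E b) \<le> (1 - t) * dist a b"
  shows "m = E ((1 - t) *\<^sub>R a + t *\<^sub>R b)"
proof -
  let ?m = "(1 - t) *\<^sub>R a + t *\<^sub>R b"
  obtain u where u: "regular u" "?m \<in> cell u" using exists_cell by blast
  have r: "retr u E (E v) = v" for v using retr_chart[OF E u(1)] by blast
  have "dist a (retr u E m) \<le> t * dist a b" "dist (retr u E m) b \<le> (1 - t) * dist a b"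
    using t retr_lipschitz[OF E u(1), of "E a" m] retr_lipschitz[OF E u(1), of m "E b"] unfolding r by linarith+
  then have m: "retr u E m = ?m" by (rule segment_point_unique)
  obtain f where f: "f \<in> At" "agree u f E" "m \<in> range f"
    using exists_chart_extending_point[OF E u(1)] by blast
  then have "m = f (retr u E m)" using retr_chart[OF f(1) u(1) f(2)] by auto
  then show ?thesis using m f(2) u(2) by simp
qed

text \<open>The apartment of \<open>g\<close> contains a segment with the same end points, and
  geodesics are unique.\<close>

lemma chart_range_convex:
  assumes "f \<in> At" "g \<in> At" "f a \<in> range g" "f b \<in> range g" "0 \<le> t" "t \<le> 1"
  shows "f ((1 - t) *\<^sub>R a + t *\<^sub>R b) \<in> range g"
proof -
  let ?m = "(1 - t) *\<^sub>R a + t *\<^sub>R b"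
  obtain a' b' where ab: "f a = g a'" "f b = g b'" using assms by blast
  have "a - ?m = t *\<^sub>R (a - b)" "?m - b = (1 - t) *\<^sub>R (a - b)" by (simp_all add: algebra_simps)
  then have "dist a ?m = t * dist a b" "dist ?m b = (1 - t) * dist a b"
    using assms(5,6) unfolding dist_norm by simp_all
  moreover have "dist a b = dist a' b'" using ab assms(1,2) chart_isometry by metis
  ultimately have "f ?m = g ((1 - t) *\<^sub>R a' + t *\<^sub>R b')"
    using ab assms(1) by (intro geodesic_in_chart[OF assms(2)]) (simp_all add: chart_isometry flip: ab)
  then show ?thesis by blast
qed

text \<open>The CAT(0) inequality, by retraction onto an apartment containing the segment from \<open>q\<close> to \<open>r\<close>,
  centered at an alcove containing \<open>m\<close>.\<close>

lemma cat0_inequality: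
  fixes m p q r :: 'i
  assumes "dist q m \<le> t * dist q r" "dist m r \<le> (1 - t) * dist q r" "0 \<le> t" "t \<le> 1"
  shows "(dist p m)\<^sup>2 \<le> (1 - t) * (dist p q)\<^sup>2 + t * (dist p r)\<^sup>2 - t * (1 - t) * (dist q r)\<^sup>2"
proof -
  obtain E a b where E: "E \<in> At" "q = E a" "r = E b" by (rule two_points_in_chart)
  let ?m = "(1 - t) *\<^sub>R a + t *\<^sub>R b"
  have m: "m = E ?m"
    using assms E by (intro geodesic_in_chart) (simp_all add: chart_isometry)
  obtain u where u: "regular u" "?m \<in> cell u" using exists_cell by blast
  obtain f where f: "f \<in> At" "agree u f E" "p \<in> range f"
    using exists_chart_extending_point[OF E(1) u(1)] by blast
  then obtain v where v: "p = f v" by blast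
  have r: "retr u E (E x) = x" "retr u E (f x) = x" for x
    using retr_chart[OF E(1) u(1)] retr_chart[OF f(1) u(1) f(2)] by auto
  have "dist p m = dist v ?m" using f u(2) m v chart_isometry by metis
  then have "(dist p m)\<^sup>2 = (v - ?m) \<bullet> (v - ?m)" by (simp add: dist_norm power2_norm_eq_inner)
  also have "\<dots> = (1 - t) * ((v - a) \<bullet> (v - a)) + t * ((v - b) \<bullet> (v - b)) - t * (1 - t) * ((a - b) \<bullet> (a - b))"
    by (simp add: inner_diff_left inner_diff_right inner_add_left inner_add_right inner_commute algebra_simps)
  also have "\<dots> = (1 - t) * (dist v a)\<^sup>2 + t * (dist v b)\<^sup>2 - t * (1 - t) * (dist a b)\<^sup>2"
    by (simp add: dist_norm power2_norm_eq_inner)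
  also have "\<dots> \<le> (1 - t) * (dist p q)\<^sup>2 + t * (dist p r)\<^sup>2 - t * (1 - t) * (dist q r)\<^sup>2"
  proof -
    have "dist v a \<le> dist p q" "dist v b \<le> dist p r"
      using retr_lipschitz[OF E(1) u(1), of p q] retr_lipschitz[OF E(1) u(1), of p r] E v by (simp_all add: r)
    then have "(dist v a)\<^sup>2 \<le> (dist p q)\<^sup>2" "(dist v b)\<^sup>2 \<le> (dist p r)\<^sup>2" by (simp_all add: power_mono)
    then show ?thesis
      using assms(3,4) E by (simp add: chart_isometry add_mono mult_left_mono)
  qed
  finally show ?thesis .
qed

text \<open>Two uses of the CAT(0) inequality, one for each side issuing from \<open>p\<close>; the
  terms in \<open>dist p q\<close> and \<open>dist p r\<close> cancel.\<close>

lemma geodesics_spread: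
  fixes p q q' r r' :: 'i
  assumes "dist p q' \<le> \<mu> * dist p q" "dist q' q \<le> (1 - \<mu>) * dist p q"
    and "dist p r' \<le> \<mu> * dist p r" "dist r' r \<le> (1 - \<mu>) * dist p r" and "0 \<le> \<mu>" "\<mu> \<le> 1"
  shows "dist q' r' \<le> \<mu> * dist q r"
proof -
  have q'p: "(dist q' p)\<^sup>2 \<le> (\<mu> * dist p q)\<^sup>2" using assms(1) by (simp add: dist_commute power_mono)
  have 1: "(dist q' r')\<^sup>2 \<le> (1 - \<mu>) * (dist q' p)\<^sup>2 + \<mu> * (dist q' r)\<^sup>2 - \<mu> * (1 - \<mu>) * (dist p r)\<^sup>2"
    by (rule cat0_inequality[OF assms(3-6)])
  have "(dist r q')\<^sup>2 \<le> (1 - \<mu>) * (dist r p)\<^sup>2 + \<mu> * (dist r q)\<^sup>2 - \<mu> * (1 - \<mu>) * (dist p q)\<^sup>2"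
    by (rule cat0_inequality[OF assms(1,2,5,6)])
  then have 2: "\<mu> * (dist q' r)\<^sup>2 \<le> \<mu> * ((1 - \<mu>) * (dist p r)\<^sup>2 + \<mu> * (dist q r)\<^sup>2 - \<mu> * (1 - \<mu>) * (dist p q)\<^sup>2)"
    using assms(5) by (simp add: dist_commute mult_left_mono)
  have 3: "(1 - \<mu>) * (dist q' p)\<^sup>2 \<le> (1 - \<mu>) * (\<mu> * dist p q)\<^sup>2"
    using q'p assms(6) by (simp add: mult_left_mono)
  have "(dist q' r')\<^sup>2 \<le> (\<mu> * dist q r)\<^sup>2"
    using 1 2 3 by (simp add: power2_eq_square algebra_simps)
  then show ?thesis using assms(5) by (simp add: power2_le_iff_abs_le abs_mult)
qed

end

section \<open>Opposite germs at a point\<close>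

lemma wall_through:
  fixes \<alpha> :: "'v::real_inner"
  assumes "0 < \<alpha> \<bullet> (w - p)" "\<alpha> \<bullet> p + k = 0"
  shows "0 < \<alpha> \<bullet> w + k"
  using assms by (simp add: inner_diff_right)

lemma (in root_datum) panel_point_opposite:
  assumes P: "panel_point \<alpha> k u x"
  shows "panel_point (-\<alpha>) (-k) (reflection \<alpha> k u) x"
proof -
  have \<alpha>: "\<alpha> \<in> \<Phi>" "k \<in> levels ty" "regular u" "0 < \<alpha> \<bullet> u + k" "\<alpha> \<bullet> x + k = 0" "x \<in> cell u"
    and mult: "\<And>b l. b \<in> \<Phi> \<Longrightarrow> l \<in> levels ty \<Longrightarrow> b \<bullet> x + l = 0 \<Longrightarrow> \<exists>c. b = c *\<^sub>R \<alpha>"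
    using P by (auto simp: panel_point_def)
  have "\<exists>c. b = c *\<^sub>R (- \<alpha>)" if b: "b \<in> \<Phi>" "l \<in> levels ty" "b \<bullet> x + l = 0" for b l
  proof -
    obtain c where "b = c *\<^sub>R \<alpha>" using mult[OF b] by blast
    then have "b = (- c) *\<^sub>R (- \<alpha>)" by simp
    then show ?thesis by blast
  qed
  moreover have "0 < (- \<alpha>) \<bullet> reflection \<alpha> k u + (- k)"
    using inner_reflection[OF root_nonzero[OF \<alpha>(1)], of k u] \<alpha>(4) by simp
  moreover have "x \<in> cell (reflection \<alpha> k u)"
    using on_wall_in_reflected[OF P \<alpha>(6,5)] .
  moreover have "(- \<alpha>) \<bullet> x + (- k) = 0" using \<alpha>(5) by simp
  ultimately show ?thesis
    using uminus_root[OF \<alpha>(1)] levels_uminus[OF \<alpha>(2)] regular_reflection[OF \<alpha>(1-3)]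
    unfolding panel_point_def by blast
qed

text \<open>The last hypothesis puts \<open>v\<close> in the closed local chamber; roots negative on
  \<open>u - p\<close> are covered through their opposites.\<close>

lemma (in root_datum) eventually_line_in_cell:
  assumes u: "regular u" "p \<in> cell u"
    and nonneg: "\<And>b. b \<in> local_roots ty \<Phi> p \<Longrightarrow> 0 < b \<bullet> (u - p) \<Longrightarrow> 0 \<le> b \<bullet> v"
  shows "\<forall>\<^sub>F s in at_right 0. p + s *\<^sub>R v \<in> cell u"
  using eventually_line[OF locally_finite, of p v] eventually_pos
proof eventually_elim
  case (elim s)
  show ?case unfolding cell_def
  proof (clarify)
    fix b l assume b: "b \<in> \<Phi>" "l \<in> levels ty"
    show "0 \<le> (b \<bullet> u + l) * (b \<bullet> (p + s *\<^sub>R v) + l)"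
    proof (cases "b \<bullet> p + l = 0")
      case True
      then have l: "l = - (b \<bullet> p)" by simp
      have loc: "b \<in> local_roots ty \<Phi> p" using b True mem_local_roots by blast
      have "0 \<le> (b \<bullet> (u - p)) * (b \<bullet> v)"
      proof (cases "0 < b \<bullet> (u - p)")
        case True
        then show ?thesis using nonneg[OF loc] by simp
      next
        case False
        have "b \<bullet> (u - p) \<noteq> 0" using local_regular_towards[OF u(1)] loc unfolding local_regular_def by blast
        then have "0 < - b \<bullet> (u - p)" using False by simp
        then have "0 \<le> - b \<bullet> v" using nonneg[OF local_root_uminus[OF loc]] by blast
        then show ?thesis using False by (simp add: mult_nonpos_nonpos)
      qed
      moreover have "(b \<bullet> u + l) * (b \<bullet> (p + s *\<^sub>R v) + l) = s * ((b \<bullet> (u - p)) * (b \<bullet> v))"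
        by (simp add: l inner_add_right inner_diff_right)
      ultimately show ?thesis using elim(2) by simp
    next
      case False
      then have 1: "0 < (b \<bullet> p + l) * (b \<bullet> (p + s *\<^sub>R v) + l)" using elim(1) b by blast
      have "0 \<le> (b \<bullet> p + l) * (b \<bullet> u + l)" using u(2) b by (simp add: cell_def mult.commute)
      then have "0 \<le> (b \<bullet> (p + s *\<^sub>R v) + l) * (b \<bullet> u + l)" using mult_pos_nonneg_iff[OF 1] by blast
      then show ?thesis by (simp only: mult.commute)
    qed
  qed
qed

context building
begin

lemma agree_on_alcove:
  assumes "f \<in> At" "g \<in> At" "regular u" "agree u f g" "g ` cell w \<subseteq> range f"
  shows "agree w f g"
proof
  fix v assume "v \<in> cell w"
  then have "g v \<in> range f" using assms(5) by blast
  moreover have "agree u g f" using assms(4) by simp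
  ultimately show "f v = g v" using agree_on_common[OF assms(2,1,3)] by metis
qed

context
  fixes \<alpha> k u x
  assumes P: "panel_point \<alpha> k u x"
begin

lemma panel_point_facts: "\<alpha> \<in> \<Phi>" "k \<in> levels ty" "regular u" "0 < \<alpha> \<bullet> u + k" "\<alpha> \<bullet> x + k = 0" "x \<in> cell u"
    "regular (reflection \<alpha> k u)" "x \<in> cell (reflection \<alpha> k u)"
  using P regular_reflection on_wall_in_reflected[OF P] by (auto simp: panel_point_def)

lemma agree_reflected:
  "agree (reflection \<alpha> k u) f g \<longleftrightarrow> agree u (f \<circ> reflection \<alpha> k) (g \<circ> reflection \<alpha> k)"
  using reflection_cell[OF panel_point_facts(1,2), of u, symmetric] by auto

lemma chart_same_side:
  assumes f: "f \<in> At" and h: "h \<in> At" and fh: "agree u f h" and w: "regular w" "0 < \<alpha> \<bullet> w + k"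
  shows "\<exists>\<kappa>\<in>At. agree (reflection \<alpha> k u) \<kappa> f \<and> agree u \<kappa> h \<and> agree w \<kappa> h"
proof -
  let ?su = "reflection \<alpha> k u"
  note P_facts = panel_point_facts
  obtain \<kappa> where \<kappa>: "\<kappa> \<in> At" "agree ?su \<kappa> f" "h ` cell w \<subseteq> range \<kappa>"
    using exists_chart_extending[OF f P_facts(7) h w(1)] by blast
  have "h x = \<kappa> x" using \<kappa>(2) fh P_facts by metis
  then have x: "h x \<in> range \<kappa>" by simp
  have hw: "h w \<in> range \<kappa>" using \<kappa>(3) mem_cell_self by blast
  obtain t where t: "0 < t" "t < 1" "regular ((1 - t) *\<^sub>R x + t *\<^sub>R w)" "(1 - t) *\<^sub>R x + t *\<^sub>R w \<in> cell u"
    using panel_point_line[OF P w(2)] by blast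
  have "h ((1 - t) *\<^sub>R x + t *\<^sub>R w) \<in> range \<kappa>"
    using chart_range_convex[OF h \<kappa>(1) x hw] t by simp
  from alcove_subset_range[OF h \<kappa>(1) t(3) this]
  have hu: "h ` cell u \<subseteq> range \<kappa>" using cell_eq[OF P_facts(3) t(3,4)] by simp
  moreover have "f ` cell u = h ` cell u" using fh by (intro image_cong) auto
  ultimately have "f ` cell u \<subseteq> range \<kappa>" by simp
  from agree_on_alcove[OF \<kappa>(1) f P_facts(7) \<kappa>(2) this] have "agree u \<kappa> f" .
  then have uh: "agree u \<kappa> h" using fh by simp
  show ?thesis using \<kappa>(1,2) uh agree_on_alcove[OF \<kappa>(1) h P_facts(3) uh \<kappa>(3)] by blast
qed

text \<open>Convexity now puts both alcoves across the panel, that of \<open>f\<close> and that of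
  \<open>h\<close>, into one apartment. Being different, they face each other there. In the chart
  \<open>g\<close>, the alcove of \<open>f\<close> across the panel becomes the base, while the far
  side of \<open>h\<close> keeps its coordinates.\<close>

lemma chart_across:
  assumes f: "f \<in> At" and h: "h \<in> At" and fh: "agree u f h" and w: "regular w" "\<alpha> \<bullet> w + k < 0"
    and ne: "f ` cell (reflection \<alpha> k u) \<noteq> h ` cell (reflection \<alpha> k u)"
  shows "\<exists>g\<in>At. agree u g (f \<circ> reflection \<alpha> k) \<and> agree w g h"
proof -
  let ?s = "reflection \<alpha> k"
  note P_facts = panel_point_facts
  obtain \<kappa> where \<kappa>: "\<kappa> \<in> At" "agree (?s u) \<kappa> f" "h ` cell w \<subseteq> range \<kappa>"
    using exists_chart_extending[OF f P_facts(7) h w(1)] by blast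
  have wall_eq: "h y = \<kappa> y" if "y \<in> cell u" "\<alpha> \<bullet> y + k = 0" for y
    using \<kappa>(2) fh on_wall_in_reflected[OF P that] that(1) by metis
  have x: "h x \<in> range \<kappa>" using wall_eq[OF P_facts(6,5)] by simp
  have hw: "h w \<in> range \<kappa>" using \<kappa>(3) mem_cell_self by blast
  have "0 < (- \<alpha>) \<bullet> w + (- k)" using w(2) by simp
  from panel_point_line[OF panel_point_opposite[OF P] this]
  obtain t where t: "0 < t" "t < 1" "regular ((1 - t) *\<^sub>R x + t *\<^sub>R w)" "(1 - t) *\<^sub>R x + t *\<^sub>R w \<in> cell (?s u)"
    by blast
  have "h ((1 - t) *\<^sub>R x + t *\<^sub>R w) \<in> range \<kappa>"
    using chart_range_convex[OF h \<kappa>(1) x hw] t by simp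
  from alcove_subset_range[OF h \<kappa>(1) t(3) this]
  have hsu: "h ` cell (?s u) \<subseteq> range \<kappa>" using cell_eq[OF P_facts(7) t(3,4)] by simp
  then obtain w' where w': "regular w'" "h ` cell (?s u) = \<kappa> ` cell w'"
    using alcove_in_chart[OF h \<kappa>(1) P_facts(7)] by blast
  have "\<kappa> x \<in> \<kappa> ` cell w'" using wall_eq[OF P_facts(6,5)] w'(2) P_facts(8) by (metis imageI)
  then have "x \<in> cell w'" by (auto simp: chart_inj[OF \<kappa>(1)])
  moreover have "\<kappa> ` cell (?s u) = f ` cell (?s u)" using \<kappa>(2) by (intro image_cong) auto
  \<comment> \<open>Only two alcoves of the apartment of \<kappa> contain the panel point. The
    reflected one is that of \<open>f\<close>, so that of \<open>h\<close> is
    \<open>cell u\<close>.\<close>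
  ultimately have img: "h ` cell (?s u) = \<kappa> ` cell u"
    using panel_point_cells[OF P w'(1)] w'(2) ne by (metis (full_types))
  have *: "agree (?s u) (\<kappa> \<circ> ?s) h"
  proof
    fix v assume v: "v \<in> cell (?s u)"
    then obtain v' where v': "v' \<in> cell u" "h v = \<kappa> v'" using img by blast
    \<comment> \<open>Since \<open>h\<close> and \<kappa> agree on the panel, \<open>v'\<close> can
      only be \<open>v\<close> or its mirror image; the first happens only on the wall, where the
      two coincide.\<close>
    have "dist v y = dist v' y" if y: "y \<in> cell u" "\<alpha> \<bullet> y + k = 0" for y
    proof -
      have "dist v y = dist (h v) (h y)" using chart_isometry[OF h] by simp
      also have "\<dots> = dist (\<kappa> v') (\<kappa> y)" using v'(2) wall_eq[OF y] by simp
      also have "\<dots> = dist v' y" using chart_isometry[OF \<kappa>(1)] by simp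
      finally show ?thesis .
    qed
    from panel_equidistant[OF P this] have "v' = v \<or> v' = ?s v" .
    moreover have "v' = v \<Longrightarrow> ?s v = v"
      using reflection_fix cell_inter_reflected[OF P _ v] v'(1) by blast
    ultimately have "v' = ?s v" by metis
    then show "(\<kappa> \<circ> ?s) v = h v" using v'(2) by simp
  qed
  have g: "\<kappa> \<circ> ?s \<in> At" using chart_reflection[OF \<kappa>(1) P_facts(1,2)] .
  have "range (\<kappa> \<circ> ?s) = range \<kappa>" using reflection_surj[of \<alpha> k] by (metis image_comp)
  then have "agree w (\<kappa> \<circ> ?s) h"
    using agree_on_alcove[OF g h P_facts(7) *] \<kappa>(3) by simp
  moreover have "agree u (\<kappa> \<circ> ?s) (f \<circ> ?s)" using \<kappa>(2) agree_reflected by blast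
  ultimately show ?thesis using g by blast
qed

end

text \<open>The germs at \<open>p\<close> of the rays \<open>h (p - s \<eta>)\<close> and \<open>f (p + s \<eta>')\<close> together form a geodesic.\<close>

definition opposite :: "'v \<Rightarrow> ('v \<Rightarrow> 'i) \<Rightarrow> 'v \<Rightarrow> ('v \<Rightarrow> 'i) \<Rightarrow> 'v \<Rightarrow> bool" where
  "opposite p h \<eta> f \<eta>' \<longleftrightarrow>
     (\<forall>\<^sub>F s in at_right 0. dist (h (p - s *\<^sub>R \<eta>)) (f (p + s *\<^sub>R \<eta>')) = 2 * s * norm \<eta>)"

lemma opposite_germs:
  assumes "opposite p h \<eta> f \<eta>'" "norm \<eta>1 = norm \<eta>"
    and "\<forall>\<^sub>F s in at_right 0. h1 (p - s *\<^sub>R \<eta>1) = h (p - s *\<^sub>R \<eta>)"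
    and "\<forall>\<^sub>F s in at_right 0. f1 (p + s *\<^sub>R \<eta>1') = f (p + s *\<^sub>R \<eta>')"
  shows "opposite p h1 \<eta>1 f1 \<eta>1'"
  using assms(1,3,4) unfolding opposite_def assms(2) by eventually_elim simp

text \<open>Equality in the triangle inequality for two vectors of equal norm forces them to be
  equal.\<close>

lemma opposite_in_chart:
  assumes "h \<in> At" "norm \<eta> = norm \<eta>'" "opposite p h \<eta> h \<eta>'"
  shows "\<eta> = \<eta>'"
proof -
  have "\<forall>\<^sub>F s in at_right (0::real). 0 < s \<and> dist (p - s *\<^sub>R \<eta>) (p + s *\<^sub>R \<eta>') = 2 * s * norm \<eta>"
    using assms(3) eventually_pos unfolding opposite_def chart_isometry[OF assms(1)]
    by eventually_elim simp
  then obtain s where s: "0 < s" "dist (p - s *\<^sub>R \<eta>) (p + s *\<^sub>R \<eta>') = 2 * s * norm \<eta>"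
    using eventually_happens'[OF trivial_limit_at_right_real] by blast
  have "(p - s *\<^sub>R \<eta>) - (p + s *\<^sub>R \<eta>') = (- s) *\<^sub>R (\<eta> + \<eta>')" by (simp add: algebra_simps)
  then have "s * norm (\<eta> + \<eta>') = s * (2 * norm \<eta>)" using s unfolding dist_norm by simp
  then have "norm (\<eta> + \<eta>') = 2 * norm \<eta>" using s(1) by simp
  then have "(norm (\<eta> + \<eta>'))\<^sup>2 = 2 * (norm \<eta>)\<^sup>2 + 2 * (norm \<eta>')\<^sup>2"
    using assms(2) by (simp add: power_mult_distrib)
  then have "(\<eta> - \<eta>') \<bullet> (\<eta> - \<eta>') = 0"
    by (simp add: power2_norm_eq_inner inner_add_left inner_add_right inner_diff_left inner_diff_right inner_commute)
  then show ?thesis by simp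
qed

lemma opposite_imp_chain:
  assumes u: "regular u" "p \<in> cell u"
  shows "\<lbrakk>h \<in> At; f \<in> At; agree u f h; norm \<eta> = norm \<eta>'; opposite p h \<eta> f \<eta>'\<rbrakk>
    \<Longrightarrow> chain p (u - p) \<eta> \<eta>'"
proof (induction "card {b \<in> local_roots ty \<Phi> p. 0 < b \<bullet> (u - p) \<and> b \<bullet> \<eta>' < 0}"
    arbitrary: h f \<eta> \<eta>' rule: less_induct)
  case less
  note h = less.prems(1) and f = less.prems(2) and fh = less.prems(3) and nrm = less.prems(4) and opp = less.prems(5)
  have e: "local_regular p (u - p)" using local_regular_towards[OF u(1)] .
  show ?case
  proof (cases "\<exists>b\<in>local_roots ty \<Phi> p. 0 < b \<bullet> (u - p) \<and> b \<bullet> \<eta>' < 0")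
    case False
    then have "\<forall>\<^sub>F s in at_right 0. p + s *\<^sub>R \<eta>' \<in> cell u"
      by (intro eventually_line_in_cell[OF u]) force
    then have ev: "\<forall>\<^sub>F s in at_right 0. h (p + s *\<^sub>R \<eta>') = f (p + s *\<^sub>R \<eta>')"
      by eventually_elim (use fh in auto)
    have "opposite p h \<eta> h \<eta>'" by (rule opposite_germs[OF opp refl _ ev]) simp
    from opposite_in_chart[OF h nrm this] show ?thesis by simp
  next
    case True
    then obtain \<alpha> y where \<alpha>: "simple_root p (u - p) \<alpha> y" "\<alpha> \<bullet> \<eta>' < 0"
      using exists_simple_root[OF e] by blast
    obtain k x where k: "\<alpha> \<bullet> p + k = 0" and P: "panel_point \<alpha> k u x"
      using simple_root_panel_point[OF u \<alpha>(1)] by blast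
    note P_facts = panel_point_facts[OF P]
    let ?s = "reflection \<alpha> k" and ?r = "reflection \<alpha> 0"
    have line: "?s (p + \<sigma> *\<^sub>R v) = p + \<sigma> *\<^sub>R ?r v" "?s (p - \<sigma> *\<^sub>R v) = p - \<sigma> *\<^sub>R ?r v" for \<sigma> v
      using reflection_line[OF k] reflection_line_diff[OF k] by auto
    have inner_r: "\<alpha> \<bullet> ?r v = - (\<alpha> \<bullet> v)" for v
      using inner_simple_reflection[OF e \<alpha>(1)] .
    have fs: "f \<circ> ?s \<in> At" using chart_reflection[OF f P_facts(1,2)] .
    \<comment> \<open>\<open>h1\<close> and \<open>\<eta>1\<close> describe the incoming germ as
      seen from the moved base alcove; finding them is what distinguishes the cases below.\<close>
    have IH: "chain p (u - p) \<eta>1 (?r \<eta>')"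
      if "h1 \<in> At" "agree u (f \<circ> ?s) h1" "norm \<eta>1 = norm \<eta>"
        "\<forall>\<^sub>F \<sigma> in at_right 0. h1 (p - \<sigma> *\<^sub>R \<eta>1) = h (p - \<sigma> *\<^sub>R \<eta>)" for h1 \<eta>1
    proof (rule less.hyps[OF card_negative_roots_decreases[OF e \<alpha>] that(1) fs that(2)])
      show "norm \<eta>1 = norm (?r \<eta>')" using that(3) nrm by (simp add: norm_reflection)
      show "opposite p h1 \<eta>1 (f \<circ> ?s) (?r \<eta>')"
        using opp that(3,4) by (rule opposite_germs) (simp add: line reflection_invol)
    qed
    have lower: "chain p (u - p) (lower \<alpha> v) \<eta>'" if "chain p (u - p) v (?r \<eta>')" for v
      using chain_lower[OF e \<alpha>(1) that] \<alpha>(2) by (simp add: lower_def[OF e \<alpha>(1)] inner_r reflection_invol)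
    show ?thesis
    proof (cases "\<alpha> \<bullet> \<eta> \<le> 0")
      \<comment> \<open>The incoming germ leaves \<open>p\<close> along \<open>- \<eta>\<close>, so
        here it lies on the side of the base alcove.\<close>
      case True
      obtain w where w: "regular w" "0 < \<alpha> \<bullet> (w - p)" "\<forall>\<^sub>F \<sigma> in at_right 0. p + \<sigma> *\<^sub>R (- \<eta>) \<in> cell w"
        using germ_in_cell_side[of \<alpha> "-\<eta>" p] True root_nonzero[OF P_facts(1)] by auto
      obtain \<kappa> where \<kappa>: "\<kappa> \<in> At" "agree (?s u) \<kappa> f" "agree w \<kappa> h"
        using chart_same_side[OF P f h fh w(1) wall_through[OF w(2) k]] by blast
      have "chain p (u - p) (?r \<eta>) (?r \<eta>')"
      proof (rule IH[of "\<kappa> \<circ> ?s"])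
        show "\<kappa> \<circ> ?s \<in> At" using chart_reflection[OF \<kappa>(1) P_facts(1,2)] .
        show "agree u (f \<circ> ?s) (\<kappa> \<circ> ?s)" using \<kappa>(2) agree_reflected[OF P] by metis
        show "norm (?r \<eta>) = norm \<eta>" by (rule norm_reflection)
        show "\<forall>\<^sub>F \<sigma> in at_right 0. (\<kappa> \<circ> ?s) (p - \<sigma> *\<^sub>R ?r \<eta>) = h (p - \<sigma> *\<^sub>R \<eta>)"
          using w(3) by eventually_elim (use \<kappa>(3) in \<open>simp add: line reflection_invol\<close>)
      qed
      from lower[OF this] show ?thesis
        using True reflection_fix[of \<alpha> \<eta> 0]
        by (auto simp: lower_def[OF e \<alpha>(1)] inner_r reflection_invol split: if_splits)
    next
      case False
      show ?thesis
      proof (cases "f ` cell (?s u) = h ` cell (?s u)")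
        \<comment> \<open>The moved base alcove still lies in the apartment of \<open>h\<close>, so
          the incoming direction is simply reflected.\<close>
        case True
        then have "agree (?s u) f h"
          using agree_on_alcove[OF f h u(1) fh, of "?s u"] by (metis image_mono subset_UNIV)
        then have "agree u (f \<circ> ?s) (h \<circ> ?s)" using agree_reflected[OF P] by blast
        then have "chain p (u - p) (?r \<eta>) (?r \<eta>')"
          by (rule IH[OF chart_reflection[OF h P_facts(1,2)]])
             (simp_all add: norm_reflection line reflection_invol)
        from lower[OF this] have "chain p (u - p) (?r \<eta>) \<eta>'"
          using False by (simp add: lower_def[OF e \<alpha>(1)] inner_r)
        with chain_simple_reflection[OF e \<alpha>(1)] False show ?thesis
          by (meson linear rtranclp_trans)
      next
        \<comment> \<open>The moved base alcove is not the one facing the incoming germ, so \<eta>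
          is unchanged and the simple reflection is appended to the chain.\<close>
        case ne: False
        obtain w where w: "regular w" "0 < (-\<alpha>) \<bullet> (w - p)" "\<forall>\<^sub>F \<sigma> in at_right 0. p + \<sigma> *\<^sub>R (- \<eta>) \<in> cell w"
          using germ_in_cell_side[of "-\<alpha>" "-\<eta>" p] False root_nonzero[OF P_facts(1)] by auto
        have "\<alpha> \<bullet> w + k < 0" using w(2) k by (simp add: inner_diff_right)
        then obtain g where g: "g \<in> At" "agree u g (f \<circ> ?s)" "agree w g h"
          using chart_across[OF P f h fh w(1) _ ne] by blast
        have "chain p (u - p) \<eta> (?r \<eta>')"
        proof (rule IH[OF g(1)])
          show "agree u (f \<circ> ?s) g" using g(2) by metis
          show "\<forall>\<^sub>F \<sigma> in at_right 0. g (p - \<sigma> *\<^sub>R \<eta>) = h (p - \<sigma> *\<^sub>R \<eta>)"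
            using w(3) by eventually_elim (use g(3) in simp)
        qed simp
        moreover have "chain p (u - p) (?r \<eta>') \<eta>'"
          using chain_simple_reflection[OF e \<alpha>(1), of "?r \<eta>'"] \<alpha>(2) by (simp add: inner_r reflection_invol)
        ultimately show ?thesis by (rule rtranclp_trans)
      qed
    qed
  qed
qed

end

context thick_building
begin

text \<open>Of three alcoves on the panel, at most two are the alcoves of \<open>h\<close> there.
  Another one shares an apartment with \<open>cell u\<close>, in which it must be the reflected
  alcove.\<close>

lemma exists_other_alcove:
  assumes P: "panel_point \<alpha> k u x" and h: "h \<in> At"
  shows "\<exists>f\<in>At. agree u f h \<and> f ` cell (reflection \<alpha> k u) \<noteq> h ` cell (reflection \<alpha> k u)"
proof -
  note P_facts = panel_point_facts[OF P]
  let ?su = "reflection \<alpha> k u"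
  define F where "F = cell u \<inter> {y. \<alpha> \<bullet> y = - k}"
  have "x \<in> F" using P_facts by (simp add: F_def)
  have "h ` F \<in> panels ty \<Phi> At"
    using panel_facet[OF P] h P_facts(3) unfolding panels_def closed_chambers_walls F_def by blast
  from thick[OF this] obtain a b c where abc: "a \<in> alcoves ty \<Phi> At" "b \<in> alcoves ty \<Phi> At" "c \<in> alcoves ty \<Phi> At"
      "a \<noteq> b" "a \<noteq> c" "b \<noteq> c" "h ` F \<subseteq> a" "h ` F \<subseteq> b" "h ` F \<subseteq> c"
    by (elim bexE conjE)
  have main: "d = h ` cell u \<or> (\<exists>f\<in>At. agree u f h \<and> d = f ` cell ?su)"
    if d: "d \<in> alcoves ty \<Phi> At" "h ` F \<subseteq> d" for d
  proof -
    obtain g w where g: "g \<in> At" "regular w" "d = g ` cell w" using d(1) alcoves_iff by blast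
    obtain f where f: "f \<in> At" "agree u f h" "d \<subseteq> range f"
      using exists_chart_extending[OF h P_facts(3) g(1,2)] g(3) by blast
    obtain w' where w': "regular w'" "d = f ` cell w'"
      using alcove_in_chart[OF g(1) f(1) g(2)] f(3) g(3) by blast
    have "f x \<in> f ` cell w'" using d(2) \<open>x \<in> F\<close> w'(2) f(2) P_facts(6) by auto
    then have "x \<in> cell w'" by (auto simp: chart_inj[OF f(1)])
    from panel_point_cells[OF P w'(1) this] have "cell w' = cell u \<or> cell w' = cell ?su" by presburger
    moreover have "f ` cell u = h ` cell u" using f(2) by (intro image_cong) auto
    ultimately show ?thesis using w'(2) f(1,2) by metis
  qed
  have "\<exists>d\<in>{a,b,c}. d \<noteq> h ` cell u \<and> d \<noteq> h ` cell ?su"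
    using abc(4-6) by (metis insertCI)
  then obtain d where d: "d \<in> {a,b,c}" "d \<noteq> h ` cell u" "d \<noteq> h ` cell ?su"
    by (elim bexE conjE)
  from d(1) consider "d = a" | "d = b" | "d = c" by blast
  then have "d \<in> alcoves ty \<Phi> At \<and> h ` F \<subseteq> d" using abc(1-3,7-9) by cases simp_all
  then have "\<exists>f\<in>At. agree u f h \<and> d = f ` cell ?su" using main[of d] d(2) by simp
  then obtain f where "f \<in> At" "agree u f h" "d = f ` cell ?su" by (elim bexE conjE)
  then show ?thesis using d(3) by (intro bexI[of _ f]) simp_all
qed

text \<open>By \<open>chain_upper\<close> a chain leads to the mirror image of
  \<open>\<eta>'\<close>, closer to the local chamber. The induction hypothesis for a moved base
  provides an outgoing germ, which is then transported back to the original base.\<close>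

lemma chain_imp_opposite:
  assumes u: "regular u" "p \<in> cell u"
  shows "\<lbrakk>h \<in> At; chain p (u - p) \<eta> \<eta>'\<rbrakk> \<Longrightarrow> \<exists>f\<in>At. agree u f h \<and> opposite p h \<eta> f \<eta>'"
proof (induction "card {b \<in> local_roots ty \<Phi> p. 0 < b \<bullet> (u - p) \<and> b \<bullet> \<eta>' < 0}"
    arbitrary: h \<eta> \<eta>' rule: less_induct)
  case less
  note h = less.prems(1) and ch = less.prems(2)
  have e: "local_regular p (u - p)" using local_regular_towards[OF u(1)] .
  show ?case
  proof (cases "\<exists>b\<in>local_roots ty \<Phi> p. 0 < b \<bullet> (u - p) \<and> b \<bullet> \<eta>' < 0")
    case False
    \<comment> \<open>A nonempty chain ends strictly beyond its last wall, so only the empty one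
      ends in the closed local chamber.\<close>
    have "\<eta> = \<eta>'"
      using ch
    proof (cases rule: rtranclp.cases)
      case (rtrancl_into_rtrancl \<eta>1)
      then obtain b where b: "b \<in> local_roots ty \<Phi> p" "0 < b \<bullet> (u - p)" "0 < b \<bullet> \<eta>1" "\<eta>' = reflection b 0 \<eta>1"
        by (auto simp: chain_step_def)
      then have "b \<bullet> \<eta>' < 0" using inner_reflection[OF local_root_nonzero[OF b(1)], of 0 \<eta>1] by simp
      then show ?thesis using False b by blast
    qed simp
    moreover have "opposite p h \<eta> h \<eta>"
      unfolding opposite_def chart_isometry[OF h]
      using eventually_pos
    proof eventually_elim
      case (elim s)
      have "(p - s *\<^sub>R \<eta>) - (p + s *\<^sub>R \<eta>) = (- 2 * s) *\<^sub>R \<eta>"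
        by (simp add: algebra_simps flip: scaleR_add_left)
      then show ?case using elim unfolding dist_norm by simp
    qed
    ultimately show ?thesis using h by blast
  next
    case True
    then obtain \<alpha> y where \<alpha>: "simple_root p (u - p) \<alpha> y" "\<alpha> \<bullet> \<eta>' < 0"
      using exists_simple_root[OF e] by blast
    obtain k x where k: "\<alpha> \<bullet> p + k = 0" and P: "panel_point \<alpha> k u x"
      using simple_root_panel_point[OF u \<alpha>(1)] by blast
    note P_facts = panel_point_facts[OF P]
    let ?s = "reflection \<alpha> k" and ?r = "reflection \<alpha> 0"
    have line: "?s (p + \<sigma> *\<^sub>R v) = p + \<sigma> *\<^sub>R ?r v" "?s (p - \<sigma> *\<^sub>R v) = p - \<sigma> *\<^sub>R ?r v" for \<sigma> v
      using reflection_line[OF k] reflection_line_diff[OF k] by auto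
    have inner_r: "\<alpha> \<bullet> ?r v = - (\<alpha> \<bullet> v)" for v
      using inner_simple_reflection[OF e \<alpha>(1)] .
    \<comment> \<open>The outgoing germ of \<open>f'\<close> is on the side of the moved base
      alcove, so \<open>chart_same_side\<close> joins it to the alcove \<open>cell u\<close> of
      \<open>g\<close>, the base before the move.\<close>
    have reflect_back: "\<exists>f\<in>At. agree u f g \<and> opposite p h \<eta> f \<eta>'"
      if g: "g \<in> At" and f': "f' \<in> At" "agree u f' (g \<circ> ?s)" "opposite p h1 \<eta>1 f' (?r \<eta>')"
        and h1: "norm \<eta> = norm \<eta>1" "\<forall>\<^sub>F \<sigma> in at_right 0. h (p - \<sigma> *\<^sub>R \<eta>) = h1 (p - \<sigma> *\<^sub>R \<eta>1)"
      for f' g h1 \<eta>1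
    proof -
      have gs: "g \<circ> ?s \<in> At" using chart_reflection[OF g P_facts(1,2)] .
      have "0 \<le> \<alpha> \<bullet> ?r \<eta>'" using \<alpha>(2) by (simp add: inner_r)
      then obtain w where w: "regular w" "0 < \<alpha> \<bullet> (w - p)" "\<forall>\<^sub>F \<sigma> in at_right 0. p + \<sigma> *\<^sub>R ?r \<eta>' \<in> cell w"
        using germ_in_cell_side[of \<alpha> "?r \<eta>'" p] root_nonzero[OF P_facts(1)] by auto
      have "agree u (g \<circ> ?s) f'" using f'(2) by metis
      then obtain \<kappa> where \<kappa>: "\<kappa> \<in> At" "agree (?s u) \<kappa> (g \<circ> ?s)" "agree w \<kappa> f'"
        using chart_same_side[OF P gs f'(1) _ w(1) wall_through[OF w(2) k]] by blast
      have "agree u (\<kappa> \<circ> ?s) g"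
        using \<kappa>(2) unfolding agree_reflected[OF P] by (simp add: reflection_invol)
      moreover have "opposite p h \<eta> (\<kappa> \<circ> ?s) \<eta>'"
      proof (rule opposite_germs[OF f'(3) h1])
        show "\<forall>\<^sub>F \<sigma> in at_right 0. (\<kappa> \<circ> ?s) (p + \<sigma> *\<^sub>R \<eta>') = f' (p + \<sigma> *\<^sub>R ?r \<eta>')"
          using w(3) by eventually_elim (use \<kappa>(3) in \<open>simp add: line\<close>)
      qed
      ultimately show ?thesis using chart_reflection[OF \<kappa>(1) P_facts(1,2)] by blast
    qed
    have upper: "chain p (u - p) (upper \<alpha> \<eta>) (?r \<eta>')"
      using chain_upper[OF e \<alpha>(1) ch] \<alpha>(2) by (simp add: upper_def[OF e \<alpha>(1)])
    show ?thesis
    proof (cases "\<alpha> \<bullet> \<eta> \<le> 0")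
      case True
      have hs: "h \<circ> ?s \<in> At" using chart_reflection[OF h P_facts(1,2)] .
      have "upper \<alpha> \<eta> = ?r \<eta>"
        using True reflection_fix[of \<alpha> \<eta> 0] by (auto simp: upper_def[OF e \<alpha>(1)])
      with upper have "chain p (u - p) (?r \<eta>) (?r \<eta>')" by simp
      from less.hyps[OF card_negative_roots_decreases[OF e \<alpha>] hs this]
      obtain f' where "f' \<in> At" "agree u f' (h \<circ> ?s)" "opposite p (h \<circ> ?s) (?r \<eta>) f' (?r \<eta>')" by blast
      from reflect_back[OF h this] show ?thesis by (simp add: norm_reflection line reflection_invol)
    next
      case False
      obtain f where f: "f \<in> At" "agree u f h" "f ` cell (?s u) \<noteq> h ` cell (?s u)"
        using exists_other_alcove[OF P h] by blast
      obtain w where w: "regular w" "0 < (-\<alpha>) \<bullet> (w - p)" "\<forall>\<^sub>F \<sigma> in at_right 0. p + \<sigma> *\<^sub>R (- \<eta>) \<in> cell w"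
        using germ_in_cell_side[of "-\<alpha>" "-\<eta>" p] False root_nonzero[OF P_facts(1)] by auto
      have "\<alpha> \<bullet> w + k < 0" using w(2) k by (simp add: inner_diff_right)
      then obtain g where g: "g \<in> At" "agree u g (f \<circ> ?s)" "agree w g h"
        using chart_across[OF P f(1) h f(2) w(1) _ f(3)] by blast
      have "chain p (u - p) \<eta> (?r \<eta>')" using upper False by (simp add: upper_def[OF e \<alpha>(1)])
      from less.hyps[OF card_negative_roots_decreases[OF e \<alpha>] g(1) this]
      obtain f' where f': "f' \<in> At" "agree u f' g" "opposite p g \<eta> f' (?r \<eta>')" by blast
      have "agree u f' (f \<circ> ?s)" using f'(2) g(2) by simp
      moreover have "\<forall>\<^sub>F \<sigma> in at_right 0. h (p - \<sigma> *\<^sub>R \<eta>) = g (p - \<sigma> *\<^sub>R \<eta>)"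
        using w(3) by eventually_elim (use g(3) in simp)
      ultimately obtain f'' where "f'' \<in> At" "agree u f'' f" "opposite p h \<eta> f'' \<eta>'"
        using reflect_back[OF f(1) f'(1) _ f'(3) refl] by blast
      then show ?thesis using f(2) by (metis (no_types, lifting))
    qed
  qed
qed

end

section \<open>Lifting the broken line\<close>

lemma (in root_datum) chain_scale:
  assumes "0 < \<epsilon>"
  shows "chain p (\<epsilon> *\<^sub>R e) = chain p e"
proof -
  have "chain_step p (\<epsilon> *\<^sub>R e) = chain_step p e"
    using assms by (auto simp: chain_step_def fun_eq_iff zero_less_mult_iff)
  then show ?thesis by simp
qed

section \<open>Germs of geodesics and their concatenation\<close>

context building
begin

text \<open>An apartment through two points of the geodesic contains the arc between them, and a
  germ of the arc lies in one alcove. In a chart through this alcove and the base alcove,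
  coordinates are the values of the retraction.\<close>

lemma geodesic_germ_in_chart:
  assumes g: "g \<in> At" and u: "regular u" and d: "0 < d"
    and geo: "\<And>s s'. s \<in> {0..d} \<Longrightarrow> s' \<in> {0..d} \<Longrightarrow> dist (\<delta> s) (\<delta> s') = c * \<bar>s - s'\<bar>"
    and ret: "\<And>s. s \<in> {0..d} \<Longrightarrow> retr u g (\<delta> s) = p + s *\<^sub>R \<eta>"
  shows "\<exists>f\<in>At. agree u f g \<and> \<delta> 0 = f p \<and> (\<forall>\<^sub>F s in at_right 0. \<delta> s = f (p + s *\<^sub>R \<eta>))"
proof -
  obtain E a b where E: "E \<in> At" "\<delta> 0 = E a" "\<delta> d = E b" by (rule two_points_in_chart)
  define v where "v = inverse d *\<^sub>R (b - a)"
  have ab: "dist a b = c * d" using geo[of 0 d] d E by (simp add: chart_isometry)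
  have lin: "\<delta> s = E (a + s *\<^sub>R v)" if s: "s \<in> {0..d}" for s
  proof -
    have "\<delta> s = E ((1 - s / d) *\<^sub>R a + (s / d) *\<^sub>R b)"
    proof (rule geodesic_in_chart[OF E(1)])
      show "dist (E a) (\<delta> s) \<le> s / d * dist a b"
        using geo[of 0 s] s d E(2) ab by (simp add: field_simps)
      show "dist (\<delta> s) (E b) \<le> (1 - s / d) * dist a b"
      proof -
        have "(1 - s / d) * (c * d) = c * (d - s)" using d by (simp add: field_simps)
        moreover have "dist (\<delta> s) (E b) = c * (d - s)" using geo[of s d] s d E(3) by simp
        ultimately show ?thesis unfolding ab by linarith
      qed
    qed
    also have "(1 - s / d) *\<^sub>R a + (s / d) *\<^sub>R b = a + s *\<^sub>R v"
      by (simp add: v_def algebra_simps divide_inverse)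
    finally show ?thesis .
  qed
  obtain w where w: "regular w" "a \<in> cell w" "\<forall>\<^sub>F s in at_right 0. a + s *\<^sub>R v \<in> cell w"
    using germ_in_cell by blast
  obtain f where f: "f \<in> At" "agree u f g" "E ` cell w \<subseteq> range f"
    using exists_chart_extending[OF g u E(1) w(1)] by blast
  have *: "\<delta> s = f (p + s *\<^sub>R \<eta>)" if s: "s \<in> {0..d}" "a + s *\<^sub>R v \<in> cell w" for s
  proof -
    obtain y where y: "\<delta> s = f y" using lin[OF s(1)] s(2) f(3) by auto
    then have "y = p + s *\<^sub>R \<eta>" using ret[OF s(1)] retr_chart[OF f(1) u f(2)] by simp
    with y show ?thesis by simp
  qed
  have "\<forall>\<^sub>F s in at_right 0. \<delta> s = f (p + s *\<^sub>R \<eta>)"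
    using w(3) eventually_pos eventually_less_right[OF d] by eventually_elim (use * in simp)
  moreover have "\<delta> 0 = f p" using *[of 0] w(2) d by simp
  ultimately show ?thesis using f(1,2) by blast
qed

text \<open>The point that names the projected alcove lies on the segment from \<open>p\<close> to
  \<open>u\<close>, and apartments are convex.\<close>

lemma agree_towards:
  assumes f: "f \<in> At" and g: "g \<in> At" and u: "regular u" and fg: "agree u f g" and p: "f p = g p"
    and \<epsilon>: "0 < \<epsilon>" "\<epsilon> < 1" "regular (p + \<epsilon> *\<^sub>R (u - p))"
  shows "agree (p + \<epsilon> *\<^sub>R (u - p)) f g"
proof -
  have "f u = g u" using fg mem_cell_self by blast
  then have "f ((1 - \<epsilon>) *\<^sub>R p + \<epsilon> *\<^sub>R u) \<in> range g"
    using p \<epsilon> by (intro chart_range_convex[OF f g]) auto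
  moreover have "(1 - \<epsilon>) *\<^sub>R p + \<epsilon> *\<^sub>R u = p + \<epsilon> *\<^sub>R (u - p)" by (simp add: algebra_simps)
  ultimately have "f (p + \<epsilon> *\<^sub>R (u - p)) \<in> range g" by simp
  from alcove_subset_range[OF f g \<epsilon>(3) this]
  have sub: "f ` cell (p + \<epsilon> *\<^sub>R (u - p)) \<subseteq> range g" .
  have "agree u g f" using fg by simp
  from agree_on_alcove[OF g f u this sub] show ?thesis by simp
qed

lemma opposite_germs_imp_chain:
  assumes f: "f \<in> At" and h: "h \<in> At" and u: "regular u" and fh: "agree u f h" and p: "f p = h p"
    and nrm: "norm \<eta> = norm \<eta>'" and opp: "opposite p h \<eta> f \<eta>'"
  shows "chain p (u - p) \<eta> \<eta>'"
proof -
  obtain \<epsilon> where \<epsilon>: "0 < \<epsilon>" "\<epsilon> < 1" "regular (p + \<epsilon> *\<^sub>R (u - p))" "p \<in> cell (p + \<epsilon> *\<^sub>R (u - p))"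
    using exists_cell_towards[OF u] by blast
  have "chain p ((p + \<epsilon> *\<^sub>R (u - p)) - p) \<eta> \<eta>'"
    using opposite_imp_chain[OF \<epsilon>(3,4) h f agree_towards[OF f h u fh p \<epsilon>(1-3)] nrm opp] .
  then show ?thesis using chain_scale[OF \<epsilon>(1)] by simp
qed

text \<open>Contracting both arcs towards their common point by the factor \<mu> multiplies the
  distance of their ends by at most \<mu>, while close to that point the distance is known
  exactly.\<close>

lemma concat_geodesics:
  fixes \<gamma> \<delta> :: "real \<Rightarrow> 'i"
  assumes c: "0 \<le> c" and match: "\<gamma> \<tau> = \<delta> \<tau>"
    and \<gamma>: "\<And>s s'. s \<in> {a..\<tau>} \<Longrightarrow> s' \<in> {a..\<tau>} \<Longrightarrow> dist (\<gamma> s) (\<gamma> s') = c * \<bar>s - s'\<bar>"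
    and \<delta>: "\<And>s s'. s \<in> {\<tau>..b} \<Longrightarrow> s' \<in> {\<tau>..b} \<Longrightarrow> dist (\<delta> s) (\<delta> s') = c * \<bar>s - s'\<bar>"
    and loc: "\<forall>\<^sub>F s in at_right 0. dist (\<gamma> (\<tau> - s)) (\<delta> (\<tau> + s)) = 2 * s * c"
    and s: "s \<in> {a..\<tau>}" "s' \<in> {\<tau>..b}"
  shows "dist (\<gamma> s) (\<delta> s') = c * (s' - s)"
proof (cases "s = \<tau> \<or> s' = \<tau>")
  case True
  then show ?thesis
  proof
    assume "s = \<tau>"
    then show ?thesis using match \<delta>[of \<tau> s'] s by simp
  next
    assume "s' = \<tau>"
    then show ?thesis using match[symmetric] \<gamma>[of s \<tau>] s by simp
  qed
next
  case False
  define \<sigma>1 \<sigma>2 M where "\<sigma>1 = \<tau> - s" and "\<sigma>2 = s' - \<tau>" and "M = max \<sigma>1 \<sigma>2"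
  have pos: "0 < \<sigma>1" "0 < \<sigma>2" "0 < M" using s False by (auto simp: \<sigma>1_def \<sigma>2_def M_def)
  have "\<forall>\<^sub>F \<sigma> in at_right (0::real). 0 < \<sigma> \<and> \<sigma> < \<sigma>1 \<and> \<sigma> < \<sigma>2 \<and> dist (\<gamma> (\<tau> - \<sigma>)) (\<delta> (\<tau> + \<sigma>)) = 2 * \<sigma> * c"
    using loc eventually_pos eventually_less_right[OF pos(1)] eventually_less_right[OF pos(2)]
    by eventually_elim simp
  then obtain \<sigma> where \<sigma>: "0 < \<sigma>" "\<sigma> < \<sigma>1" "\<sigma> < \<sigma>2" "dist (\<gamma> (\<tau> - \<sigma>)) (\<delta> (\<tau> + \<sigma>)) = 2 * \<sigma> * c"
    using eventually_happens'[OF trivial_limit_at_right_real] by blast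
  \<comment> \<open>Dividing by the longer arc brings both contracted points within \<sigma> of
    \<tau>.\<close>
  define \<mu> where "\<mu> = \<sigma> / M"
  have "\<sigma> < M" using \<sigma>(2) by (simp add: M_def)
  then have \<mu>: "0 < \<mu>" "\<mu> \<le> 1" using \<sigma>(1) pos(3) by (auto simp: \<mu>_def)
  have "\<mu> * M = \<sigma>" using pos(3) by (simp add: \<mu>_def)
  moreover have "\<mu> * \<sigma>1 \<le> \<mu> * M" "\<mu> * \<sigma>2 \<le> \<mu> * M"
    using \<mu>(1) by (auto simp: M_def)
  ultimately have le: "\<mu> * \<sigma>1 \<le> \<sigma>" "\<mu> * \<sigma>2 \<le> \<sigma>" by auto
  have nn: "0 \<le> \<mu> * \<sigma>1" "0 \<le> \<mu> * \<sigma>2" using \<mu> pos by auto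
  define q' r' where "q' = \<gamma> (\<tau> - \<mu> * \<sigma>1)" and "r' = \<delta> (\<tau> + \<mu> * \<sigma>2)"
  have in1: "\<tau> - \<mu> * \<sigma>1 \<in> {a..\<tau>}" "\<tau> - \<sigma> \<in> {a..\<tau>}" "s \<in> {a..\<tau>}" "\<tau> \<in> {a..\<tau>}"
    using le nn \<sigma> s by (auto simp: \<sigma>1_def)
  have in2: "\<tau> + \<mu> * \<sigma>2 \<in> {\<tau>..b}" "\<tau> + \<sigma> \<in> {\<tau>..b}" "s' \<in> {\<tau>..b}" "\<tau> \<in> {\<tau>..b}"
    using le nn \<sigma> s by (auto simp: \<sigma>2_def)
  have "dist q' r' \<le> \<mu> * dist (\<gamma> s) (\<delta> s')"
  proof (rule geodesics_spread[of "\<gamma> \<tau>"])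
    show "dist (\<gamma> \<tau>) q' \<le> \<mu> * dist (\<gamma> \<tau>) (\<gamma> s)"
      using \<gamma>[OF in1(4,1)] \<gamma>[OF in1(4,3)] nn pos by (simp add: q'_def \<sigma>1_def)
    show "dist q' (\<gamma> s) \<le> (1 - \<mu>) * dist (\<gamma> \<tau>) (\<gamma> s)"
    proof -
      have "\<tau> - \<mu> * \<sigma>1 - s = (1 - \<mu>) * \<sigma>1" by (simp add: \<sigma>1_def algebra_simps)
      then have "dist q' (\<gamma> s) = c * ((1 - \<mu>) * \<sigma>1)"
        using \<gamma>[OF in1(1,3)] \<mu> pos by (simp add: q'_def abs_mult)
      then show ?thesis using \<gamma>[OF in1(4,3)] pos by (simp add: \<sigma>1_def)
    qed
    show "dist (\<gamma> \<tau>) r' \<le> \<mu> * dist (\<gamma> \<tau>) (\<delta> s')"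
      using \<delta>[OF in2(4,1)] \<delta>[OF in2(4,3)] nn pos by (simp add: r'_def \<sigma>2_def match)
    show "dist r' (\<delta> s') \<le> (1 - \<mu>) * dist (\<gamma> \<tau>) (\<delta> s')"
    proof -
      have "s' - (\<tau> + \<mu> * \<sigma>2) = (1 - \<mu>) * \<sigma>2" by (simp add: \<sigma>2_def algebra_simps)
      then have "dist r' (\<delta> s') = c * ((1 - \<mu>) * \<sigma>2)"
        using \<delta>[OF in2(3,1)] \<mu> pos by (simp add: r'_def abs_mult dist_commute)
      then show ?thesis using \<delta>[OF in2(4,3)] pos by (simp add: \<sigma>2_def match)
    qed
  qed (use \<mu> in auto)
  \<comment> \<open>The points at parameters \<open>\<tau> - \<sigma>\<close> and
    \<open>\<tau> + \<sigma>\<close> have a known distance; the path between them through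
    \<open>q'\<close> and \<open>r'\<close> bounds \<open>dist q' r'\<close> from below.\<close>
  moreover have "\<mu> * (c * (s' - s)) \<le> dist q' r'"
  proof -
    have "dist (\<gamma> (\<tau> - \<sigma>)) q' = c * (\<sigma> - \<mu> * \<sigma>1)" "dist r' (\<delta> (\<tau> + \<sigma>)) = c * (\<sigma> - \<mu> * \<sigma>2)"
      using \<gamma>[OF in1(2,1)] \<delta>[OF in2(1,2)] le by (simp_all add: q'_def r'_def)
    moreover have "dist (\<gamma> (\<tau> - \<sigma>)) (\<delta> (\<tau> + \<sigma>)) \<le> dist (\<gamma> (\<tau> - \<sigma>)) q' + dist q' r' + dist r' (\<delta> (\<tau> + \<sigma>))"
      using dist_triangle[of "\<gamma> (\<tau> - \<sigma>)" "\<delta> (\<tau> + \<sigma>)" q'] dist_triangle[of q' "\<delta> (\<tau> + \<sigma>)" r'] by linarith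
    ultimately have "2 * \<sigma> * c \<le> c * (\<sigma> - \<mu> * \<sigma>1) + dist q' r' + c * (\<sigma> - \<mu> * \<sigma>2)" using \<sigma>(4) by simp
    then show ?thesis by (simp add: \<sigma>1_def \<sigma>2_def algebra_simps)
  qed
  ultimately have "\<mu> * (c * (s' - s)) \<le> \<mu> * dist (\<gamma> s) (\<delta> s')" by linarith
  then have "c * (s' - s) \<le> dist (\<gamma> s) (\<delta> s')" using \<mu>(1) by simp
  moreover have "dist (\<gamma> s) (\<delta> s') \<le> dist (\<gamma> s) (\<gamma> \<tau>) + dist (\<delta> \<tau>) (\<delta> s')"
    using dist_triangle[of "\<gamma> s" "\<delta> s'" "\<gamma> \<tau>"] match by simp
  moreover have "dist (\<gamma> s) (\<gamma> \<tau>) + dist (\<delta> \<tau>) (\<delta> s') = c * (s' - s)"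
    using \<gamma>[OF in1(3,4)] \<delta>[OF in2(4,3)] s by (simp add: algebra_simps)
  ultimately show ?thesis by linarith
qed

text \<open>An isomorphism that fixes the alcove preserves distances to its points, so its value at
  \<open>q\<close> is the same for every apartment. Existence comes from the inverse of a chart that
  agrees with \<open>f\<close> on the alcove.\<close>

lemma retraction_at_eq:
  assumes f: "f \<in> At" and u: "regular u"
  shows "retraction_at At (range f) (f ` cell u) q = f (retr u f q)"
  unfolding retraction_at_def
proof (rule the_equality)
  obtain E where E: "E \<in> At" "agree u E f" "q \<in> range E"
    using exists_chart_extending_point[OF f u] by blast
  then obtain v where v: "q = E v" by blast
  let ?\<phi> = "f \<circ> inv E"
  have "inj E" using chart_inj[OF E(1)] by (auto intro!: injI)
  then have inv: "inv E (E y) = y" for y by simp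
  then have comp: "?\<phi> \<circ> E = f" by (simp add: fun_eq_iff)
  have fE: "f y = E y" if "y \<in> cell u" for y using E(2) that by simp
  show "\<exists>B \<phi>. B \<in> apartments At \<and> f ` cell u \<subseteq> B \<and> q \<in> B \<and>
      apartment_iso At B (range f) \<phi> \<and> (\<forall>p\<in>f ` cell u. \<phi> p = p) \<and> f (retr u f q) = \<phi> q"
  proof (intro exI conjI)
    show "range E \<in> apartments At" using E(1) by (auto simp: apartments_def)
    show "f ` cell u \<subseteq> range E" using fE by auto
    show "q \<in> range E" by (fact E(3))
    show "apartment_iso At (range E) (range f) ?\<phi>"
      unfolding apartment_iso_def using E(1) f comp by (intro bexI[of _ E]) auto
    show "\<forall>p\<in>f ` cell u. ?\<phi> p = p" using fE inv by simp
    show "f (retr u f q) = ?\<phi> q" using retr_chart[OF E(1) u E(2)] v inv by simp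
  qed
next
  fix r
  assume "\<exists>B \<phi>. B \<in> apartments At \<and> f ` cell u \<subseteq> B \<and> q \<in> B \<and>
      apartment_iso At B (range f) \<phi> \<and> (\<forall>p\<in>f ` cell u. \<phi> p = p) \<and> r = \<phi> q"
  then obtain B \<phi> where B: "f ` cell u \<subseteq> B" "q \<in> B" "apartment_iso At B (range f) \<phi>"
      "\<forall>p\<in>f ` cell u. \<phi> p = p" "r = \<phi> q" by blast
  obtain f0 where f0: "f0 \<in> At" "range f0 = B" "\<phi> \<circ> f0 \<in> At" "range (\<phi> \<circ> f0) = range f"
    using B(3) by (auto simp: apartment_iso_def)
  have iso: "dist (\<phi> a) (\<phi> b) = dist a b" if ab: "a \<in> B" "b \<in> B" for a b
  proof -
    obtain a' b' where "a = f0 a'" "b = f0 b'" using ab f0(2) by blast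
    then show ?thesis using chart_isometry[OF f0(1)] chart_isometry[OF f0(3)] by simp
  qed
  have "\<phi> q \<in> range f" using B(2) f0(2,4) by auto
  then obtain v where v: "\<phi> q = f v" by blast
  have "retr u f q = v"
  proof (rule retr_eq[OF u])
    fix y assume y: "y \<in> cell u"
    then have "dist q (f y) = dist (\<phi> q) (\<phi> (f y))" using iso B(1,2) by (metis image_subset_iff)
    also have "\<dots> = dist (f v) (f y)" using B(4) y v by simp
    finally show "dist q (f y) = dist v y" by (simp add: chart_isometry[OF f])
  qed
  then show "r = f (retr u f q)" using B(5) v by simp
qed

lemma straight_geodesic:
  assumes "E \<in> At"
  shows "geodesic_path (\<lambda>s. E (a + s *\<^sub>R (b - a))) (E a) (E b)"
proof -
  have "dist (a + s *\<^sub>R (b - a)) (a + s' *\<^sub>R (b - a)) = dist a b * \<bar>s - s'\<bar>" for s s'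
    by (simp add: dist_norm norm_minus_commute flip: scaleR_diff_left)
  then show ?thesis unfolding geodesic_path_def chart_isometry[OF assms] by simp
qed

end

text \<open>The outgoing germ is built over the projected alcove at \<open>p\<close>; a chart
  through this germ that agrees with \<open>h\<close> on \<open>cell u\<close> still sees it in the
  same coordinates.\<close>

lemma (in thick_building) chain_imp_opposite_germs:
  assumes h: "h \<in> At" and u: "regular u" and ch: "chain p (u - p) \<eta> \<eta>'"
  shows "\<exists>f\<in>At. agree u f h \<and> f p = h p \<and> opposite p h \<eta> f \<eta>'"
proof -
  obtain \<epsilon> where \<epsilon>: "0 < \<epsilon>" "\<epsilon> < 1" "regular (p + \<epsilon> *\<^sub>R (u - p))" "p \<in> cell (p + \<epsilon> *\<^sub>R (u - p))"
    using exists_cell_towards[OF u] by blast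
  let ?u = "p + \<epsilon> *\<^sub>R (u - p)"
  have "chain p (?u - p) \<eta> \<eta>'" using ch chain_scale[OF \<epsilon>(1)] by simp
  from chain_imp_opposite[OF \<epsilon>(3,4) h this]
  obtain g where g: "g \<in> At" "agree ?u g h" "opposite p h \<eta> g \<eta>'" by blast
  obtain w where w: "regular w" "p \<in> cell w" "\<forall>\<^sub>F s in at_right 0. p + s *\<^sub>R \<eta>' \<in> cell w"
    using germ_in_cell by blast
  obtain f where f: "f \<in> At" "agree u f h" "g ` cell w \<subseteq> range f"
    using exists_chart_extending[OF h u g(1) w(1)] by blast
  have "h p = g p" using g(2) \<epsilon>(4) by simp
  then have hp: "h p \<in> range f" using f(3) w(2) by auto
  have "agree u h f" using f(2) by simp
  from agree_on_common[OF h f(1) u this hp] have p: "f p = h p" by simp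
  have "agree ?u f g" using agree_towards[OF f(1) h u f(2) p \<epsilon>(1-3)] g(2) by simp
  from agree_on_alcove[OF f(1) g(1) \<epsilon>(3) this f(3)] have fg: "agree w f g" .
  from w(3) have "\<forall>\<^sub>F s in at_right 0. f (p + s *\<^sub>R \<eta>') = g (p + s *\<^sub>R \<eta>')"
    by eventually_elim (use fg in simp)
  then have "opposite p h \<eta> f \<eta>'" by (intro opposite_germs[OF g(3) refl]) simp_all
  with f(1,2) p show ?thesis by blast
qed

lemma interval_partition_mono:
  fixes t :: "nat \<Rightarrow> real"
  assumes "\<And>i. i \<le> n \<Longrightarrow> t i < t (Suc i)" "i \<le> j" "j \<le> Suc n"
  shows "t i \<le> t j"
  using assms(2,3)
proof (induction j rule: dec_induct)
  case (step m)
  then show ?case using assms(1)[of m] by simp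
qed simp

section \<open>Geodesic lifts of a piecewise linear path\<close>

context thick_building
begin

context
  fixes f u and P :: "real \<Rightarrow> 'a" and V and n :: nat and t :: "nat \<Rightarrow> real" and c :: real
  assumes f: "f \<in> At" and u: "regular u"
    and t0: "t 0 = 0" and t1: "t (Suc n) = 1" and t_less: "\<And>i. i \<le> n \<Longrightarrow> t i < t (Suc i)"
    and P: "\<And>i s. i \<le> n \<Longrightarrow> s \<in> {t i..t (Suc i)} \<Longrightarrow> P s = P (t i) + (s - t i) *\<^sub>R V i"
    and V: "\<And>i. i \<le> n \<Longrightarrow> norm (V i) = c"
begin

lemma t_in: "i \<le> Suc n \<Longrightarrow> 0 \<le> t i \<and> t i \<le> 1"
  using interval_partition_mono[of n t 0 i] interval_partition_mono[of n t i "Suc n"] t_less t0 t1 by simp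

lemma P_after:
  assumes "i \<le> n" "s \<in> {0..t (Suc i) - t i}"
  shows "P (t i + s) = P (t i) + s *\<^sub>R V i"
  using P[OF assms(1), of "t i + s"] assms(2) by simp

lemma P_before:
  assumes "i \<le> n" "s \<in> {0..t (Suc i) - t i}"
  shows "P (t (Suc i) - s) = P (t (Suc i)) + s *\<^sub>R (- V i)"
proof -
  have "P (t (Suc i) - s) = P (t i) + (t (Suc i) - s - t i) *\<^sub>R V i"
    using P[OF assms(1), of "t (Suc i) - s"] assms(2) by simp
  moreover have "P (t (Suc i)) = P (t i) + (t (Suc i) - t i) *\<^sub>R V i"
    using P[OF assms(1), of "t (Suc i)"] t_less[OF assms(1)] by simp
  ultimately show ?thesis by (simp add: scaleR_diff_left)
qed

lemma geodesic_lift_imp_chain: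
  assumes geo: "\<And>s s'. s \<in> {0..1} \<Longrightarrow> s' \<in> {0..1} \<Longrightarrow> dist (\<gamma> s) (\<gamma> s') = L * \<bar>s - s'\<bar>"
    and ret: "\<And>s. s \<in> {0..1} \<Longrightarrow> retr u f (\<gamma> s) = P s"
    and i: "i < n"
  shows "chain (P (t (Suc i))) (u - P (t (Suc i))) (V i) (V (Suc i))"
proof -
  define \<tau> p where "\<tau> = t (Suc i)" and "p = P \<tau>"
  have bnd: "0 \<le> t i" "t (Suc (Suc i)) \<le> 1" "t i < \<tau>" "\<tau> < t (Suc (Suc i))"
    using t_in[of i] t_in[of "Suc (Suc i)"] t_less[of i] t_less[of "Suc i"] i by (auto simp: \<tau>_def)
  have "\<exists>g\<in>At. agree u g f \<and> \<gamma> (\<tau> + 0) = g p \<and> (\<forall>\<^sub>F s in at_right 0. \<gamma> (\<tau> + s) = g (p + s *\<^sub>R V (Suc i)))"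
  proof (rule geodesic_germ_in_chart[OF f u, where c = L])
    show "0 < t (Suc (Suc i)) - \<tau>" using bnd by simp
    show "dist (\<gamma> (\<tau> + s)) (\<gamma> (\<tau> + s')) = L * \<bar>s - s'\<bar>"
      if "s \<in> {0..t (Suc (Suc i)) - \<tau>}" "s' \<in> {0..t (Suc (Suc i)) - \<tau>}" for s s'
      using geo[of "\<tau> + s" "\<tau> + s'"] that bnd by simp
    show "retr u f (\<gamma> (\<tau> + s)) = p + s *\<^sub>R V (Suc i)" if "s \<in> {0..t (Suc (Suc i)) - \<tau>}" for s
      using ret[of "\<tau> + s"] that bnd P_after[of "Suc i" s] i by (simp add: \<tau>_def p_def)
  qed
  then obtain g where g: "g \<in> At" "agree u g f" "\<gamma> \<tau> = g p"
      "\<forall>\<^sub>F s in at_right 0. \<gamma> (\<tau> + s) = g (p + s *\<^sub>R V (Suc i))" by auto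
  have "\<exists>h\<in>At. agree u h f \<and> \<gamma> (\<tau> - 0) = h p \<and> (\<forall>\<^sub>F s in at_right 0. \<gamma> (\<tau> - s) = h (p + s *\<^sub>R (- V i)))"
  proof (rule geodesic_germ_in_chart[OF f u, where c = L])
    show "0 < \<tau> - t i" using bnd by simp
    show "dist (\<gamma> (\<tau> - s)) (\<gamma> (\<tau> - s')) = L * \<bar>s - s'\<bar>"
      if "s \<in> {0..\<tau> - t i}" "s' \<in> {0..\<tau> - t i}" for s s'
      using geo[of "\<tau> - s" "\<tau> - s'"] that bnd by (simp add: abs_minus_commute)
    show "retr u f (\<gamma> (\<tau> - s)) = p + s *\<^sub>R (- V i)" if "s \<in> {0..\<tau> - t i}" for s
      using ret[of "\<tau> - s"] that bnd P_before[of i s] i by (simp add: \<tau>_def p_def)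
  qed
  then obtain h where h: "h \<in> At" "agree u h f" "\<gamma> \<tau> = h p"
      "\<forall>\<^sub>F s in at_right 0. \<gamma> (\<tau> - s) = h (p + s *\<^sub>R (- V i))" by auto
  have small: "\<forall>\<^sub>F s in at_right 0. 0 < s \<and> \<tau> - s \<in> {0..1} \<and> \<tau> + s \<in> {0..1}"
  proof -
    have pos: "0 < \<tau>" "0 < 1 - \<tau>" using bnd by auto
    show ?thesis
      using eventually_pos eventually_less_right[OF pos(1)] eventually_less_right[OF pos(2)]
      by eventually_elim simp
  qed
  have "\<forall>\<^sub>F s in at_right 0. L * s = c * s \<and> 0 < s"
    using small g(4)
  proof eventually_elim
    case (elim s)
    have "dist (\<gamma> \<tau>) (\<gamma> (\<tau> + s)) = L * s" using geo[of \<tau> "\<tau> + s"] elim(1) bnd by simp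
    moreover have "dist (\<gamma> \<tau>) (\<gamma> (\<tau> + s)) = c * s"
      unfolding elim(2) g(3) chart_isometry[OF g(1)] using V[of "Suc i"] i elim(1) by (simp add: dist_norm)
    ultimately show ?case using elim(1) by simp
  qed
  then obtain s :: real where "L * s = c * s" "0 < s"
    using eventually_happens'[OF trivial_limit_at_right_real] by blast
  \<comment> \<open>Near the break the lift lies in the apartment of \<open>g\<close>, so its speed
    is that of the path.\<close>
  then have L: "L = c" by simp
  have "opposite p h (V i) g (V (Suc i))"
    unfolding opposite_def using small g(4) h(4)
  proof eventually_elim
    case (elim s)
    have "dist (\<gamma> (\<tau> - s)) (\<gamma> (\<tau> + s)) = c * (2 * s)" using geo[of "\<tau> - s" "\<tau> + s"] elim(1) by (simp add: L)
    then show ?case using elim(2,3) V[of i] i by simp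
  qed
  moreover have "agree u g h" using g(2) h(2) by simp
  moreover have "norm (V i) = norm (V (Suc i))" using V i by simp
  ultimately have "chain p (u - p) (V i) (V (Suc i))"
    using opposite_germs_imp_chain[OF g(1) h(1) u] g(3) h(3) by metis
  then show ?thesis by (simp add: p_def \<tau>_def)
qed

text \<open>The chain at a break provides a chart in which the next piece can be drawn with its germ
  opposite to the end of the geodesic built so far; \<open>concat_geodesics\<close> does the
  rest.\<close>

lemma chain_imp_geodesic_lift:
  assumes ch: "\<And>i. i < n \<Longrightarrow> chain (P (t (Suc i))) (u - P (t (Suc i))) (V i) (V (Suc i))"
  shows "i \<le> n \<Longrightarrow> \<exists>\<gamma>. \<gamma> 0 = f (P 0) \<and>
    (\<forall>s\<in>{0..t (Suc i)}. \<forall>s'\<in>{0..t (Suc i)}. dist (\<gamma> s) (\<gamma> s') = c * \<bar>s - s'\<bar>) \<and>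
    (\<forall>s\<in>{0..t (Suc i)}. retr u f (\<gamma> s) = P s)"
proof (induction i)
  case 0
  have "dist (f (P s)) (f (P s')) = c * \<bar>s - s'\<bar>" if "s \<in> {0..t (Suc 0)}" "s' \<in> {0..t (Suc 0)}" for s s'
    using P[of 0 s] P[of 0 s'] V[of 0] that unfolding chart_isometry[OF f]
    by (simp add: t0 dist_norm flip: scaleR_diff_left)
  then show ?case using retr_chart[OF f u] by (intro exI[of _ "f \<circ> P"]) simp
next
  case (Suc i)
  define \<tau> b p where "\<tau> = t (Suc i)" and "b = t (Suc (Suc i))" and "p = P \<tau>"
  have bnd: "0 \<le> t i" "t i < \<tau>" "\<tau> < b"
    using t_in[of i] t_less[of i] t_less[of "Suc i"] Suc.prems by (auto simp: \<tau>_def b_def)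
  have c: "0 \<le> c" using V[of 0] norm_ge_zero by (metis le0)
  obtain \<gamma> where \<gamma>: "\<gamma> 0 = f (P 0)"
    "\<And>s s'. s \<in> {0..\<tau>} \<Longrightarrow> s' \<in> {0..\<tau>} \<Longrightarrow> dist (\<gamma> s) (\<gamma> s') = c * \<bar>s - s'\<bar>"
    "\<And>s. s \<in> {0..\<tau>} \<Longrightarrow> retr u f (\<gamma> s) = P s"
    using Suc unfolding \<tau>_def by (metis Suc_leD)
  have "\<exists>h\<in>At. agree u h f \<and> \<gamma> (\<tau> - 0) = h p \<and> (\<forall>\<^sub>F s in at_right 0. \<gamma> (\<tau> - s) = h (p + s *\<^sub>R (- V i)))"
  proof (rule geodesic_germ_in_chart[OF f u, where c = c])
    show "0 < \<tau> - t i" using bnd by simp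
    show "dist (\<gamma> (\<tau> - s)) (\<gamma> (\<tau> - s')) = c * \<bar>s - s'\<bar>"
      if "s \<in> {0..\<tau> - t i}" "s' \<in> {0..\<tau> - t i}" for s s'
      using \<gamma>(2)[of "\<tau> - s" "\<tau> - s'"] that bnd by (simp add: abs_minus_commute)
    show "retr u f (\<gamma> (\<tau> - s)) = p + s *\<^sub>R (- V i)" if "s \<in> {0..\<tau> - t i}" for s
      using \<gamma>(3)[of "\<tau> - s"] that bnd P_before[of i s] Suc.prems by (simp add: \<tau>_def p_def)
  qed
  then obtain h where h: "h \<in> At" "agree u h f" "\<gamma> \<tau> = h p"
      "\<forall>\<^sub>F s in at_right 0. \<gamma> (\<tau> - s) = h (p + s *\<^sub>R (- V i))" by auto
  have "chain p (u - p) (V i) (V (Suc i))" using ch[of i] Suc.prems by (simp add: p_def \<tau>_def)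
  from chain_imp_opposite_germs[OF h(1) u this]
  obtain g where g: "g \<in> At" "agree u g h" "g p = h p" "opposite p h (V i) g (V (Suc i))" by blast
  define \<delta> where "\<delta> = g \<circ> P"
  have P\<delta>: "P s = p + (s - \<tau>) *\<^sub>R V (Suc i)" if "s \<in> {\<tau>..b}" for s
    using P[of "Suc i" s] that Suc.prems by (simp add: p_def \<tau>_def b_def)
  have \<delta>: "dist (\<delta> s) (\<delta> s') = c * \<bar>s - s'\<bar>" if "s \<in> {\<tau>..b}" "s' \<in> {\<tau>..b}" for s s'
    using P\<delta>[OF that(1)] P\<delta>[OF that(2)] V[of "Suc i"] Suc.prems unfolding \<delta>_def o_def chart_isometry[OF g(1)]
    by (simp add: dist_norm flip: scaleR_diff_left)
  have match: "\<gamma> \<tau> = \<delta> \<tau>" using h(3) g(3) by (simp add: \<delta>_def p_def)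
  have loc: "\<forall>\<^sub>F s in at_right 0. dist (\<gamma> (\<tau> - s)) (\<delta> (\<tau> + s)) = 2 * s * c"
  proof -
    have "0 < b - \<tau>" using bnd by simp
    from h(4) g(4)[unfolded opposite_def] eventually_pos eventually_less_right[OF this] show ?thesis
    proof eventually_elim
      case (elim s)
      then show ?case using P\<delta>[of "\<tau> + s"] V[of i] Suc.prems by (simp add: \<delta>_def)
    qed
  qed
  have cross: "dist (\<gamma> s) (\<delta> s') = c * (s' - s)" if "s \<in> {0..\<tau>}" "s' \<in> {\<tau>..b}" for s s'
    using concat_geodesics[OF c match \<gamma>(2) \<delta> loc that] .
  define \<gamma>' where "\<gamma>' s = (if s \<le> \<tau> then \<gamma> s else \<delta> s)" for s
  have gf: "agree u g f" using g(2) h(2) by simp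
  have "\<gamma>' 0 = f (P 0)" using \<gamma>(1) bnd by (simp add: \<gamma>'_def)
  moreover have "dist (\<gamma>' s) (\<gamma>' s') = c * \<bar>s - s'\<bar>" if "s \<in> {0..b}" "s' \<in> {0..b}" for s s'
    using that \<gamma>(2)[of s s'] \<delta>[of s s'] cross[of s s'] cross[of s' s]
    by (cases "s \<le> \<tau>"; cases "s' \<le> \<tau>") (auto simp: \<gamma>'_def dist_commute)
  moreover have "retr u f (\<gamma>' s) = P s" if "s \<in> {0..b}" for s
    using that \<gamma>(3)[of s] retr_chart[OF g(1) u gf] by (simp add: \<gamma>'_def \<delta>_def)
  ultimately show ?case unfolding b_def by blast
qed

text \<open>Only the side over \<pi> carries a condition. The side from \<open>z\<close> to
  \<open>\<pi> 0\<close> is drawn in the base apartment, the side from \<open>\<gamma> 1\<close> to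
  \<open>z\<close> in an apartment through the base alcove and \<open>\<gamma> 1\<close>, on which
  the retraction is isometric.\<close>

lemma image_of_geodesic_triangle_iff_chain:
  assumes z: "z \<in> f ` cell u" and \<pi>: "\<And>s. s \<in> {0..1} \<Longrightarrow> \<pi> s = f (P s)"
  shows "image_of_geodesic_triangle (retraction_at At (range f) (f ` cell u)) z (\<pi> 0) (\<pi> 1) \<pi> \<longleftrightarrow>
    (\<forall>i<n. chain (P (t (Suc i))) (u - P (t (Suc i))) (V i) (V (Suc i)))" (is "?image \<longleftrightarrow> ?chains")
proof
  assume ?image
  then obtain y' \<gamma> where \<gamma>: "geodesic_path \<gamma> (\<pi> 0) y'" "\<forall>s\<in>{0..1}. f (retr u f (\<gamma> s)) = \<pi> s"
    unfolding image_of_geodesic_triangle_def retraction_at_eq[OF f u] by blast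
  have "retr u f (\<gamma> s) = P s" if "s \<in> {0..1}" for s
  proof -
    have "f (retr u f (\<gamma> s)) = f (P s)" using \<gamma>(2) \<pi>[OF that] that by simp
    then show ?thesis unfolding chart_inj[OF f] .
  qed
  moreover have "dist (\<gamma> s) (\<gamma> s') = dist (\<pi> 0) y' * \<bar>s - s'\<bar>" if "s \<in> {0..1}" "s' \<in> {0..1}" for s s'
    using \<gamma>(1) that by (simp add: geodesic_path_def)
  ultimately show ?chains using geodesic_lift_imp_chain[of \<gamma> "dist (\<pi> 0) y'"] by blast
next
  assume ?chains
  then obtain \<gamma> where \<gamma>: "\<gamma> 0 = f (P 0)"
    "\<forall>s\<in>{0..1}. \<forall>s'\<in>{0..1}. dist (\<gamma> s) (\<gamma> s') = c * \<bar>s - s'\<bar>" "\<forall>s\<in>{0..1}. retr u f (\<gamma> s) = P s"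
    using chain_imp_geodesic_lift[of n] unfolding t1 by blast
  obtain z0 where z0: "z0 \<in> cell u" "z = f z0" using z by blast
  obtain E where E: "E \<in> At" "agree u E f" "\<gamma> 1 \<in> range E"
    using exists_chart_extending_point[OF f u] by blast
  note retr_E = retr_chart[OF E(1) u E(2)]
  have retr_f: "retr u f (f v) = v" for v using retr_chart[OF f u] by blast
  have E1: "\<gamma> 1 = E (P 1)"
  proof -
    obtain v where v: "\<gamma> 1 = E v" using E(3) by blast
    then have "v = P 1" using \<gamma>(3)[rule_format, of 1] retr_E[of v] by simp
    with v show ?thesis by simp
  qed
  have Ez: "z = E z0" using z0 E(2) by simp
  have ends: "\<pi> 0 = f (P 0)" "\<pi> 1 = f (P 1)" using \<pi> by auto
  let ?\<rho> = "\<lambda>q. f (retr u f q)"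
  have "geodesic_path \<gamma> (\<pi> 0) (\<gamma> 1)"
  proof -
    have "dist (\<pi> 0) (\<gamma> 1) = c" using \<gamma>(1) \<gamma>(2)[rule_format, of 0 1] ends by simp
    then show ?thesis using \<gamma>(1,2) ends by (simp add: geodesic_path_def)
  qed
  moreover have "\<forall>s\<in>{0..1}. ?\<rho> (\<gamma> s) = \<pi> s" using \<gamma>(3) \<pi> by simp
  moreover have "geodesic_path (\<lambda>s. f (z0 + s *\<^sub>R (P 0 - z0))) z (\<pi> 0)"
    using straight_geodesic[OF f] z0(2) ends by simp
  moreover have "geodesic_path (?\<rho> \<circ> (\<lambda>s. f (z0 + s *\<^sub>R (P 0 - z0)))) z (\<pi> 0)"
    using straight_geodesic[OF f] z0(2) ends by (simp add: o_def retr_f)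
  moreover have "geodesic_path (\<lambda>s. E (P 1 + s *\<^sub>R (z0 - P 1))) (\<gamma> 1) z"
    using straight_geodesic[OF E(1)] E1 Ez by simp
  moreover have "geodesic_path (?\<rho> \<circ> (\<lambda>s. E (P 1 + s *\<^sub>R (z0 - P 1)))) (\<pi> 1) z"
    using straight_geodesic[OF f] z0(2) ends by (simp add: o_def retr_E)
  ultimately show ?image
    unfolding image_of_geodesic_triangle_def retraction_at_eq[OF f u, abs_def] by blast
qed

end

end

section \<open>One-sided derivatives and the theorem\<close>

lemma vector_derivative_affine_on:
  fixes F :: "real \<Rightarrow> 'a::real_normed_vector"
  assumes "a < b" "\<And>s. s \<in> {a..b} \<Longrightarrow> F s = U + s *\<^sub>R v"
  shows "vector_derivative F (at_right a) = v" "vector_derivative F (at_left b) = v"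
    and "a < s \<Longrightarrow> s < b \<Longrightarrow> vector_derivative F (at s) = v"
proof -
  have aff: "((\<lambda>s. U + s *\<^sub>R v) has_vector_derivative v) (at s within S)" for s S
    by (auto intro!: derivative_eq_intros)
  \<comment> \<open>The transfer from the affine function needs \<open>a\<close> to belong to the
    set, hence \<open>{a..}\<close> first; the right derivative follows by restriction.\<close>
  have "(F has_vector_derivative v) (at a within {a..})"
  proof (rule has_vector_derivative_transform_within[OF aff])
    show "0 < b - a" using assms(1) by simp
  qed (use assms in \<open>auto simp: dist_real_def\<close>)
  then have "(F has_vector_derivative v) (at_right a)"
    by (rule has_vector_derivative_within_subset) auto
  then show "vector_derivative F (at_right a) = v"
    by (rule vector_derivative_within[OF trivial_limit_at_right_real])
  have "(F has_vector_derivative v) (at b within {..b})"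
  proof (rule has_vector_derivative_transform_within[OF aff])
    show "0 < b - a" using assms(1) by simp
  qed (use assms in \<open>auto simp: dist_real_def\<close>)
  then have "(F has_vector_derivative v) (at_left b)"
    by (rule has_vector_derivative_within_subset) auto
  then show "vector_derivative F (at_left b) = v"
    by (rule vector_derivative_within[OF trivial_limit_at_left_real])
  assume s: "a < s" "s < b"
  have "(F has_vector_derivative v) (at s)"
    by (rule has_vector_derivative_transform_within_open[OF aff, of "{a<..<b}"]) (use s assms(2) in auto)
  then show "vector_derivative F (at s) = v" by (rule vector_derivative_at)
qed

theorem mainTheorem1:
  fixes ty :: building_kind
    and \<Phi> :: "'v::euclidean_space set"
    and At :: "('v \<Rightarrow> 'i::metric_space) set"
    and f :: "'v \<Rightarrow> 'i" and A \<aa> :: "'i set"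
    and x y z :: 'i and xs :: "nat \<Rightarrow> 'i"
    and n :: nat and t :: "nat \<Rightarrow> real" and \<pi> :: "real \<Rightarrow> 'i"
    and D :: "nat \<Rightarrow> 'v set"
  assumes "thick_building ty \<Phi> At"
    and "f \<in> At" and "range f = A"
    and "broken_line_param f n t \<pi>"
    and "\<pi> 0 = x" and "\<pi> 1 = y" and "\<And>i. i \<in> {1..n} \<Longrightarrow> xs i = \<pi> (t i)"
    and "\<aa> \<in> alcoves_of ty \<Phi> At A" and "z \<in> \<aa>"
    and "\<And>i. i \<in> {1..n} \<Longrightarrow>
           D i \<in> local_chambers ty \<Phi> (coord f (xs i)) \<and>
           (\<forall>z'\<in>\<aa>. coord f z' - coord f (xs i) \<in> D i)"
  shows "image_of_geodesic_triangle (retraction_at At A \<aa>) z x y \<pi> \<longleftrightarrow>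
    (\<forall>i\<in>{1..n}.
       weyl_chain ty \<Phi> (coord f (xs i)) (D i)
         (vector_derivative (coord f \<circ> \<pi>) (at_left (t i)))
         (vector_derivative (coord f \<circ> \<pi>) (at_right (t i))))"
proof -
  interpret thick_building ty \<Phi> At by fact
  note f = \<open>f \<in> At\<close>
  define P where "P = coord f \<circ> \<pi>"
  have "inj f" using chart_inj[OF f] by (auto intro!: injI)
  then have coord_f: "coord f (f v) = v" for v by (simp add: coord_def)
  have t: "t 0 = 0" "t (Suc n) = 1" "\<And>i. i \<le> n \<Longrightarrow> t i < t (Suc i)"
    and \<pi>_range: "\<pi> ` {0..1} \<subseteq> range f"
    and aff: "\<And>i. i \<le> n \<Longrightarrow> affine_on {t i..t (Suc i)} P"
    using assms(4) by (auto simp: broken_line_param_def P_def)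
  obtain c where c: "\<And>s. s \<in> {0..1} - t ` {0..Suc n} \<Longrightarrow> norm (vector_derivative P (at s)) = c"
    using assms(4) by (auto simp: broken_line_param_def P_def)
  have \<pi>P: "\<pi> s = f (P s)" if "s \<in> {0..1}" for s
    using \<pi>_range that coord_f by (force simp: P_def)
  have t_mono: "t i \<le> t j" if "i \<le> j" "j \<le> Suc n" for i j
    using interval_partition_mono[of n t] t(3) that by blast
  obtain U V where UV: "\<And>i s. i \<le> n \<Longrightarrow> s \<in> {t i..t (Suc i)} \<Longrightarrow> P s = U i + s *\<^sub>R V i"
    using aff unfolding affine_on_def by metis
  have P: "P s = P (t i) + (s - t i) *\<^sub>R V i" if "i \<le> n" "s \<in> {t i..t (Suc i)}" for i s
    using UV[OF that] UV[OF that(1), of "t i"] t(3)[OF that(1)] by (simp add: algebra_simps)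
  have V: "norm (V i) = c" if i: "i \<le> n" for i
  proof -
    \<comment> \<open>The midpoint of a piece is not a break point, so the constant speed holds
      there.\<close>
    define s where "s = (t i + t (Suc i)) / 2"
    have s: "t i < s" "s < t (Suc i)" using t(3)[OF i] by (auto simp: s_def)
    have "s \<notin> t ` {0..Suc n}"
    proof
      assume "s \<in> t ` {0..Suc n}"
      then obtain j where j: "j \<le> Suc n" "s = t j" by auto
      show False
        using t_mono[of j i] t_mono[of "Suc i" j] i j s by (cases "j \<le> i") auto
    qed
    moreover have "s \<in> {0..1}" using t_mono[of 0 i] t_mono[of "Suc i" "Suc n"] i s t by auto
    ultimately have "norm (vector_derivative P (at s)) = c" using c by blast
    then show ?thesis using vector_derivative_affine_on(3)[OF t(3)[OF i] UV[OF i] s] by simp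
  qed
  obtain g C where g: "g \<in> At" "range g = A" "C \<in> closed_chambers (walls ty \<Phi>)" "\<aa> = g ` C"
    using assms(8) by (auto simp: alcoves_of_def)
  then obtain w where w: "regular w" "\<aa> = g ` cell w" by (auto simp: closed_chambers_walls)
  \<comment> \<open>The alcove is given in some chart of the apartment; here it is named in the
    chart \<open>f\<close>.\<close>
  then obtain u where u: "regular u" "\<aa> = f ` cell u"
    using alcove_in_chart[OF g(1) f w(1)] g(2) assms(3) by (metis image_mono subset_UNIV)
  have "image_of_geodesic_triangle (retraction_at At A \<aa>) z x y \<pi> \<longleftrightarrow>
      (\<forall>i<n. chain (P (t (Suc i))) (u - P (t (Suc i))) (V i) (V (Suc i)))"
    using image_of_geodesic_triangle_iff_chain[OF f u(1) t P V, of z \<pi>] \<pi>P assms(3,5,6,9) u(2) by simp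
  also have "\<dots> \<longleftrightarrow> (\<forall>i<n. weyl_chain ty \<Phi> (coord f (xs (Suc i))) (D (Suc i))
         (vector_derivative P (at_left (t (Suc i)))) (vector_derivative P (at_right (t (Suc i)))))"
  proof (intro all_cong)
    fix i assume i: "i < n"
    let ?p = "P (t (Suc i))"
    have p: "coord f (xs (Suc i)) = ?p" using assms(7)[of "Suc i"] i by (simp add: P_def)
    have chamber: "D (Suc i) \<in> local_chambers ty \<Phi> ?p" "u - ?p \<in> D (Suc i)"
      using assms(10)[of "Suc i"] i u(2) mem_cell_self[of u] coord_f unfolding p by force+
    then obtain e where e: "D (Suc i) = {v. \<forall>a\<in>local_roots ty \<Phi> ?p. 0 \<le> (a \<bullet> e) * (a \<bullet> v)}"
        "\<forall>a\<in>local_roots ty \<Phi> ?p. a \<bullet> e \<noteq> 0"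
      unfolding local_chambers_eq by blast
    have reg: "local_regular ?p (u - ?p)" using local_regular_towards[OF u(1)] .
    \<comment> \<open>The vector \<open>u - ?p\<close> lies in the chamber and off the local walls,
      so it defines the same chamber as \<open>e\<close>.\<close>
    have "D (Suc i) = {v. \<forall>a\<in>local_roots ty \<Phi> ?p. 0 \<le> (a \<bullet> (u - ?p)) * (a \<bullet> v)}"
    proof -
      have "0 < (a \<bullet> e) * (a \<bullet> (u - ?p))" if "a \<in> local_roots ty \<Phi> ?p" for a
        using chamber(2) e that reg unfolding local_regular_def by (force simp: less_le)
      then show ?thesis unfolding e(1) using mult_pos_nonneg_iff by blast
    qed
    note weyl_chain_iff_chain[OF reg this]
    moreover have "vector_derivative P (at_left (t (Suc i))) = V i"
      using i by (intro vector_derivative_affine_on(2)[OF t(3) UV]) auto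
    moreover have "vector_derivative P (at_right (t (Suc i))) = V (Suc i)"
      using i by (intro vector_derivative_affine_on(1)[OF t(3) UV]) auto
    ultimately
    show "chain ?p (u - ?p) (V i) (V (Suc i)) \<longleftrightarrow> weyl_chain ty \<Phi> (coord f (xs (Suc i))) (D (Suc i))
         (vector_derivative P (at_left (t (Suc i)))) (vector_derivative P (at_right (t (Suc i))))"
      using p by simp
  qed
  \<comment> \<open>Breaks are numbered from 1: break \<open>Suc i\<close> separates pieces
    \<open>i\<close> and \<open>Suc i\<close>.\<close>
  also have "\<dots> \<longleftrightarrow> (\<forall>i\<in>{1..n}. weyl_chain ty \<Phi> (coord f (xs i)) (D i)
         (vector_derivative P (at_left (t i))) (vector_derivative P (at_right (t i))))"
    using image_Suc_lessThan[of n, symmetric] by auto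
  finally show ?thesis unfolding P_def .
qed

end
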